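(* Let $0$ be a critical point of a smooth function $f:\mathbb R^\nu\to\mathbb R$ in variables $k=(k_1,\dots,k_\nu)$, and suppose that the kernel of the second differential of $f$ at the origin coincides with the coordinate axis $Ok_1$. Then there exists a sequence of real numbers $a_\mu$, $\mu=2,3,\dots$, depending on the partial derivatives of $f$ at the origin, with the following properties. 1. $a_\mu=\frac{\partial^{\mu+1}f(0)}{\partial k_1^{\mu+1}}+P_\mu$, where $P_\mu$ is a polynomial (depending only on $\mu$ and $\nu$), with integer coefficients and vanishing free term, in the values of the partial derivatives $\frac{\partial^{i_1+\dots+i_\nu}f(0)}{\partial k_1^{i_1}\cdots\partial k_\nu^{i_\nu}}$, $3\le i_1+\dots+i_\nu\le\mu$ (except the derivatives with respect to $k_1$ only), and the components of the inverse of the matrix $\left\|\frac{\partial^2 f(0)}{\partial k_i\partial k_j}\right\|_{i,j=2,\dots,\nu}$. For $\mu=2,3,4,5$ (notation in the context): $$a_2=f_{y^3},\qquad a_3=f_{y^4}-3\,b_2^TGb_2,\qquad a_4=f_{y^5}-10\,b_2^TGb_3+15\,b_2^TGM_1Gb_2,$$ $$a_5=f_{y^6}-15\,b_2^TGb_4+60\,b_2^TGM_1Gb_3-90\,b_2^TGM_1GM_1Gb_2-10\,b_3^TGb_3+45\,b_2^TGM_2Gb_2-15\,T(Gb_2,Gb_2,Gb_2).$$ 2. For each $\mu\ge 2$, the germ of $f$ at the origin has a singularity of type $A_\mu$ if and only if $a_2=\dots=a_{\mu-1}=0$ and $a_\mu\neq0$. Moreover, if $a_2=\dots=a_{\mu-1}=0$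 and $a_\mu\ne 0$, then in some neighbourhood of the origin $f$ reduces to the form $f=a+a_\mu\tilde k_1^{\mu+1}+Q(\tilde k_2,\dots,\tilde k_\nu)$ by a regular smooth change of variables $k\to\tilde k$ leaving the origin fixed, where $a$ is a constant and $Q$ is a nondegenerate quadratic form in $\nu-1$ variables. In particular, $f\in A_\mu^+$ if $a_\mu>0$ and $f\in A_\mu^-$ if $a_\mu<0$.
   Context: A germ $f$ at a critical point $0\in\mathbb R^\nu$ has a singularity of type $A_\mu^{\pm}$ if there is a germ of diffeomorphism fixing $0$ after which $f=\mathrm{const}\pm x_1^{\mu+1}+Q(x_2,\dots,x_\nu)$ with $Q$ a nondegenerate quadratic form; type $A_\mu$ means $A_\mu^+$ or $A_\mu^-$. Notation: $y=k_1$, $z=(k_2,\dots,k_\nu)$; subscripts of $f$ denote partial derivatives at $0$, e.g. $f_{y^j}=\partial^jf(0)/\partial y^j$. $G$ is the inverse of the $(\nu-1)\times(\nu-1)$ matrix $\|\partial^2f(0)/\partial z_i\partial z_j\|$; $b_j=f_{y^jz}\in\mathbb R^{\nu-1}$ is the vector with components $\partial^{j+1}f(0)/\partial y^j\partial z_i$; $M_j=f_{y^jz^2}$ is the symmetric matrix with entries $\partial^{j+2}f(0)/\partial y^j\partial z_i\partial z_m$; $T=f_{z^3}$ is the symmetric trilinear form $T(u,v,w)=\sum \frac{\partial^3f(0)}{\partial z_i\partial z_j\partial z_m}u_iv_jw_m$. If $\nu=1$ all terms involving $z$ are absent and $a_\mu=\partial^{\mu+1}f(0)/\partial k_1^{\mu+1}$.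 *)

theory Defs
  imports "HOL-Analysis.Analysis" "HOL-Library.Multiset" "HOL-Library.Poly_Mapping"
begin

primrec Ck_on :: "nat \<Rightarrow> 'a::real_normed_vector set \<Rightarrow> ('a \<Rightarrow> 'b::real_normed_vector) \<Rightarrow> bool" where
  "Ck_on 0 S f \<longleftrightarrow> continuous_on S f"
| "Ck_on (Suc n) S f \<longleftrightarrow> (\<forall>x\<in>S. f differentiable (at x)) \<and>
     (\<forall>v. Ck_on n S (\<lambda>x. frechet_derivative f (at x) v))"

(* Intended for open S. *)
definition smooth_on :: "'a::real_normed_vector set \<Rightarrow> ('a \<Rightarrow> 'b::real_normed_vector) \<Rightarrow> bool" where
  "smooth_on S f \<longleftrightarrow> (\<forall>n. Ck_on n S f)"

(* The coordinates of R^nu are indexed by a finite linearly ordered type 'n with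
   CARD('n) = nu (so nu = 1 is allowed); its least element is the index of k_1,
   and the elements of -{k1} index z = (k_2, ..., k_nu). *)
abbreviation k1 :: "'n::{finite,linorder}" where
  "k1 \<equiv> Min UNIV"

(* The types real^'n and real^'n^'n; that notation would force the sort "finite" on 'n. *)
type_synonym 'n rvec = "(real, 'n) vec"
type_synonym 'n rmat = "((real, 'n) vec, 'n) vec"

definition partial_deriv :: "'n::finite \<Rightarrow> ('n rvec \<Rightarrow> real) \<Rightarrow> 'n rvec \<Rightarrow> real" where
  "partial_deriv i f x = frechet_derivative f (at x) (axis i 1)"

(* A multiset of coordinate indices encodes the multi-index (i_1, ..., i_nu) of its
   multiplicities; its size is i_1 + ... + i_nu. *)
definition mixed_partial ::
  "'n::{finite,linorder} multiset \<Rightarrow> ('n::{finite,linorder} rvec \<Rightarrow> real) \<Rightarrow> 'n rvec \<Rightarrow> real" where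
  "mixed_partial \<alpha> f = foldr partial_deriv (sorted_list_of_multiset \<alpha>) f"

definition second_differential ::
  "('n::finite rvec \<Rightarrow> real) \<Rightarrow> 'n rvec \<Rightarrow> 'n rvec \<Rightarrow> 'n rvec \<Rightarrow> real" where
  "second_differential f x v w =
     frechet_derivative (\<lambda>u. frechet_derivative f (at u) w) (at x) v"

definition kernel_second_differential :: "('n::finite rvec \<Rightarrow> real) \<Rightarrow> 'n rvec \<Rightarrow> 'n rvec set" where
  "kernel_second_differential f x = {v. \<forall>w. second_differential f x v w = 0}"

(* Since the type of indices of z would be empty for nu = 1, vectors and matrices
   indexed by z are padded with zeros at k1. *)

definition z_inverse :: "'n::{finite,linorder} rmat \<Rightarrow> 'n rmat" where
  "z_inverse A = (THE G.
     (\<forall>i j. i = k1 \<or> j = k1 \<longrightarrow> G $ i $ j = 0) \<and>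
     (\<forall>i j. i \<noteq> k1 \<and> j \<noteq> k1 \<longrightarrow>
        (\<Sum>l\<in>-{k1}. A $ i $ l * G $ l $ j) = (if i = j then 1 else 0) \<and>
        (\<Sum>l\<in>-{k1}. G $ i $ l * A $ l $ j) = (if i = j then 1 else 0)))"

definition Gmat :: "('n::{finite,linorder} rvec \<Rightarrow> real) \<Rightarrow> 'n rmat" where
  "Gmat f = z_inverse (\<chi> i j. mixed_partial {#i, j#} f 0)"

definition fy :: "('n::{finite,linorder} rvec \<Rightarrow> real) \<Rightarrow> nat \<Rightarrow> real" where
  "fy f j = mixed_partial (replicate_mset j k1) f 0"

definition bvec :: "('n::{finite,linorder} rvec \<Rightarrow> real) \<Rightarrow> nat \<Rightarrow> 'n rvec" where
  "bvec f j = (\<chi> i. if i = k1 then 0 else mixed_partial (replicate_mset j k1 + {#i#}) f 0)"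

definition Mmat :: "('n::{finite,linorder} rvec \<Rightarrow> real) \<Rightarrow> nat \<Rightarrow> 'n rmat" where
  "Mmat f j = (\<chi> i m. if i = k1 \<or> m = k1 then 0
                      else mixed_partial (replicate_mset j k1 + {#i, m#}) f 0)"

definition Tform ::
  "('n::{finite,linorder} rvec \<Rightarrow> real) \<Rightarrow> 'n rvec \<Rightarrow> 'n rvec \<Rightarrow> 'n rvec \<Rightarrow> real" where
  "Tform f u v w = (\<Sum>i\<in>-{k1}. \<Sum>j\<in>-{k1}. \<Sum>m\<in>-{k1}.
     mixed_partial {#i, j, m#} f 0 * u $ i * v $ j * w $ m)"

(* Polynomials with integer coefficients in variables from 'v: finitely supported maps
   from monomials (finitely supported exponent maps) to coefficients. The coefficient of
   the monomial 0 is the free term. *)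
type_synonym 'v int_mpoly = "('v \<Rightarrow>\<^sub>0 nat) \<Rightarrow>\<^sub>0 int"

definition mpoly_vars :: "'v int_mpoly \<Rightarrow> 'v set" where
  "mpoly_vars p = (\<Union>m\<in>Poly_Mapping.keys p. Poly_Mapping.keys m)"

definition mpoly_eval :: "('v \<Rightarrow> real) \<Rightarrow> 'v int_mpoly \<Rightarrow> real" where
  "mpoly_eval x p = (\<Sum>m\<in>Poly_Mapping.keys p.
     of_int (Poly_Mapping.lookup p m) *
     (\<Prod>v\<in>Poly_Mapping.keys m. x v ^ Poly_Mapping.lookup m v))"

datatype 'n jet_var = PartialVar "'n multiset" | InvVar 'n 'n

definition admissible_vars :: "nat \<Rightarrow> 'n::{finite,linorder} jet_var set" where
  "admissible_vars \<mu> =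
     {PartialVar \<alpha> | \<alpha>. 3 \<le> size \<alpha> \<and> size \<alpha> \<le> \<mu> \<and> \<not> set_mset \<alpha> \<subseteq> {k1}} \<union>
     {InvVar i j | i j. i \<noteq> k1 \<and> j \<noteq> k1}"

primrec jet_value :: "('n::{finite,linorder} rvec \<Rightarrow> real) \<Rightarrow> 'n jet_var \<Rightarrow> real" where
  "jet_value f (PartialVar \<alpha>) = mixed_partial \<alpha> f 0"
| "jet_value f (InvVar i j) = Gmat f $ i $ j"

definition nondeg_quadratic_form_z :: "('n::{finite,linorder} rvec \<Rightarrow> real) \<Rightarrow> bool" where
  "nondeg_quadratic_form_z Q \<longleftrightarrow> (\<exists>q::'n rmat. transpose q = q \<and>
     (\<forall>x. Q x = (\<Sum>i\<in>-{k1}. \<Sum>j\<in>-{k1}. q $ i $ j * x $ i * x $ j)) \<and>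
     (\<forall>u::'n rvec. (\<forall>i\<in>-{k1}. (\<Sum>j\<in>-{k1}. q $ i $ j * u $ j) = 0) \<longrightarrow>
        (\<forall>j\<in>-{k1}. u $ j = 0)))"

(* f takes the form h in the coordinates \<phi>(k), where \<phi> is a germ at 0 of a
   diffeomorphism fixing 0. *)
definition reduces_to :: "('a::real_normed_vector \<Rightarrow> real) \<Rightarrow> ('a \<Rightarrow> real) \<Rightarrow> bool" where
  "reduces_to f h \<longleftrightarrow> (\<exists>U V \<phi> \<psi>. open U \<and> open V \<and> 0 \<in> U \<and> 0 \<in> V \<and>
     homeomorphism U V \<phi> \<psi> \<and> smooth_on U \<phi> \<and> smooth_on V \<psi> \<and> \<phi> 0 = 0 \<and>
     (\<forall>k\<in>U. f k = h (\<phi> k)))"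

definition type_A_plus :: "nat \<Rightarrow> ('n::{finite,linorder} rvec \<Rightarrow> real) \<Rightarrow> bool" where
  "type_A_plus \<mu> f \<longleftrightarrow> (\<exists>c Q. nondeg_quadratic_form_z Q \<and>
     reduces_to f (\<lambda>x. c + (x $ k1) ^ (\<mu> + 1) + Q x))"

definition type_A_minus :: "nat \<Rightarrow> ('n::{finite,linorder} rvec \<Rightarrow> real) \<Rightarrow> bool" where
  "type_A_minus \<mu> f \<longleftrightarrow> (\<exists>c Q. nondeg_quadratic_form_z Q \<and>
     reduces_to f (\<lambda>x. c - (x $ k1) ^ (\<mu> + 1) + Q x))"

definition type_A :: "nat \<Rightarrow> ('n::{finite,linorder} rvec \<Rightarrow> real) \<Rightarrow> bool" where
  "type_A \<mu> f \<longleftrightarrow> type_A_plus \<mu> f \<or> type_A_minus \<mu> f"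

end

theory Submission
  imports Defs
begin

text \<open>
  Write \<open>k = (y, z)\<close>. Instead of solving \<open>f\<^sub>z = 0\<close> for \<open>z\<close> by the implicit function theorem, one only solves it
  formally: a polynomial curve \<open>\<gamma> y = (y, \<Sum>\<^sub>j c\<^sub>j y\<^sup>j / j!)\<close> with \<open>f\<^sub>z (\<gamma> y) = O(y\<^sup>N\<^sup>+\<^sup>1)\<close> is obtained by the recursion
  \<open>c\<^sub>j = - G r\<^sub>j\<close>, where \<open>r\<^sub>j\<close> collects the terms of the \<open>j\<close>-th derivative of \<open>f\<^sub>z \<circ> \<gamma>\<close> that involve only earlier \<open>c\<^sub>i\<close>;
  these are integer polynomials. Then \<open>a\<^sub>\<mu>\<close> is the derivative of order \<open>\<mu> + 1\<close> of \<open>f \<circ> \<gamma>\<close> at 0, and the terms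
  containing \<open>f\<^sub>z\<^sub>z\<close> are removed with \<open>f\<^sub>z\<^sub>z c\<^sub>j = - r\<^sub>j\<close>.

  For the normal form take \<open>N = \<mu>\<close>. Taylor's formula around the curve gives
  \<open>f = c + y\<^sup>\<mu>\<^sup>+\<^sup>1 (u y + \<Sum> z\<^sub>i \<rho>\<^sub>i y) + z\<^sup>T B z\<close> (with \<open>z\<close> measured from the curve) where \<open>u\<close>, \<open>\<rho>\<^sub>i\<close>, \<open>B\<close> are smooth and
  \<open>(\<mu> + 1)! u 0 = a\<^sub>\<mu>\<close>. The first bracket is absorbed into \<open>y\<close> by a \<open>(\<mu> + 1)\<close>-st root and \<open>B\<close> is made constant by a matrix
  square root, which the inverse function theorem provides. Conversely, the gradients of \<open>f\<close> and of a normal form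
  have the same order of vanishing along corresponding curves, and this order determines the first nonzero \<open>a\<^sub>j\<close>.
\<close>

subsection \<open>Calculus of smooth functions\<close>

text \<open>Only mixed derivatives of orders 3 to \<mu> and entries of \<open>G\<close> may occur in
  P_\<mu>, with integer coefficients. The coefficients are integers because a_\<mu> is a derivative
  and not a Taylor coefficient: the chain rule merely counts terms. The upper bound on the order
  looks false at first, since the derivative of order \<mu> + 1 along the curve involves all
  derivatives of f of that order; but each such term except the pure one contains c_1, and c_1 = 0
  because f_yz vanishes at 0. For the lower bound, f_z and f_yz vanish at 0, so that only f_zz has
  to be traded for \<open>G\<close>. A polynomial curve is smooth on the whole line and its
  derivatives at 0 are its coefficients, whereas an exact solution of f_z = 0 would be local and its
  derivatives would still have to be computed. Cutting it off at order N costs nothing: c_(N+1)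
  would enter the derivative of order N + 1 of f along the curve only through f_z(0) = 0.\<close>

lemma Ck_on_cong_imp:
  assumes "open S" "\<And>x. x \<in> S \<Longrightarrow> f x = g x" "Ck_on n S f"
  shows "Ck_on n S g"
  using assms(2,3)
proof (induction n arbitrary: f g)
  case 0
  then show ?case by (simp cong: continuous_on_cong)
next
  case (Suc n)
  have D: "(g has_derivative frechet_derivative f (at x)) (at x)" if "x \<in> S" for x
  proof -
    have "(f has_derivative frechet_derivative f (at x)) (at x)"
      using Suc.prems(2) that by (simp flip: frechet_derivative_works)
    then show ?thesis
      by (rule has_derivative_transform_within_open[OF _ assms(1) that]) (use Suc.prems(1) in auto)
  qed
  have eq: "frechet_derivative f (at x) = frechet_derivative g (at x)" if "x \<in> S" for x
    using D[OF that] by (rule frechet_derivative_at)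
  have "Ck_on n S (\<lambda>x. frechet_derivative g (at x) v)" for v
    by (rule Suc.IH[of "\<lambda>x. frechet_derivative f (at x) v"]) (use Suc.prems(2) eq in auto)
  then show ?case using D by (auto simp: differentiable_def)
qed

lemma Ck_on_SucI:
  assumes "open S" and D: "\<And>x. x \<in> S \<Longrightarrow> (f has_derivative f' x) (at x)"
    and C: "\<And>v. Ck_on n S (\<lambda>x. f' x v)"
  shows "Ck_on (Suc n) S f"
proof -
  have "frechet_derivative f (at x) = f' x" if "x \<in> S" for x
    using frechet_derivative_at[OF D[OF that]] by simp
  then have "Ck_on n S (\<lambda>x. frechet_derivative f (at x) v)" for v
    by (intro Ck_on_cong_imp[OF assms(1) _ C[of v]]) auto
  then show ?thesis using D by (auto simp: differentiable_def)
qed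

lemma Ck_on_SucD:
  assumes "Ck_on (Suc n) S f"
  shows "\<And>x. x \<in> S \<Longrightarrow> (f has_derivative frechet_derivative f (at x)) (at x)"
    and "\<And>v. Ck_on n S (\<lambda>x. frechet_derivative f (at x) v)"
  using assms by (auto simp flip: frechet_derivative_works)

lemma Ck_on_pred: "Ck_on (Suc n) S f \<Longrightarrow> Ck_on n S f"
proof (induction n arbitrary: f)
  case 0
  then show ?case
    by (auto intro!: continuous_at_imp_continuous_on differentiable_imp_continuous_within)
next
  case (Suc n)
  note D = Ck_on_SucD[OF Suc.prems]
  show ?case using D(1) Suc.IH[OF D(2)] by (auto simp: differentiable_def)
qed

lemma Ck_on_subset: "Ck_on n S f \<Longrightarrow> T \<subseteq> S \<Longrightarrow> Ck_on n T f"
  by (induction n arbitrary: f) (auto intro: continuous_on_subset)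

lemma Ck_on_const [simp]: "Ck_on n S (\<lambda>x. c)"
  by (induction n arbitrary: c) auto

lemma Ck_on_bounded_linear:
  assumes "open S" "bounded_linear L" "Ck_on n S f"
  shows "Ck_on n S (\<lambda>x. L (f x))"
  using assms(3)
proof (induction n arbitrary: f)
  case 0
  then show ?case using assms(2) by (auto intro: bounded_linear.continuous_on)
next
  case (Suc n)
  note D = Ck_on_SucD[OF Suc.prems]
  show ?case
    by (rule Ck_on_SucI[OF assms(1) bounded_linear.has_derivative[OF assms(2) D(1)]])
      (auto intro: Suc.IH D(2))
qed

lemma Ck_on_linear:
  assumes "open S" "bounded_linear L"
  shows "Ck_on n S L"
proof (cases n)
  case 0
  then show ?thesis by (simp add: linear_continuous_on assms)
next
  case (Suc m)
  show ?thesis unfolding Suc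
    by (rule Ck_on_SucI[OF assms(1), where f' = "\<lambda>_. L"])
      (use assms in \<open>auto intro: bounded_linear_imp_has_derivative\<close>)
qed

lemma Ck_on_ident: "open S \<Longrightarrow> Ck_on n S (\<lambda>x. x)"
  by (rule Ck_on_linear) auto

lemma Ck_on_add:
  assumes "open S" "Ck_on n S f" "Ck_on n S g"
  shows "Ck_on n S (\<lambda>x. f x + g x)"
  using assms(2,3)
proof (induction n arbitrary: f g)
  case 0
  then show ?case by (auto intro!: continuous_intros)
next
  case (Suc n)
  note D = Ck_on_SucD[OF Suc.prems(1)] Ck_on_SucD[OF Suc.prems(2)]
  show ?case
    by (rule Ck_on_SucI[OF assms(1) has_derivative_add[OF D(1) D(3)]])
      (auto intro: Suc.IH D(2,4))
qed

lemma Ck_on_sum: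
  assumes "open S" "\<And>i. i \<in> I \<Longrightarrow> Ck_on n S (f i)"
  shows "Ck_on n S (\<lambda>x. \<Sum>i\<in>I. f i x)"
  using assms(2)
proof (induction I rule: infinite_finite_induct)
  case (insert i I)
  then show ?case using Ck_on_add[OF assms(1), of n "f i"] by simp
qed simp_all

lemma Ck_on_bilinear:
  assumes "open S" "bounded_bilinear p" "Ck_on n S f" "Ck_on n S g"
  shows "Ck_on n S (\<lambda>x. p (f x) (g x))"
  using assms(3,4)
proof (induction n arbitrary: f g)
  case 0
  then show ?case using assms(2) by (auto intro: bounded_bilinear.continuous_on)
next
  case (Suc n)
  note D = Ck_on_SucD[OF Suc.prems(1)] Ck_on_SucD[OF Suc.prems(2)]
  have "Ck_on n S (\<lambda>x. p (f x) (frechet_derivative g (at x) v) + p (frechet_derivative f (at x) v) (g x))" for v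
    by (rule Ck_on_add[OF assms(1) Suc.IH[OF Ck_on_pred[OF Suc.prems(1)] D(4)]
          Suc.IH[OF D(2) Ck_on_pred[OF Suc.prems(2)]]])
  with bounded_bilinear.FDERIV[OF assms(2) D(1) D(3)] show ?case
    by (rule Ck_on_SucI[OF assms(1)]) auto
qed

lemma Ck_on_prod:
  fixes f :: "'i \<Rightarrow> 'a::real_normed_vector \<Rightarrow> real"
  assumes "open S" "\<And>i. i \<in> I \<Longrightarrow> Ck_on n S (f i)"
  shows "Ck_on n S (\<lambda>x. \<Prod>i\<in>I. f i x)"
  using assms(2)
proof (induction I rule: infinite_finite_induct)
  case (insert i I)
  then show ?case using Ck_on_bilinear[OF assms(1) bounded_bilinear_mult, of n "f i"] by simp
qed simp_all

text \<open>In the chain rule both the base point and the direction of the outer derivative depend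
  on x, so the induction hypothesis does not apply to it directly. Expanding the direction in the
  basis leaves scalar coefficients times derivatives of \<open>g\<close> in fixed
  directions.\<close>

lemma Ck_on_compose:
  fixes f :: "'a::real_normed_vector \<Rightarrow> 'b::euclidean_space"
  assumes "open S" "open T" "\<And>x. x \<in> S \<Longrightarrow> f x \<in> T" "Ck_on n S f" "Ck_on n T g"
  shows "Ck_on n S (\<lambda>x. g (f x))"
  using assms(4,5)
proof (induction n arbitrary: g)
  case 0
  then show ?case using assms(3) by (auto intro: continuous_on_compose2)
next
  case (Suc n)
  note D = Ck_on_SucD[OF Suc.prems(1)] Ck_on_SucD[OF Suc.prems(2)]
  let ?D = "\<lambda>x v. frechet_derivative f (at x) v"
  let ?E = "\<lambda>x. frechet_derivative g (at (f x))"
  have der: "((\<lambda>x. g (f x)) has_derivative (\<lambda>v. \<Sum>b\<in>Basis. (?D x v \<bullet> b) *\<^sub>R ?E x b)) (at x)"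
    if "x \<in> S" for x
  proof -
    have "((\<lambda>x. g (f x)) has_derivative (\<lambda>v. ?E x (?D x v))) (at x)"
      using D(1)[OF that] D(3)[OF assms(3)[OF that]] by (rule has_derivative_compose)
    moreover have *: "?E x w = (\<Sum>b\<in>Basis. (w \<bullet> b) *\<^sub>R ?E x b)" for w
    proof -
      have "linear (?E x)" using D(3)[OF assms(3)[OF that]] by (rule has_derivative_linear)
      then have "?E x (\<Sum>b\<in>Basis. (w \<bullet> b) *\<^sub>R b) = (\<Sum>b\<in>Basis. (w \<bullet> b) *\<^sub>R ?E x b)"
        by (simp add: linear_sum linear_cmul)
      then show ?thesis by (simp add: euclidean_representation)
    qed
    ultimately show ?thesis by (subst ext[OF *, symmetric])
  qed
  have "Ck_on n S (\<lambda>x. \<Sum>b\<in>Basis. (?D x v \<bullet> b) *\<^sub>R ?E x b)" for v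
  proof (rule Ck_on_sum[OF assms(1)])
    fix b :: 'b
    have "Ck_on n S (\<lambda>x. ?D x v \<bullet> b)"
      by (rule Ck_on_bounded_linear[OF assms(1) bounded_linear_inner_left D(2)])
    moreover have "Ck_on n S (\<lambda>x. ?E x b)"
      by (rule Suc.IH[OF Ck_on_pred[OF Suc.prems(1)] D(4)])
    ultimately show "Ck_on n S (\<lambda>x. (?D x v \<bullet> b) *\<^sub>R ?E x b)"
      by (rule Ck_on_bilinear[OF assms(1) bounded_bilinear_scaleR])
  qed
  with der show ?case by (rule Ck_on_SucI[OF assms(1)])
qed

lemma Ck_on_power:
  fixes f :: "'a::real_normed_vector \<Rightarrow> real"
  shows "open S \<Longrightarrow> Ck_on n S f \<Longrightarrow> Ck_on n S (\<lambda>x. f x ^ m)"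
  using Ck_on_prod[of S "{..<m}" n "\<lambda>_. f"] by simp

lemma Ck_on_inverse: "Ck_on n (- {0::real}) inverse"
proof (induction n)
  case 0
  then show ?case by (auto intro!: continuous_intros)
next
  case (Suc n)
  have o: "open (- {0::real})" by auto
  have "Ck_on n (- {0::real}) (\<lambda>x. - (inverse x * v * inverse x))" for v
    by (rule Ck_on_bounded_linear[OF o bounded_linear_minus[OF bounded_linear_ident]])
      (rule Ck_on_bilinear[OF o bounded_bilinear_mult] Suc.IH Ck_on_const)+
  then show ?case
    by (rule Ck_on_SucI[OF o, rotated]) (auto intro: has_derivative_inverse')
qed

lemma Ck_on_powr: "Ck_on n {0<..} (\<lambda>x::real. x powr a)"
proof (induction n arbitrary: a)
  case 0
  then show ?case by (auto intro!: continuous_intros)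
next
  case (Suc n)
  have o: "open {0::real<..}" by auto
  have "Ck_on n {0<..} (\<lambda>x. v * (a * x powr (a - 1)))" for v
    by (intro Ck_on_bilinear[OF o bounded_bilinear_mult] Suc.IH Ck_on_const)
  moreover have "((\<lambda>x. x powr a) has_derivative (\<lambda>v. v * (a * x powr (a - 1)))) (at x)"
    if "x \<in> {0<..}" for x :: real
  proof -
    have "(*) (a * x powr (a - 1)) = (\<lambda>v. v * (a * x powr (a - 1)))" by (simp add: fun_eq_iff)
    then show ?thesis using has_real_derivative_powr[of x a] that by (simp add: has_field_derivative_def)
  qed
  ultimately show ?case by (rule Ck_on_SucI[OF o, rotated])
qed

lemma Ck_on_vec_lambda:
  fixes f :: "'n::finite \<Rightarrow> 'a::real_normed_vector \<Rightarrow> real"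
  assumes "open S" "\<And>i. Ck_on n S (f i)"
  shows "Ck_on n S (\<lambda>x. \<chi> i. f i x)"
proof -
  have eq: "(\<chi> i. f i x) = (\<Sum>i\<in>UNIV. f i x *\<^sub>R axis i (1::real))" for x
    by (simp add: vec_eq_iff axis_def if_distrib[of "\<lambda>u. _ * u"] sum.delta' cong: if_cong)
  show ?thesis unfolding eq
    by (intro Ck_on_sum Ck_on_bilinear[OF _ bounded_bilinear_scaleR] assms Ck_on_const)
qed

lemma Ck_on_nth:
  "open S \<Longrightarrow> Ck_on n S f \<Longrightarrow> Ck_on n S (\<lambda>x. (f x :: real ^ 'n::finite) $ i)"
  by (rule Ck_on_bounded_linear[OF _ bounded_linear_vec_nth])

text \<open>By Cramer's rule the entries of the inverse are rational functions of the entries of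
  \<open>A y\<close>.\<close>

lemma Ck_on_inv_linear:
  fixes A :: "'a::real_normed_vector \<Rightarrow> real ^ 'n::finite \<Rightarrow> real ^ 'n"
  assumes S: "open S" and C: "\<And>w. Ck_on n S (\<lambda>y. A y w)"
    and lin: "\<And>y. y \<in> S \<Longrightarrow> linear (A y)" and bij: "\<And>y. y \<in> S \<Longrightarrow> bij (A y)"
  shows "Ck_on n S (\<lambda>y. inv (A y) v)"
proof -
  let ?d = "\<lambda>y. det (matrix (A y))"
  let ?c = "\<lambda>y k. det (\<chi> i j. if j = k then v $ i else matrix (A y) $ i $ j)"
  have entry: "Ck_on n S (\<lambda>y. matrix (A y) $ i $ j)" for i j
    unfolding matrix_def using Ck_on_nth[OF S C] by simp
  have det: "Ck_on n S (\<lambda>y. det (B y))" if "\<And>i j. Ck_on n S (\<lambda>y. B y $ i $ j)" for B :: "'a \<Rightarrow> real ^ 'n ^ 'n"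
    unfolding det_def
    by (intro Ck_on_sum S Ck_on_bilinear[OF S bounded_bilinear_mult] Ck_on_const Ck_on_prod that)
  have mw: "matrix (A y) *v x = A y x" if "y \<in> S" for y x
    using matrix_vector_mul(1)[of "A y"] lin[OF that] matrix_vector_mul(2)[of "A y"] by metis
  have nz: "?d y \<noteq> 0" if "y \<in> S" for y
  proof -
    have "inj ((*v) (matrix (A y)))"
      using bij_is_inj[OF bij[OF that]] mw[OF that] by (simp add: inj_def)
    then show ?thesis
      by (metis invertible_det_nz matrix_left_invertible_injective invertible_left_inverse)
  qed
  have eq: "inv (A y) v = (\<chi> k. ?c y k * inverse (?d y))" if "y \<in> S" for y
  proof -
    have "matrix (A y) *v (inv (A y) v) = v"
      using mw[OF that] bij[OF that] by (simp add: bij_is_surj surj_f_inv_f)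
    then show ?thesis
      using cramer[OF nz[OF that]] by (simp add: divide_inverse)
  qed
  have "Ck_on n S (\<lambda>y. \<chi> k. ?c y k * inverse (?d y))"
  proof (intro Ck_on_vec_lambda S Ck_on_bilinear[OF S bounded_bilinear_mult] det)
    show "Ck_on n S (\<lambda>y. inverse (?d y))"
      by (rule Ck_on_compose[OF S _ _ det Ck_on_inverse]) (use nz entry in auto)
    show "Ck_on n S (\<lambda>y. (\<chi> i j. if j = k then v $ i else matrix (A y) $ i $ j) $ i $ j)" for k i j
      using entry by (cases "j = k") auto
  qed
  then show ?thesis by (rule Ck_on_cong_imp[OF S, rotated]) (use eq in auto)
qed

section \<open>Smooth functions\<close>

lemma smooth_onD:
  assumes "smooth_on S f"
  shows "x \<in> S \<Longrightarrow> (f has_derivative frechet_derivative f (at x)) (at x)"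
    and "smooth_on S (\<lambda>x. frechet_derivative f (at x) v)"
    and "continuous_on S f"
proof -
  have *: "Ck_on (Suc n) S f" for n using assms by (auto simp: smooth_on_def simp del: Ck_on.simps)
  show "x \<in> S \<Longrightarrow> (f has_derivative frechet_derivative f (at x)) (at x)"
    by (rule Ck_on_SucD(1)[OF *])
  show "smooth_on S (\<lambda>x. frechet_derivative f (at x) v)"
    using Ck_on_SucD(2)[OF *] by (simp add: smooth_on_def)
  show "continuous_on S f" using assms unfolding smooth_on_def by (metis Ck_on.simps(1))
qed

lemma smooth_on_subset: "smooth_on S f \<Longrightarrow> T \<subseteq> S \<Longrightarrow> smooth_on T f"
  unfolding smooth_on_def by (blast intro: Ck_on_subset)

lemma smooth_on_const: "smooth_on S (\<lambda>x. c)"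
  by (simp add: smooth_on_def)

lemma smooth_on_linear: "open S \<Longrightarrow> bounded_linear L \<Longrightarrow> smooth_on S L"
  by (simp add: smooth_on_def Ck_on_linear)

lemma smooth_on_ident: "open S \<Longrightarrow> smooth_on S (\<lambda>x. x)"
  by (simp add: smooth_on_def Ck_on_ident)

lemma smooth_on_bounded_linear:
  "open S \<Longrightarrow> bounded_linear L \<Longrightarrow> smooth_on S f \<Longrightarrow> smooth_on S (\<lambda>x. L (f x))"
  unfolding smooth_on_def by (rule allI, rule Ck_on_bounded_linear) auto

lemma smooth_on_add:
  "open S \<Longrightarrow> smooth_on S f \<Longrightarrow> smooth_on S g \<Longrightarrow> smooth_on S (\<lambda>x. f x + g x)"
  unfolding smooth_on_def by (rule allI, rule Ck_on_add) auto

lemma smooth_on_minus: "open S \<Longrightarrow> smooth_on S f \<Longrightarrow> smooth_on S (\<lambda>x. - f x)"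
  using smooth_on_bounded_linear[OF _ bounded_linear_minus[OF bounded_linear_ident]] by auto

lemma smooth_on_diff:
  "open S \<Longrightarrow> smooth_on S f \<Longrightarrow> smooth_on S g \<Longrightarrow> smooth_on S (\<lambda>x. f x - g x)"
  using smooth_on_add[of S f "\<lambda>x. - g x"] smooth_on_minus[of S g] by simp

lemma smooth_on_sum:
  "open S \<Longrightarrow> (\<And>i. i \<in> I \<Longrightarrow> smooth_on S (f i)) \<Longrightarrow> smooth_on S (\<lambda>x. \<Sum>i\<in>I. f i x)"
  unfolding smooth_on_def by (rule allI, rule Ck_on_sum) auto

lemma smooth_on_mult:
  fixes f g :: "'a::real_normed_vector \<Rightarrow> real"
  shows "open S \<Longrightarrow> smooth_on S f \<Longrightarrow> smooth_on S g \<Longrightarrow> smooth_on S (\<lambda>x. f x * g x)"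
  unfolding smooth_on_def by (rule allI, rule Ck_on_bilinear[OF _ bounded_bilinear_mult]) auto

lemma smooth_on_scaleR:
  "open S \<Longrightarrow> smooth_on S f \<Longrightarrow> smooth_on S g \<Longrightarrow> smooth_on S (\<lambda>x. f x *\<^sub>R g x)"
  unfolding smooth_on_def by (rule allI, rule Ck_on_bilinear[OF _ bounded_bilinear_scaleR]) auto

lemma smooth_on_power:
  fixes f :: "'a::real_normed_vector \<Rightarrow> real"
  shows "open S \<Longrightarrow> smooth_on S f \<Longrightarrow> smooth_on S (\<lambda>x. f x ^ m)"
  unfolding smooth_on_def by (rule allI, rule Ck_on_power) auto

lemma smooth_on_vec_lambda:
  fixes f :: "'n::finite \<Rightarrow> 'a::real_normed_vector \<Rightarrow> real"
  shows "open S \<Longrightarrow> (\<And>i. smooth_on S (f i)) \<Longrightarrow> smooth_on S (\<lambda>x. \<chi> i. f i x)"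
  unfolding smooth_on_def by (rule allI, rule Ck_on_vec_lambda) auto

lemma smooth_on_nth:
  "open S \<Longrightarrow> smooth_on S f \<Longrightarrow> smooth_on S (\<lambda>x. (f x :: real ^ 'n::finite) $ i)"
  unfolding smooth_on_def by (rule allI, rule Ck_on_nth) auto

lemma smooth_on_compose:
  fixes f :: "'a::real_normed_vector \<Rightarrow> 'b::euclidean_space"
  assumes "open S" "open T" "smooth_on S f" "smooth_on T g" "\<And>x. x \<in> S \<Longrightarrow> f x \<in> T"
  shows "smooth_on S (\<lambda>x. g (f x))"
  using assms Ck_on_compose[of S T f _ g] by (simp add: smooth_on_def)

lemma smooth_on_compose_UNIV:
  fixes f :: "'a::real_normed_vector \<Rightarrow> 'b::euclidean_space"
  assumes "smooth_on UNIV g" "open S" "smooth_on S f"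
  shows "smooth_on S (\<lambda>x. g (f x))"
  using smooth_on_compose[of S UNIV f g] assms by simp

lemma smooth_on_powr:
  fixes f :: "'a::real_normed_vector \<Rightarrow> real"
  assumes "open S" "smooth_on S f" "\<And>x. x \<in> S \<Longrightarrow> f x > 0"
  shows "smooth_on S (\<lambda>x. f x powr a)"
  using smooth_on_compose[of S "{0<..}" f "\<lambda>x. x powr a"] assms
  by (simp add: smooth_on_def Ck_on_powr)

lemma smooth_on_divide_const:
  fixes f :: "'a::real_normed_vector \<Rightarrow> real"
  shows "open S \<Longrightarrow> smooth_on S f \<Longrightarrow> smooth_on S (\<lambda>x. f x / c)"
  unfolding divide_inverse by (rule smooth_on_mult) (auto intro: smooth_on_const)

lemmas smooth_intros = smooth_on_const smooth_on_ident smooth_on_add smooth_on_minus smooth_on_diff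
  smooth_on_sum smooth_on_mult smooth_on_scaleR smooth_on_power smooth_on_vec_lambda smooth_on_nth
  smooth_on_divide_const open_UNIV

text \<open>The inverse function theorem supplies a differentiable inverse whose derivative is
  \<open>inv (D (\<psi> y))\<close>. If \<open>\<psi>\<close> is C^n then so is this derivative, by
  composition and Cramer's rule, and therefore \<open>\<psi>\<close> is C^(n+1).\<close>

lemma smooth_inverse_function:
  fixes \<phi> :: "real ^ 'n::finite \<Rightarrow> real ^ 'n"
  assumes "open U" "0 \<in> U" and sm: "smooth_on U \<phi>" and \<phi>0: "\<phi> 0 = 0"
    and inj: "\<And>v. frechet_derivative \<phi> (at 0) v = 0 \<Longrightarrow> v = 0"
  obtains U' V \<psi> where "open U'" "U' \<subseteq> U" "0 \<in> U'" "open V" "0 \<in> V"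
    "homeomorphism U' V \<phi> \<psi>" "smooth_on V \<psi>"
proof -
  define D where "D x = Blinfun (frechet_derivative \<phi> (at x))" for x
  have D: "blinfun_apply (D x) = frechet_derivative \<phi> (at x)" if "x \<in> U" for x
    unfolding D_def using smooth_onD(1)[OF sm that]
    by (intro bounded_linear_Blinfun_apply has_derivative_bounded_linear)
  have der: "(\<phi> has_derivative blinfun_apply (D x)) (at x)" if "x \<in> U" for x
    using smooth_onD(1)[OF sm that] D[OF that] by simp
  have cont: "continuous_on U D"
  proof (rule continuous_on_blinfun_componentwise)
    fix i :: "real ^ 'n"
    have "continuous_on U (\<lambda>x. frechet_derivative \<phi> (at x) i)"
      using smooth_onD(2)[OF sm] by (rule smooth_onD(3))
    then show "continuous_on U (\<lambda>x. blinfun_apply (D x) i)"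
      by (simp add: D cong: continuous_on_cong)
  qed
  let ?L = "frechet_derivative \<phi> (at 0)"
  have lin: "linear ?L"
    using smooth_onD(1)[OF sm assms(2)] by (rule has_derivative_linear)
  have "inj ?L" using inj linear_injective_0[OF lin] by blast
  then obtain g where g: "linear g" "g \<circ> ?L = id"
    using linear_injective_left_inverse[OF lin] by blast
  have "Blinfun g o\<^sub>L D 0 = id_blinfun"
    using g(2) by (intro blinfun_eqI) (simp add: bounded_linear_Blinfun_apply linear_linear g(1) D[OF assms(2)] fun_eq_iff)
  from inverse_function_theorem[OF assms(1) der cont assms(2) this]
  obtain U' V \<psi> \<psi>' where I: "open U'" "U' \<subseteq> U" "0 \<in> U'" "open V" "\<phi> 0 \<in> V" "homeomorphism U' V \<phi> \<psi>"
    "\<And>y. y \<in> V \<Longrightarrow> (\<psi> has_derivative (\<psi>' y)) (at y)"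
    "\<And>y. y \<in> V \<Longrightarrow> \<psi>' y = inv (blinfun_apply (D (\<psi> y)))"
    "\<And>y. y \<in> V \<Longrightarrow> bij (blinfun_apply (D (\<psi> y)))"
    by (metis (no_types, lifting))
  have \<psi>U: "\<psi> y \<in> U" if "y \<in> V" for y
    using I(2,6) that by (auto simp: homeomorphism_def)
  have "Ck_on n V \<psi>" for n
  proof (induction n)
    case 0
    then show ?case using I(6) by (simp add: homeomorphism_def)
  next
    case (Suc n)
    have "Ck_on n V (\<lambda>y. inv (blinfun_apply (D (\<psi> y))) v)" for v
    proof (rule Ck_on_inv_linear[OF I(4)])
      fix w
      have "Ck_on n U (\<lambda>x. frechet_derivative \<phi> (at x) w)"
        using smooth_onD(2)[OF sm] by (simp add: smooth_on_def)
      from Ck_on_compose[OF I(4) assms(1) \<psi>U Suc this]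
      show "Ck_on n V (\<lambda>y. blinfun_apply (D (\<psi> y)) w)"
        by (rule Ck_on_cong_imp[OF I(4), rotated]) (auto simp: D \<psi>U)
    qed (auto simp: I(9) blinfun.bounded_linear_right bounded_linear.linear)
    then have "Ck_on n V (\<lambda>y. \<psi>' y v)" for v
      by (rule Ck_on_cong_imp[OF I(4), rotated]) (simp add: I(8))
    with I(7) show ?case by (rule Ck_on_SucI[OF I(4)])
  qed
  then have "smooth_on V \<psi>" by (simp add: smooth_on_def)
  with I \<phi>0 show thesis by (intro that) auto
qed

section \<open>Parametric integrals, division by powers, symmetry of second derivatives\<close>

lemma parametric_integral_has_derivative:
  fixes G :: "'a::euclidean_space \<times> real \<Rightarrow> real"
  assumes "smooth_on UNIV G"
  shows "((\<lambda>x. integral {0..1} (\<lambda>t. G (x, t))) has_derivative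
     (\<lambda>v. integral {0..1} (\<lambda>t. frechet_derivative G (at (x, t)) (v, 0)))) (at x)"
proof -
  let ?g = "\<lambda>x t v. frechet_derivative G (at (x, t)) (v, 0)"
  have der: "((\<lambda>x. G (x, t)) has_derivative ?g x t) (at x)" for x t
  proof -
    have "((\<lambda>x. (x, t)) has_derivative (\<lambda>v. (v, 0))) (at x)"
      by (auto intro!: derivative_eq_intros)
    from has_derivative_compose[OF this] smooth_onD(1)[OF assms] show ?thesis by fast
  qed
  \<comment> \<open>The Leibniz rule asks for the derivative as a continuous map into bounded linear
    operators; in finite dimensions continuity in each fixed direction suffices.\<close>
  define D where "D x t = Blinfun (?g x t)" for x t
  have D: "blinfun_apply (D x t) = ?g x t" for x t
    unfolding D_def using has_derivative_bounded_linear[OF der]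
    by (rule bounded_linear_Blinfun_apply)
  have contg: "continuous_on UNIV (\<lambda>z. frechet_derivative G (at z) v)" for v
    using smooth_onD(2)[OF assms] by (rule smooth_onD(3))
  have "continuous_on UNIV (\<lambda>z. D (fst z) (snd z))"
    by (rule continuous_on_blinfun_componentwise) (simp add: D contg)
  then have contD: "continuous_on (UNIV \<times> cbox 0 1) (\<lambda>(x, t). D x t)"
    by (auto intro: continuous_on_subset simp: split_beta)
  have intG: "(\<lambda>t. G (x, t)) integrable_on cbox 0 1" for x
    by (intro integrable_continuous continuous_on_compose2[OF smooth_onD(3)[OF assms]] continuous_intros) auto
  have intD: "(\<lambda>t. D x t) integrable_on cbox 0 1" for x
    by (intro integrable_continuous continuous_on_compose2[OF contD, of _ "\<lambda>t. (x, t)", simplified] continuous_intros) auto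
  have *: "((\<lambda>x. integral (cbox 0 1) (\<lambda>t. G (x, t))) has_derivative integral (cbox 0 1) (D x)) (at x)"
    using leibniz_rule[of UNIV 0 1 "\<lambda>x t. G (x, t)" D x] der D contD intG by simp
  have "blinfun_apply (integral (cbox 0 1) (D x)) v = integral (cbox 0 1) (\<lambda>t. ?g x t v)" for v
  proof -
    have "integral (cbox 0 1) ((\<lambda>L. blinfun_apply L v) \<circ> D x) = blinfun_apply (integral (cbox 0 1) (D x)) v"
      by (rule integral_linear[OF intD]) (rule bounded_linear_intros)+
    then show ?thesis by (simp add: D o_def)
  qed
  then have "blinfun_apply (integral (cbox 0 1) (D x)) = (\<lambda>v. integral (cbox 0 1) (\<lambda>t. ?g x t v))"
    by (rule ext)
  with * show ?thesis by simp
qed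

lemma parametric_integral_has_derivative':
  fixes G :: "'a::euclidean_space \<times> real \<Rightarrow> real"
  assumes "smooth_on UNIV G" and g: "\<And>t. ((\<lambda>x. G (x, t)) has_derivative g t) (at x)"
  shows "((\<lambda>x. integral {0..1} (\<lambda>t. G (x, t))) has_derivative (\<lambda>v. integral {0..1} (\<lambda>t. g t v))) (at x)"
proof -
  have "frechet_derivative G (at (x, t)) (v, 0) = g t v" for t v
  proof -
    have "((\<lambda>x. (x, t)) has_derivative (\<lambda>v. (v, 0))) (at x)"
      by (auto intro!: derivative_eq_intros)
    from has_derivative_compose[OF this smooth_onD(1)[OF assms(1)]]
    have "((\<lambda>x. G (x, t)) has_derivative (\<lambda>v. frechet_derivative G (at (x, t)) (v, 0))) (at x)" by simp
    from has_derivative_unique[OF this g] show ?thesis by metis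
  qed
  then show ?thesis using parametric_integral_has_derivative[OF assms(1), of x] by simp
qed

text \<open>The derivative in direction v is again such an integral, with the derivative of
  \<open>G\<close> in direction (v, 0) as integrand; hence the induction is over all
  \<open>G\<close>.\<close>

lemma smooth_on_parametric_integral:
  fixes G :: "'a::euclidean_space \<times> real \<Rightarrow> real"
  assumes "smooth_on UNIV G"
  shows "smooth_on UNIV (\<lambda>x. integral {0..1} (\<lambda>t. G (x, t)))"
proof -
  have "Ck_on n UNIV (\<lambda>x. integral {0..1} (\<lambda>t. G (x, t)))" for n
    using assms
  proof (induction n arbitrary: G)
    case 0
    show ?case
      using has_derivative_continuous[OF parametric_integral_has_derivative[OF 0]]
      by (simp add: continuous_at_imp_continuous_on)
  next
    case (Suc n)
    show ?case
      by (rule Ck_on_SucI[OF open_UNIV parametric_integral_has_derivative[OF Suc.prems]])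
        (rule Suc.IH[OF smooth_onD(2)[OF Suc.prems]])
  qed
  then show ?thesis by (simp add: smooth_on_def)
qed

lemma smooth_on_UNIV_real_derivatives:
  fixes d :: "nat \<Rightarrow> real \<Rightarrow> real"
  assumes "\<And>j t. (d j has_real_derivative d (Suc j) t) (at t)"
  shows "smooth_on UNIV (d j)"
proof -
  have "Ck_on n UNIV (d j)" for n
  proof (induction n arbitrary: j)
    case 0
    show ?case using assms by (auto intro!: continuous_at_imp_continuous_on DERIV_isCont)
  next
    case (Suc n)
    have "(d j has_derivative (\<lambda>v. d (Suc j) t * v)) (at t)" for t
      using assms by (simp add: has_field_derivative_def)
    moreover have "Ck_on n UNIV (\<lambda>t. d (Suc j) t * v)" for v
      by (rule Ck_on_bilinear[OF open_UNIV bounded_bilinear_mult Suc Ck_on_const])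
    ultimately show ?case by (rule Ck_on_SucI[OF open_UNIV])
  qed
  then show ?thesis by (simp add: smooth_on_def)
qed

lemma DERIV_scale: "((\<lambda>s. s * t) has_real_derivative t) (at s within A)"
  by (auto intro!: derivative_eq_intros)

lemma integral_power_unit: "integral {0..1} (\<lambda>s::real. s ^ j) = 1 / (real j + 1)"
proof -
  have "((\<lambda>s::real. s ^ j) has_integral (1 ^ Suc j / real (Suc j) - 0 ^ Suc j / real (Suc j))) {0..1}"
    by (rule fundamental_theorem_of_calculus)
      (auto intro!: derivative_eq_intros simp flip: has_real_derivative_iff_has_vector_derivative
        simp del: power_Suc of_nat_Suc)
  then show ?thesis by (simp add: integral_unique add.commute)
qed

text \<open>The quotient \<open>(d 0 t - d 0 0) / t\<close> is \<open>\<integral> d 1 (s t) ds\<close>, whose derivatives at 0 are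
  those of \<open>d 0\<close>, shifted and divided by \<open>j + 1\<close>.\<close>

lemma smooth_power_quotient:
  fixes d :: "nat \<Rightarrow> real \<Rightarrow> real"
  assumes "\<And>j t. (d j has_real_derivative d (Suc j) t) (at t)" and "\<And>j. j < m \<Longrightarrow> d j 0 = 0"
  obtains u where "smooth_on UNIV u" "\<And>t. d 0 t = t ^ m * u t" "u 0 = d m 0 / fact m"
proof -
  have "\<exists>u. smooth_on UNIV u \<and> (\<forall>t. d 0 t = t ^ m * u t) \<and> u 0 = d m 0 / fact m"
    using assms
  proof (induction m arbitrary: d)
    case 0
    then show ?case using smooth_on_UNIV_real_derivatives[of d 0] by auto
  next
    case (Suc m)
    define e where "e j t = integral {0..1} (\<lambda>s. s ^ j * d (Suc j) (s * t))" for j t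
    have cont: "continuous_on A (d j)" for j A
      using Suc.prems(1) by (auto intro!: continuous_at_imp_continuous_on DERIV_isCont)
    have e: "(e j has_real_derivative e (Suc j) t) (at t)" for j t
    proof -
      have "((\<lambda>t. integral (cbox 0 1) (\<lambda>s. s ^ j * d (Suc j) (s * t))) has_real_derivative
        integral (cbox 0 1) (\<lambda>s. s ^ Suc j * d (Suc (Suc j)) (s * t))) (at t within UNIV)"
      proof (rule leibniz_rule_field_derivative[where fx = "\<lambda>t s. s ^ Suc j * d (Suc (Suc j)) (s * t)"])
        show "((\<lambda>x. s ^ j * d (Suc j) (s * x)) has_real_derivative s ^ Suc j * d (Suc (Suc j)) (s * x)) (at x within UNIV)"
          for x s
          by (auto intro!: derivative_eq_intros DERIV_chain2[OF Suc.prems(1)])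
        show "(\<lambda>s. s ^ j * d (Suc j) (s * x)) integrable_on cbox 0 1" for x
          by (intro integrable_continuous continuous_intros continuous_on_compose2[OF cont[of UNIV]]) auto
        show "continuous_on (UNIV \<times> cbox 0 1) (\<lambda>(x, s). s ^ Suc j * d (Suc (Suc j)) (s * x))"
          unfolding split_beta
          by (intro continuous_intros continuous_on_compose2[OF cont[of UNIV]]) auto
      qed auto
      then show ?thesis by (simp add: e_def[abs_def])
    qed
    have e0: "e j 0 = d (Suc j) 0 / (real j + 1)" for j
      by (simp add: e_def integral_power_unit)
    obtain u where u: "smooth_on UNIV u" "\<And>t. e 0 t = t ^ m * u t" "u 0 = e m 0 / fact m"
      using Suc.IH[of e, OF e] e0 Suc.prems(2) by auto
    have "d 0 t = t * e 0 t" for t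
    proof -
      have "((\<lambda>s. d 0 (s * t)) has_real_derivative t * d 1 (s * t)) (at s within {0..1})" for s
        using DERIV_chain2[where f = "d 0" and g = "\<lambda>s. s * t" and x = s and s = "{0..1}", OF Suc.prems(1) DERIV_scale]
        by (simp add: mult.commute)
      then have "((\<lambda>s. t * d 1 (s * t)) has_integral (d 0 (1 * t) - d 0 (0 * t))) {0..1}"
        by (intro fundamental_theorem_of_calculus)
          (auto simp flip: has_real_derivative_iff_has_vector_derivative)
      from integral_unique[OF this] have "integral {0..1} (\<lambda>s. t * d 1 (s * t)) = d 0 t"
        using Suc.prems(2)[of 0] by simp
      then show ?thesis by (simp add: e_def)
    qed
    then have "\<forall>t. d 0 t = t ^ Suc m * u t" using u(2) by simp
    moreover have "u 0 = d (Suc m) 0 / fact (Suc m)" using u(3) e0 by (simp add: field_simps)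
    ultimately show ?case using u(1) by blast
  qed
  then show thesis using that by blast
qed

lemma has_derivative_along_line:
  fixes f :: "'a::euclidean_space \<Rightarrow> real"
  assumes "smooth_on UNIV f"
  shows "((\<lambda>s. f (y + s *\<^sub>R v)) has_real_derivative frechet_derivative f (at (y + s *\<^sub>R v)) v) (at s)"
proof -
  let ?L = "frechet_derivative f (at (y + s *\<^sub>R v))"
  have L: "(f has_derivative ?L) (at (y + s *\<^sub>R v))" by (rule smooth_onD(1)[OF assms]) simp
  have "((\<lambda>s. y + s *\<^sub>R v) has_derivative (\<lambda>h. h *\<^sub>R v)) (at s)"
    by (auto intro!: derivative_eq_intros)
  from has_derivative_compose[OF this L]
  have "((\<lambda>s. f (y + s *\<^sub>R v)) has_derivative (\<lambda>h. ?L (h *\<^sub>R v))) (at s)" .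
  moreover have "?L (h *\<^sub>R v) = ?L v * h" for h
    using has_derivative_linear[OF L] by (simp add: linear_cmul)
  ultimately show ?thesis by (simp add: has_field_derivative_def)
qed

lemma integral_along_line:
  fixes f :: "'a::euclidean_space \<Rightarrow> real"
  assumes "smooth_on UNIV f"
  shows "integral {0..1} (\<lambda>s. t * frechet_derivative f (at (y + (s * t) *\<^sub>R v)) v) = f (y + t *\<^sub>R v) - f y"
proof -
  have "((\<lambda>s. f (y + (s * t) *\<^sub>R v)) has_real_derivative
      t * frechet_derivative f (at (y + (s * t) *\<^sub>R v)) v) (at s within {0..1})" for s
    using DERIV_chain2[where f = "\<lambda>s. f (y + s *\<^sub>R v)" and g = "\<lambda>s. s * t" and x = s and s = "{0..1}",
        OF has_derivative_along_line[OF assms] DERIV_scale]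
    by (simp add: mult.commute)
  then have I: "((\<lambda>s. t * frechet_derivative f (at (y + (s * t) *\<^sub>R v)) v) has_integral
      (f (y + (1 * t) *\<^sub>R v) - f (y + (0 * t) *\<^sub>R v))) {0..1}"
    by (intro fundamental_theorem_of_calculus)
      (auto simp flip: has_real_derivative_iff_has_vector_derivative)
  show ?thesis using integral_unique[OF I] by simp
qed

text \<open>Differentiating \<open>f (y + t v) - f y = \<integral> t D\<^sub>v f (y + s t v) ds\<close> in the direction \<open>w\<close> shows that
  \<open>D\<^sub>w D\<^sub>v f - D\<^sub>v D\<^sub>w f\<close> has mean 0 along each segment \<open>[x, x + t v]\<close>; let \<open>t\<close> tend to 0.\<close>

lemma second_derivative_symmetric:
  fixes f :: "'a::euclidean_space \<Rightarrow> real"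
  assumes sm: "smooth_on UNIV f"
  shows "frechet_derivative (\<lambda>u. frechet_derivative f (at u) v) (at x) w =
    frechet_derivative (\<lambda>u. frechet_derivative f (at u) w) (at x) v"
proof -
  define fv where "fv u = frechet_derivative f (at u) v" for u
  define fw where "fw u = frechet_derivative f (at u) w" for u
  define K where "K u = frechet_derivative fv (at u) w - frechet_derivative fw (at u) v" for u
  have smv: "smooth_on UNIV fv" and smw: "smooth_on UNIV fw"
    unfolding fv_def fw_def by (rule smooth_onD(2)[OF sm])+
  have smK: "smooth_on UNIV K" unfolding K_def
    by (intro smooth_intros smooth_onD(2)[OF smv] smooth_onD(2)[OF smw])
  have line: "smooth_on UNIV (\<lambda>z. g (fst z + (snd z * t) *\<^sub>R v))" if "smooth_on UNIV g" for t and g :: "'a \<Rightarrow> real"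
    by (rule smooth_on_compose_UNIV[OF that])
      (intro smooth_intros smooth_on_linear bounded_linear_fst bounded_linear_snd)+
  have int: "(\<lambda>s. g (x + (s * t) *\<^sub>R v)) integrable_on {0..1}" if "smooth_on UNIV g" for t and g :: "'a \<Rightarrow> real"
    by (intro integrable_continuous_real continuous_on_compose2[OF smooth_onD(3)[OF that]] continuous_intros) auto
  have key: "t * integral {0..1} (\<lambda>s. K (x + (s * t) *\<^sub>R v)) = 0" for t
  proof -
    let ?G = "\<lambda>z. t * fv (fst z + (snd z * t) *\<^sub>R v)"
    have smG: "smooth_on UNIV ?G"
      by (intro smooth_intros line smv)
    have shift: "((\<lambda>y. g (y + a)) has_derivative frechet_derivative g (at (x + a))) (at x)"
      if "smooth_on UNIV g" for a and g :: "'a \<Rightarrow> real"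
    proof -
      have "((\<lambda>y. y + a) has_derivative (\<lambda>h. h)) (at x)"
        by (auto intro!: derivative_eq_intros)
      from has_derivative_compose[OF this smooth_onD(1)[OF that]] show ?thesis by simp
    qed
    have "((\<lambda>y. ?G (y, s)) has_derivative (\<lambda>h. t * frechet_derivative fv (at (x + (s * t) *\<^sub>R v)) h)) (at x)" for s
      using has_derivative_mult_right[OF shift[OF smv], of t "(s * t) *\<^sub>R v"] by simp
    from parametric_integral_has_derivative'[OF smG this]
    have 1: "((\<lambda>y. integral {0..1} (\<lambda>s. t * fv (y + (s * t) *\<^sub>R v))) has_derivative
       (\<lambda>h. integral {0..1} (\<lambda>s. t * frechet_derivative fv (at (x + (s * t) *\<^sub>R v)) h))) (at x)" by simp
    have 2: "((\<lambda>y. f (y + t *\<^sub>R v) - f y) has_derivative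
       (\<lambda>h. frechet_derivative f (at (x + t *\<^sub>R v)) h - frechet_derivative f (at x) h)) (at x)"
      using smooth_onD(1)[OF sm, of x] by (intro has_derivative_diff shift[OF sm]) auto
    have "integral {0..1} (\<lambda>s. t * fv (y + (s * t) *\<^sub>R v)) = f (y + t *\<^sub>R v) - f y" for y
      unfolding fv_def by (rule integral_along_line[OF sm])
    with 1 have "((\<lambda>y. f (y + t *\<^sub>R v) - f y) has_derivative
       (\<lambda>h. integral {0..1} (\<lambda>s. t * frechet_derivative fv (at (x + (s * t) *\<^sub>R v)) h))) (at x)"
      by simp
    from has_derivative_unique[OF 2 this]
    have "integral {0..1} (\<lambda>s. t * frechet_derivative fv (at (x + (s * t) *\<^sub>R v)) w) = fw (x + t *\<^sub>R v) - fw x"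
      unfolding fw_def by metis
    also have "\<dots> = integral {0..1} (\<lambda>s. t * frechet_derivative fw (at (x + (s * t) *\<^sub>R v)) v)"
      by (rule integral_along_line[OF smw, symmetric])
    finally show ?thesis
      unfolding K_def
      using integral_diff[OF int[OF smooth_onD(2)[OF smv, of w]] int[OF smooth_onD(2)[OF smw, of v]], of t t]
      by auto
  qed
  define I where "I t = integral {0..1} (\<lambda>s. K (x + (s * t) *\<^sub>R v))" for t
  have "smooth_on UNIV I"
  proof -
    have "smooth_on UNIV (\<lambda>z. K (x + (snd z * fst z) *\<^sub>R v))"
      by (rule smooth_on_compose_UNIV[OF smK])
        (intro smooth_intros smooth_on_linear bounded_linear_fst bounded_linear_snd)+
    from smooth_on_parametric_integral[OF this] show ?thesis by (simp add: I_def[abs_def])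
  qed
  then have "isCont I 0" using smooth_onD(3) continuous_on_eq_continuous_at by blast
  then have "I \<midarrow>0\<rightarrow> I 0" by (simp add: isCont_def)
  moreover have "I \<midarrow>0\<rightarrow> 0"
    by (rule Lim_transform_within[OF tendsto_const, of 1]) (use key in \<open>auto simp: I_def\<close>)
  ultimately have "I 0 = 0" by (rule LIM_unique)
  then show ?thesis by (simp add: I_def K_def fv_def[abs_def] fw_def[abs_def])
qed

section \<open>Mixed partial derivatives\<close>

lemma smooth_partial_deriv: "smooth_on UNIV f \<Longrightarrow> smooth_on UNIV (partial_deriv i f)"
  using smooth_onD(2)[of UNIV f "axis i 1"] by (simp add: partial_deriv_def[abs_def])

lemma partial_deriv_commute:
  "smooth_on UNIV f \<Longrightarrow> partial_deriv i (partial_deriv j f) = partial_deriv j (partial_deriv i f)"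
  using second_derivative_symmetric[of f "axis j 1" _ "axis i 1"]
  by (simp add: partial_deriv_def[abs_def])

lemma smooth_foldr_partial_deriv:
  "smooth_on UNIV f \<Longrightarrow> smooth_on UNIV (foldr partial_deriv is f)"
  by (induction "is") (auto intro: smooth_partial_deriv)

lemma smooth_mixed_partial: "smooth_on UNIV f \<Longrightarrow> smooth_on UNIV (mixed_partial \<alpha> f)"
  unfolding mixed_partial_def by (rule smooth_foldr_partial_deriv)

lemma mixed_partial_empty [simp]: "mixed_partial {#} f = f"
  by (simp add: mixed_partial_def)

text \<open>\<open>mixed_partial\<close> differentiates in sorted order, so a new index lands
  somewhere inside the list. Symmetry of second derivatives moves it to the outside.\<close>

lemma mixed_partial_add_mset:
  assumes "smooth_on UNIV f"
  shows "mixed_partial (add_mset i \<alpha>) f = partial_deriv i (mixed_partial \<alpha> f)"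
proof -
  have "foldr partial_deriv (insort i xs) f = partial_deriv i (foldr partial_deriv xs f)" for xs
  proof (induction xs)
    case (Cons a xs)
    then show ?case
      using partial_deriv_commute[OF smooth_foldr_partial_deriv[OF assms], of i a xs] by simp
  qed simp
  then show ?thesis by (simp add: mixed_partial_def)
qed

lemma frechet_derivative_partials:
  fixes f :: "'n::finite rvec \<Rightarrow> real"
  assumes "smooth_on UNIV f"
  shows "frechet_derivative f (at x) v = (\<Sum>i\<in>UNIV. v $ i * partial_deriv i f x)"
proof -
  let ?L = "frechet_derivative f (at x)"
  have lin: "linear ?L" using smooth_onD(1)[OF assms, of x] by (intro has_derivative_linear) auto
  have "?L v = ?L (\<Sum>i\<in>UNIV. v $ i *\<^sub>R axis i 1)"
    using basis_expansion[of v] by (simp add: scalar_mult_eq_scaleR)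
  also have "\<dots> = (\<Sum>i\<in>UNIV. v $ i * ?L (axis i 1))"
    using lin by (simp add: linear_sum linear_cmul)
  finally show ?thesis by (simp add: partial_deriv_def)
qed

lemma mixed_partial_along_curve:
  fixes f :: "'n::{finite,linorder} rvec \<Rightarrow> real"
  assumes sm: "smooth_on UNIV f" and "(\<gamma> has_vector_derivative \<gamma>') (at t)"
  shows "((\<lambda>t. mixed_partial \<alpha> f (\<gamma> t)) has_real_derivative
    (\<Sum>i\<in>UNIV. \<gamma>' $ i * mixed_partial (add_mset i \<alpha>) f (\<gamma> t))) (at t)"
proof -
  let ?g = "mixed_partial \<alpha> f"
  have smg: "smooth_on UNIV ?g" using sm by (rule smooth_mixed_partial)
  have "((\<lambda>t. ?g (\<gamma> t)) has_derivative (\<lambda>h. frechet_derivative ?g (at (\<gamma> t)) (h *\<^sub>R \<gamma>'))) (at t)"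
    using has_derivative_compose[OF assms(2)[unfolded has_vector_derivative_def]] smooth_onD(1)[OF smg, of "\<gamma> t"]
    by fast
  moreover have "(\<lambda>h. frechet_derivative ?g (at (\<gamma> t)) (h *\<^sub>R \<gamma>')) =
      (*) (\<Sum>i\<in>UNIV. \<gamma>' $ i * mixed_partial (add_mset i \<alpha>) f (\<gamma> t))"
    by (simp add: fun_eq_iff frechet_derivative_partials[OF smg] mixed_partial_add_mset[OF sm]
        sum_distrib_left mult_ac)
  ultimately show ?thesis by (simp add: has_field_derivative_def)
qed

subsection \<open>Derivatives of a function along a curve\<close>

text \<open>A pair \<open>(p, [j\<^sub>1, \<dots>, j\<^sub>r])\<close> stands for the contraction of \<open>\<partial>\<^sup>p\<^sup>+\<^sup>r f / \<partial>y\<^sup>p \<partial>z\<^sup>r\<close> with the derivatives of orders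
  \<open>j\<^sub>1, \<dots>, j\<^sub>r\<close> of the \<open>z\<close>-part of the curve; \<open>D\<close> gives the mixed partials and \<open>c j i\<close> the \<open>j\<close>-th
  derivative of the \<open>i\<close>-th coordinate.\<close>

primrec jterm :: "('n::{finite,linorder} multiset \<Rightarrow> real) \<Rightarrow> (nat \<Rightarrow> 'n \<Rightarrow> real) \<Rightarrow> 'n multiset \<Rightarrow> nat list \<Rightarrow> real" where
  "jterm D c \<alpha> [] = D \<alpha>"
| "jterm D c \<alpha> (j # js) = (\<Sum>i\<in>-{k1}. c j i * jterm D c (add_mset i \<alpha>) js)"

primrec bump :: "nat list \<Rightarrow> nat list list" where
  "bump [] = []"
| "bump (j # js) = (Suc j # js) # map ((#) j) (bump js)"

text \<open>The three ways in which d/dt acts on a term: on f through y, where the curve has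
  velocity 1; on f through z, which opens a slot for the first derivative of the curve; on a slot
  that is already there.\<close>

definition jstep :: "nat \<times> nat list \<Rightarrow> (nat \<times> nat list) list" where
  "jstep x = (Suc (fst x), snd x) # (fst x, 1 # snd x) # map (Pair (fst x)) (bump (snd x))"

text \<open>Equal terms are not collected: the number of occurrences of a term is its integer
  coefficient in the chain rule of order m.\<close>

primrec jterms :: "nat \<Rightarrow> (nat \<times> nat list) list" where
  "jterms 0 = [(0, [])]"
| "jterms (Suc m) = concat (map jstep (jterms m))"

definition jval :: "('n::{finite,linorder} multiset \<Rightarrow> real) \<Rightarrow> (nat \<Rightarrow> 'n \<Rightarrow> real) \<Rightarrow> 'n multiset \<Rightarrow> nat \<times> nat list \<Rightarrow> real" where
  "jval D c \<beta> x = jterm D c (\<beta> + replicate_mset (fst x) k1) (snd x)"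

text \<open>The derivatives in \<open>\<beta>\<close> are taken before restricting to the curve:
  \<open>{#}\<close> expands f along the curve, \<open>{#l#}\<close> a component of f_z.\<close>

definition jsum :: "('n::{finite,linorder} multiset \<Rightarrow> real) \<Rightarrow> (nat \<Rightarrow> 'n \<Rightarrow> real) \<Rightarrow> 'n multiset \<Rightarrow> nat \<Rightarrow> real" where
  "jsum D c \<beta> m = (\<Sum>x\<leftarrow>jterms m. jval D c \<beta> x)"

lemma jterm_swap: "jterm D c \<alpha> (i # j # js) = jterm D c \<alpha> (j # i # js)"
proof -
  have "jterm D c \<alpha> (i # j # js) = (\<Sum>a\<in>-{k1}. \<Sum>b\<in>-{k1}. c i a * (c j b * jterm D c (add_mset b (add_mset a \<alpha>)) js))"
    by (simp add: sum_distrib_left)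
  also have "\<dots> = (\<Sum>b\<in>-{k1}. \<Sum>a\<in>-{k1}. c j b * (c i a * jterm D c (add_mset a (add_mset b \<alpha>)) js))"
    by (subst sum.swap) (simp add: mult_ac add_mset_commute)
  also have "\<dots> = jterm D c \<alpha> (j # i # js)" by (simp add: sum_distrib_left)
  finally show ?thesis .
qed

lemma has_derivative_jterm:
  assumes D: "\<And>\<alpha>. ((\<lambda>t. D t \<alpha>) has_real_derivative
      D t (add_mset k1 \<alpha>) + (\<Sum>i\<in>-{k1}. c t 1 i * D t (add_mset i \<alpha>))) (at t)"
    and c: "\<And>j i. ((\<lambda>t. c t j i) has_real_derivative c t (Suc j) i) (at t)"
  shows "((\<lambda>t. jterm (D t) (c t) \<alpha> js) has_real_derivative
      jterm (D t) (c t) (add_mset k1 \<alpha>) js + jterm (D t) (c t) \<alpha> (1 # js)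
      + (\<Sum>ks\<leftarrow>bump js. jterm (D t) (c t) \<alpha> ks)) (at t)"
proof (induction js arbitrary: \<alpha>)
  case Nil
  show ?case using D[of \<alpha>] by simp
next
  case (Cons j js)
  let ?J = "jterm (D t) (c t)"
  have "((\<lambda>t. \<Sum>i\<in>-{k1}. c t j i * jterm (D t) (c t) (add_mset i \<alpha>) js) has_real_derivative
     (\<Sum>i\<in>-{k1}. c t (Suc j) i * ?J (add_mset i \<alpha>) js + (?J (add_mset k1 (add_mset i \<alpha>)) js
       + ?J (add_mset i \<alpha>) (1 # js) + (\<Sum>ks\<leftarrow>bump js. ?J (add_mset i \<alpha>) ks)) * c t j i)) (at t)"
    by (intro DERIV_sum DERIV_mult c Cons.IH)
  also have "(\<Sum>i\<in>-{k1}. c t (Suc j) i * ?J (add_mset i \<alpha>) js + (?J (add_mset k1 (add_mset i \<alpha>)) js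
       + ?J (add_mset i \<alpha>) (1 # js) + (\<Sum>ks\<leftarrow>bump js. ?J (add_mset i \<alpha>) ks)) * c t j i) =
     ?J \<alpha> (Suc j # js) + ?J (add_mset k1 \<alpha>) (j # js) + ?J \<alpha> (j # 1 # js)
       + (\<Sum>i\<in>-{k1}. c t j i * (\<Sum>ks\<leftarrow>bump js. ?J (add_mset i \<alpha>) ks))"
    by (simp add: distrib_right distrib_left sum.distrib mult_ac add_mset_commute del: One_nat_def)
  also have "(\<Sum>i\<in>-{k1}. c t j i * (\<Sum>ks\<leftarrow>bump js. ?J (add_mset i \<alpha>) ks)) = (\<Sum>ks\<leftarrow>bump js. ?J \<alpha> (j # ks))"
  proof -
    have "(\<Sum>i\<in>-{k1}. c t j i * (\<Sum>ks\<leftarrow>kss. ?J (add_mset i \<alpha>) ks)) = (\<Sum>ks\<leftarrow>kss. ?J \<alpha> (j # ks))" for kss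
      by (induction kss) (simp_all add: sum.distrib distrib_left)
    then show ?thesis .
  qed
  \<comment> \<open>The product rule leaves the new slot behind \<open>j\<close>, whereas
    \<open>jstep\<close> opens it in front.\<close>
  finally show ?case
    unfolding jterm_swap[of "D t" _ _ j 1] by (simp add: o_def add_ac del: One_nat_def)
qed

lemma sum_list_concat_map: "(\<Sum>x\<leftarrow>concat (map f xs). g x) = (\<Sum>x\<leftarrow>xs. \<Sum>y\<leftarrow>f x. g y)"
  for g :: "'a \<Rightarrow> real"
  by (induction xs) auto

lemma has_derivative_jsum:
  assumes D: "\<And>\<alpha>. ((\<lambda>t. D t \<alpha>) has_real_derivative
      D t (add_mset k1 \<alpha>) + (\<Sum>i\<in>-{k1}. c t 1 i * D t (add_mset i \<alpha>))) (at t)"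
    and c: "\<And>j i. ((\<lambda>t. c t j i) has_real_derivative c t (Suc j) i) (at t)"
  shows "((\<lambda>t. jsum (D t) (c t) \<beta> m) has_real_derivative jsum (D t) (c t) \<beta> (Suc m)) (at t)"
proof -
  have "((\<lambda>t. jval (D t) (c t) \<beta> x) has_real_derivative (\<Sum>y\<leftarrow>jstep x. jval (D t) (c t) \<beta> y)) (at t)" for x
    using has_derivative_jterm[OF D c, of "\<beta> + replicate_mset (fst x) k1" "snd x"]
    by (simp add: jval_def jstep_def o_def add_ac)
  then have "((\<lambda>t. \<Sum>x\<leftarrow>xs. jval (D t) (c t) \<beta> x) has_real_derivative
      (\<Sum>x\<leftarrow>xs. \<Sum>y\<leftarrow>jstep x. jval (D t) (c t) \<beta> y)) (at t)" for xs
    by (induction xs) (auto intro: DERIV_add)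
  then show ?thesis by (simp add: jsum_def sum_list_concat_map)
qed

lemma bump_props:
  "ks \<in> set (bump js) \<Longrightarrow> length ks = length js \<and> sum_list ks = Suc (sum_list js) \<and>
    (\<forall>k\<in>set ks. \<exists>j\<in>set js. j \<le> k)"
proof (induction js arbitrary: ks)
  case (Cons j js)
  then show ?case by (fastforce)
qed simp

text \<open>Each differentiation adds one to p, adds one to a slot, or opens a slot of order one.
  All later bounds on orders come from this homogeneity.\<close>

lemma jterms_weight: "x \<in> set (jterms m) \<Longrightarrow> fst x + sum_list (snd x) = m \<and> (\<forall>j\<in>set (snd x). j \<ge> 1)"
proof (induction m arbitrary: x)
  case (Suc m)
  then obtain y where y: "y \<in> set (jterms m)" "x \<in> set (jstep y)" by auto
  from y(2) consider "x = (Suc (fst y), snd y)" | "x = (fst y, 1 # snd y)"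
    | ks where "x = (fst y, ks)" "ks \<in> set (bump (snd y))"
    by (auto simp: jstep_def)
  then show ?case
  proof cases
    case 3
    have "1 \<le> k" if "k \<in> set ks" for k
      using Suc.IH[OF y(1)] bump_props[OF 3(2)] that by (meson le_trans)
    then show ?thesis using Suc.IH[OF y(1)] bump_props[OF 3(2)] unfolding 3(1) by auto
  qed (use Suc.IH[OF y(1)] in auto)
qed simp

lemma length_le_sum_list: "\<forall>j\<in>set js. j \<ge> (k::nat) \<Longrightarrow> k * length js \<le> sum_list js"
  by (induction js) auto

text \<open>An empty slot list arises only from an empty one, by one more y-derivative. As an
  equation of lists this says that the pure derivative has coefficient exactly 1 in a_\<mu>.\<close>

lemma jterms_nil: "filter (\<lambda>x. snd x = []) (jterms m) = [(m, [])]"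
proof (induction m)
  case (Suc m)
  have step: "filter (\<lambda>x. snd x = []) (jstep y) = (if snd y = [] then [(Suc (fst y), [])] else [])" for y
  proof -
    have "filter (\<lambda>x. snd x = []) (map (Pair (fst y)) (bump (snd y))) = []"
      using bump_props[of _ "snd y"] by (cases "snd y") (auto simp: filter_empty_conv)
    then show ?thesis by (simp add: jstep_def)
  qed
  have "filter (\<lambda>x. snd x = []) (jterms (Suc m)) =
     concat (map (\<lambda>y. [(Suc (fst y), [])]) (filter (\<lambda>x. snd x = []) (jterms m)))" for m
  proof -
    have "filter (\<lambda>x. snd x = []) (concat (map jstep xs)) =
      concat (map (\<lambda>y. [(Suc (fst y), [])]) (filter (\<lambda>x. snd x = []) xs))" for xs
      by (induction xs) (simp_all add: step)
    then show ?thesis by simp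
  qed
  with Suc show ?case by simp
qed simp

lemma filter_concat_map_filter:
  "(\<And>y. \<not> P y \<Longrightarrow> filter P (f y) = []) \<Longrightarrow> filter P (concat (map f xs)) = filter P (concat (map f (filter P xs)))"
  by (induction xs) auto

text \<open>The condition does not mention m and passes from a term to its predecessor under
  \<open>jstep\<close>, so the induction can discard all other terms. The test for
  \<open>(0, [m])\<close> alone changes with m and would not be inductive.\<close>

lemma jterms_single_aux:
  "m \<ge> 1 \<Longrightarrow> filter (\<lambda>x. fst x = 0 \<and> length (snd x) \<le> 1) (jterms m) = [(0, [m])]"
proof (induction m rule: nat_induct_at_least)
  case base
  then show ?case by (simp add: jstep_def)
next
  case (Suc m)
  let ?P = "\<lambda>x::nat \<times> nat list. fst x = 0 \<and> length (snd x) \<le> 1"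
  have step: "filter ?P (jstep y) = []" if "\<not> ?P y" for y
  proof -
    have "filter ?P (map (Pair (fst y)) (bump (snd y))) = []"
      using bump_props[of _ "snd y"] that by (auto simp: filter_empty_conv)
    with that show ?thesis by (auto simp: jstep_def)
  qed
  have *: "filter ?P (concat (map jstep xs)) = filter ?P (concat (map jstep (filter ?P xs)))" for xs
    by (rule filter_concat_map_filter) (rule step)
  show ?case unfolding jterms.simps(2) *[of "jterms m"] Suc.IH by (simp add: jstep_def)
qed

lemma jterms_single: "m \<ge> 1 \<Longrightarrow> filter (\<lambda>x. x = (0, [m])) (jterms m) = [(0, [m])]"
proof -
  assume m: "m \<ge> 1"
  have "filter (\<lambda>x. x = (0, [m])) (jterms m) =
     filter (\<lambda>x. x = (0, [m])) (filter (\<lambda>x. fst x = 0 \<and> length (snd x) \<le> 1) (jterms m))"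
    by (auto intro!: filter_cong)
  then show ?thesis unfolding jterms_single_aux[OF m] by simp
qed

lemma sum_list_filter_split:
  fixes g :: "'a \<Rightarrow> real"
  shows "(\<Sum>x\<leftarrow>xs. g x) = (\<Sum>x\<leftarrow>filter P xs. g x) + (\<Sum>x\<leftarrow>filter (\<lambda>x. \<not> P x) xs. g x)"
  by (induction xs) auto

text \<open>The terms of the \<open>m\<close>-th derivative without \<open>f\<^sub>z\<close> contracted with the \<open>m\<close>-th derivative of the curve.\<close>

definition jrest :: "('n::{finite,linorder} multiset \<Rightarrow> real) \<Rightarrow> (nat \<Rightarrow> 'n \<Rightarrow> real) \<Rightarrow> 'n multiset \<Rightarrow> nat \<Rightarrow> real" where
  "jrest D c \<beta> m = (\<Sum>x\<leftarrow>filter (\<lambda>x. x \<noteq> (0, [m])) (jterms m). jval D c \<beta> x)"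

lemma jsum_eq_jrest:
  assumes "m \<ge> 1"
  shows "jsum D c \<beta> m = (\<Sum>l\<in>-{k1}. c m l * D (add_mset l \<beta>)) + jrest D c \<beta> m"
  unfolding jsum_def jrest_def
  by (subst sum_list_filter_split[where P = "\<lambda>x. x = (0, [m])"])
    (simp add: jterms_single[OF assms] jval_def)

lemma jterm_cong: "(\<And>j. j \<in> set js \<Longrightarrow> c j = c' j) \<Longrightarrow> jterm D c \<alpha> js = jterm D c' \<alpha> js"
  by (induction js arbitrary: \<alpha>) auto

text \<open>A slot of order m uses up the whole weight, which leaves only \<open>(0, [m])\<close>.
  The other terms thus involve earlier coefficients only, and the recursion for c makes
  sense.\<close>

lemma jterms_rest_less:
  assumes "x \<in> set (jterms m)" "x \<noteq> (0, [m])" "j \<in> set (snd x)"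
  shows "j < m"
proof -
  have w: "fst x + sum_list (snd x) = m" "\<forall>j\<in>set (snd x). j \<ge> 1"
    using jterms_weight[OF assms(1)] by auto
  obtain as bs where s: "snd x = as @ j # bs" using assms(3) by (meson split_list)
  have "j = m \<Longrightarrow> as = [] \<and> bs = [] \<and> fst x = 0"
  proof -
    assume "j = m"
    then have "fst x + sum_list as + sum_list bs = 0" using w(1) unfolding s by simp
    moreover have "length as \<le> sum_list as" "length bs \<le> sum_list bs"
      using w(2) length_le_sum_list[of as 1] length_le_sum_list[of bs 1] unfolding s by auto
    ultimately have "length as = 0" "length bs = 0" "fst x = 0" by linarith+
    then show ?thesis by simp
  qed
  then have "j \<noteq> m" using assms(2) s by (cases x) auto
  moreover have "j \<le> m" using w(1) s by simp
  ultimately show ?thesis by simp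
qed

lemma jrest_cong:
  assumes "\<And>j. j < m \<Longrightarrow> c j = c' j"
  shows "jrest D c \<beta> m = jrest D c' \<beta> m"
  unfolding jrest_def jval_def
  using assms jterms_rest_less by (intro arg_cong[where f = sum_list] map_cong jterm_cong) fastforce+

text \<open>Course-of-values recursion: stage N is the sequence cut off after c_N, on which
  \<open>jrest\<close> can be evaluated. The cut-off sequences also serve later as the coefficients
  of the polynomial curves.\<close>

primrec zcoef_upto :: "('n::{finite,linorder} multiset \<Rightarrow> real) \<Rightarrow> 'n rmat \<Rightarrow> nat \<Rightarrow> nat \<Rightarrow> 'n \<Rightarrow> real" where
  "zcoef_upto D G 0 = (\<lambda>_ _. 0)"
| "zcoef_upto D G (Suc N) = (zcoef_upto D G N)(Suc N := (\<lambda>i. - (\<Sum>l\<in>-{k1}. G $ i $ l * jrest D (zcoef_upto D G N) {#l#} (Suc N))))"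

definition zcoef :: "('n::{finite,linorder} multiset \<Rightarrow> real) \<Rightarrow> 'n rmat \<Rightarrow> nat \<Rightarrow> 'n \<Rightarrow> real" where
  "zcoef D G j = zcoef_upto D G j j"

lemma zcoef_upto_eq: "zcoef_upto D G N j = (if j \<le> N then zcoef D G j else (\<lambda>_. 0))"
proof (induction N)
  case 0
  then show ?case by (simp add: zcoef_def fun_eq_iff)
next
  case (Suc N)
  then show ?case by (cases "j = Suc N") (simp_all add: zcoef_def)
qed

lemma zcoef_0: "zcoef D G 0 = (\<lambda>_. 0)"
  by (simp add: zcoef_def)

lemma zcoef_rec:
  assumes "m \<ge> 1"
  shows "zcoef D G m i = - (\<Sum>l\<in>-{k1}. G $ i $ l * jrest D (zcoef D G) {#l#} m)"
proof -
  obtain N where m: "m = Suc N" using assms by (cases m) auto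
  have "jrest D (zcoef_upto D G N) {#l#} m = jrest D (zcoef D G) {#l#} m" for l
    by (rule jrest_cong) (auto simp: zcoef_upto_eq m)
  then show ?thesis unfolding zcoef_def m by (simp add: m)
qed

text \<open>The 2-jet of a function at a critical point where the second differential is nondegenerate in \<open>z\<close> and
  has the first axis in its kernel, and the inverse \<open>G\<close> of its \<open>z\<close>-block.\<close>

locale corank_one_jet =
  fixes D :: "'n::{finite,linorder} multiset \<Rightarrow> real" and G :: "'n rmat"
  assumes D1: "D {#i#} = 0" and D2: "D {#k1, i#} = 0"
    and G0: "i = k1 \<or> j = k1 \<Longrightarrow> G $ i $ j = 0"
    and HG: "i \<noteq> k1 \<Longrightarrow> j \<noteq> k1 \<Longrightarrow> (\<Sum>l\<in>-{k1}. D {#i, l#} * G $ l $ j) = (if i = j then 1 else 0)"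
    and GH: "i \<noteq> k1 \<Longrightarrow> j \<noteq> k1 \<Longrightarrow> (\<Sum>l\<in>-{k1}. G $ i $ l * D {#l, j#}) = (if i = j then 1 else 0)"
begin

definition c :: "nat \<Rightarrow> 'n \<Rightarrow> real" where "c = zcoef D G"

definition a :: "nat \<Rightarrow> real" where "a \<mu> = jsum D c {#} (\<mu> + 1)"

lemma c_0: "c 0 = (\<lambda>_. 0)"
  by (simp add: c_def zcoef_0)

lemma c_rec: "m \<ge> 1 \<Longrightarrow> c m i = - (\<Sum>l\<in>-{k1}. G $ i $ l * jrest D c {#l#} m)"
  unfolding c_def by (rule zcoef_rec)

lemma c_k1: "c m k1 = 0"
  by (cases m) (simp_all add: c_0 c_rec G0)

lemma D2': "D {#i, k1#} = 0"
  using D2 by (simp add: add_mset_commute)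

text \<open>The only remaining term at order 1 is f_yz, which vanishes. The curve is thus tangent to
  the first axis, and every term with a slot of order 1 drops out.\<close>

lemma c_1: "c 1 = (\<lambda>_. 0)"
  by (simp add: fun_eq_iff c_rec jrest_def jstep_def jval_def D2 D2')

text \<open>With H = f_zz, which is symmetric, the computation reads G = G H G^T = G^T.\<close>

lemma G_sym: "G $ i $ j = G $ j $ i"
proof (cases "i = k1 \<or> j = k1")
  case False
  then have ij: "i \<noteq> k1" "j \<noteq> k1" by auto
  have "G $ i $ j = (\<Sum>l\<in>-{k1}. G $ i $ l * (if l = j then 1 else 0))"
    using ij by (simp add: if_distrib[of "\<lambda>u. _ * u"] sum.delta cong: if_cong)
  also have "\<dots> = (\<Sum>l\<in>-{k1}. G $ i $ l * (\<Sum>k\<in>-{k1}. D {#l, k#} * G $ j $ k))"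
  proof (rule sum.cong)
    fix l :: 'n assume l: "l \<in> -{k1}"
    have "(\<Sum>k\<in>-{k1}. D {#l, k#} * G $ j $ k) = (\<Sum>k\<in>-{k1}. G $ j $ k * D {#k, l#})"
      by (simp add: add_mset_commute mult.commute)
    also have "\<dots> = (if l = j then 1 else 0)" using GH[of j l] ij l by auto
    finally show "G $ i $ l * (if l = j then 1 else 0) = G $ i $ l * (\<Sum>k\<in>-{k1}. D {#l, k#} * G $ j $ k)"
      by simp
  qed simp
  also have "\<dots> = (\<Sum>k\<in>-{k1}. (\<Sum>l\<in>-{k1}. G $ i $ l * D {#l, k#}) * G $ j $ k)"
    unfolding sum_distrib_left sum_distrib_right by (subst sum.swap) (simp add: mult_ac)
  also have "\<dots> = (\<Sum>k\<in>-{k1}. (if i = k then 1 else 0) * G $ j $ k)"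
    using ij by (intro sum.cong) (auto simp: GH)
  also have "\<dots> = G $ j $ i"
    using ij by (simp add: if_distrib[of "\<lambda>u. u * _"] sum.delta' cong: if_cong)
  finally show ?thesis .
qed (auto simp: G0)

lemma H_c:
  assumes "m \<ge> 1" "i \<noteq> k1"
  shows "(\<Sum>l\<in>-{k1}. c m l * D {#l, i#}) = - jrest D c {#i#} m"
proof -
  have "(\<Sum>l\<in>-{k1}. c m l * D {#l, i#}) =
      - (\<Sum>l\<in>-{k1}. \<Sum>k\<in>-{k1}. G $ l $ k * jrest D c {#k#} m * D {#l, i#})"
    by (simp add: c_rec[OF assms(1)] sum_distrib_right sum_negf)
  also have "(\<Sum>l\<in>-{k1}. \<Sum>k\<in>-{k1}. G $ l $ k * jrest D c {#k#} m * D {#l, i#}) =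
      (\<Sum>k\<in>-{k1}. jrest D c {#k#} m * (\<Sum>l\<in>-{k1}. D {#i, l#} * G $ l $ k))"
    by (subst sum.swap) (simp add: sum_distrib_left mult_ac add_mset_commute)
  also have "\<dots> = (\<Sum>k\<in>-{k1}. jrest D c {#k#} m * (if i = k then 1 else 0))"
    using assms(2) by (intro sum.cong) (auto simp: HG)
  also have "\<dots> = jrest D c {#i#} m"
    using assms(2) by (simp add: if_distrib[of "\<lambda>u. _ * u"] sum.delta' cong: if_cong)
  finally show ?thesis .
qed

text \<open>f_z vanishes along the formal curve to every order: f_zz c_m cancels the remaining terms
  by \<open>H_c\<close>, and order 0 is the criticality of the origin.\<close>

lemma jsum_z: "i \<noteq> k1 \<Longrightarrow> jsum D c {#i#} m = 0"
proof (cases "m \<ge> 1")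
  case True
  then show "i \<noteq> k1 \<Longrightarrow> ?thesis" by (simp add: jsum_eq_jrest H_c)
next
  case False
  then have "m = 0" by simp
  then show ?thesis by (simp add: jsum_def jval_def D1)
qed

lemma jsum_upto_z: 
  assumes "m \<le> N" "i \<noteq> k1"
  shows "jsum D (zcoef_upto D G N) {#i#} m = 0"
proof -
  have "jsum D (zcoef_upto D G N) {#i#} m = jsum D c {#i#} m"
    unfolding jsum_def jval_def
  proof (intro arg_cong[where f = sum_list] map_cong jterm_cong)
    fix x j assume "x \<in> set (jterms m)" "j \<in> set (snd x)"
    then have "j \<le> m" using jterms_weight[of x m] member_le_sum_list[of j "snd x"] by auto
    then show "zcoef_upto D G N j = c j" using assms(1) by (simp add: zcoef_upto_eq c_def)
  qed simp
  then show ?thesis using jsum_z[OF assms(2)] by simp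
qed

text \<open>One order more than in \<open>jsum_upto_z\<close>: at m = N + 1 the missing coefficient
  c_m would be contracted with f_z, which is 0 at the origin.\<close>

lemma jsum_upto_y:
  assumes "1 \<le> m" "m \<le> Suc N"
  shows "jsum D (zcoef_upto D G N) {#} m = jsum D c {#} m"
  using assms jrest_cong[of m "zcoef_upto D G N" c D "{#}"]
  by (simp add: jsum_eq_jrest D1 zcoef_upto_eq c_def)

end

subsection \<open>Functionals represented by integer polynomials\<close>

definition mono_eval :: "('v \<Rightarrow> real) \<Rightarrow> ('v \<Rightarrow>\<^sub>0 nat) \<Rightarrow> real" where
  "mono_eval x m = (\<Prod>v\<in>Poly_Mapping.keys m. x v ^ Poly_Mapping.lookup m v)"

lemma mono_eval_superset:
  "finite K \<Longrightarrow> Poly_Mapping.keys m \<subseteq> K \<Longrightarrow> mono_eval x m = (\<Prod>v\<in>K. x v ^ Poly_Mapping.lookup m v)"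
  unfolding mono_eval_def by (rule prod.mono_neutral_left) (auto simp: in_keys_iff)

lemma mono_eval_add: "mono_eval x (m + n) = mono_eval x m * mono_eval x n"
proof -
  let ?K = "Poly_Mapping.keys m \<union> Poly_Mapping.keys n"
  have "mono_eval x k = (\<Prod>v\<in>?K. x v ^ Poly_Mapping.lookup k v)" if "k \<in> {m, n, m + n}" for k
    using that Poly_Mapping.keys_add[of m n] by (intro mono_eval_superset) auto
  then show ?thesis by (simp add: lookup_add power_add prod.distrib)
qed

text \<open>The key set of a sum can shrink by cancellation; evaluating over any finite superset
  permits a common index set.\<close>

lemma mpoly_eval_superset:
  assumes "finite K" "Poly_Mapping.keys p \<subseteq> K"
  shows "mpoly_eval x p = (\<Sum>m\<in>K. of_int (Poly_Mapping.lookup p m) * mono_eval x m)"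
  unfolding mpoly_eval_def mono_eval_def[symmetric]
  using assms by (intro sum.mono_neutral_left) (auto simp: in_keys_iff)

lemma mpoly_eval_add: "mpoly_eval x (p + q) = mpoly_eval x p + mpoly_eval x q"
proof -
  let ?K = "Poly_Mapping.keys p \<union> Poly_Mapping.keys q"
  have "mpoly_eval x r = (\<Sum>m\<in>?K. of_int (Poly_Mapping.lookup r m) * mono_eval x m)" if "r \<in> {p, q, p + q}" for r
    using that Poly_Mapping.keys_add[of p q] by (intro mpoly_eval_superset) auto
  then show ?thesis by (simp add: lookup_add distrib_right sum.distrib)
qed

lemma mpoly_eval_0: "mpoly_eval x 0 = 0"
  by (simp add: mpoly_eval_def)

lemma mpoly_eval_sum: "mpoly_eval x (sum p I) = (\<Sum>i\<in>I. mpoly_eval x (p i))"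
  by (induction I rule: infinite_finite_induct) (simp_all add: mpoly_eval_add mpoly_eval_0)

lemma mpoly_eval_single: "mpoly_eval x (Poly_Mapping.single m k) = of_int k * mono_eval x m"
  by (subst mpoly_eval_superset[of "{m}"]) auto

lemma mpoly_sum_singles: "p = (\<Sum>m\<in>Poly_Mapping.keys p. Poly_Mapping.single m (Poly_Mapping.lookup p m))"
  by (rule poly_mapping_eqI)
    (simp add: lookup_sum lookup_single when_def in_keys_iff sum.delta' cong: if_cong)

lemma mpoly_eval_mult:
  fixes p q :: "'v int_mpoly"
  shows "mpoly_eval x (p * q) = mpoly_eval x p * mpoly_eval x q"
proof -
  let ?s = "\<lambda>p m. Poly_Mapping.single m (Poly_Mapping.lookup p m)"
  have "p * q = (\<Sum>m\<in>Poly_Mapping.keys p. \<Sum>n\<in>Poly_Mapping.keys q. ?s p m * ?s q n)"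
    by (subst (1) mpoly_sum_singles[of p], subst (1) mpoly_sum_singles[of q])
      (simp add: sum_product)
  then have "mpoly_eval x (p * q) =
      (\<Sum>m\<in>Poly_Mapping.keys p. \<Sum>n\<in>Poly_Mapping.keys q. mpoly_eval x (?s p m) * mpoly_eval x (?s q n))"
    by (simp add: mpoly_eval_sum mult_single mpoly_eval_single mono_eval_add mult_ac)
  also have "\<dots> = (\<Sum>m\<in>Poly_Mapping.keys p. mpoly_eval x (?s p m)) * (\<Sum>n\<in>Poly_Mapping.keys q. mpoly_eval x (?s q n))"
    by (simp add: sum_product)
  also have "\<dots> = mpoly_eval x p * mpoly_eval x q"
    by (simp flip: mpoly_eval_sum mpoly_sum_singles)
  finally show ?thesis .
qed

text \<open>The polynomials without free term form a ring (without unit), which is all that is needed.\<close>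

definition int_poly_rep :: "'v set \<Rightarrow> 'f set \<Rightarrow> ('f \<Rightarrow> 'v \<Rightarrow> real) \<Rightarrow> ('f \<Rightarrow> real) \<Rightarrow> bool" where
  "int_poly_rep V A ev F \<longleftrightarrow> (\<exists>p :: 'v int_mpoly. Poly_Mapping.lookup p 0 = 0 \<and> mpoly_vars p \<subseteq> V \<and>
     (\<forall>f\<in>A. F f = mpoly_eval (ev f) p))"

text \<open>Agreement on \<open>A\<close> is enough. This is where relations such as f_yz = 0 enter,
  which hold for the functions considered but are not polynomial identities.\<close>

lemma int_poly_rep_cong:
  "int_poly_rep V A ev F \<Longrightarrow> (\<And>f. f \<in> A \<Longrightarrow> F f = F' f) \<Longrightarrow> int_poly_rep V A ev F'"
  unfolding int_poly_rep_def by metis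

lemma int_poly_rep_zero: "int_poly_rep V A ev (\<lambda>_. 0)"
  unfolding int_poly_rep_def by (rule exI[of _ 0]) (simp add: mpoly_vars_def mpoly_eval_0)

lemma int_poly_rep_var:
  assumes "v \<in> V"
  shows "int_poly_rep V A ev (\<lambda>f. ev f v)"
proof -
  have "mpoly_vars (Poly_Mapping.single (Poly_Mapping.single v 1) 1 :: 'a int_mpoly) \<subseteq> V"
    using assms by (simp add: mpoly_vars_def)
  moreover have "mpoly_eval (ev f) (Poly_Mapping.single (Poly_Mapping.single v 1) 1) = ev f v" for f
    by (simp add: mpoly_eval_single mono_eval_def)
  moreover have "Poly_Mapping.single v (1::nat) \<noteq> 0"
    by (metis lookup_single_eq lookup_zero zero_neq_one)
  ultimately show ?thesis unfolding int_poly_rep_def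
    by (intro exI[of _ "Poly_Mapping.single (Poly_Mapping.single v 1) 1"]) (auto simp: lookup_single when_def)
qed

lemma int_poly_rep_add:
  assumes "int_poly_rep V A ev F" "int_poly_rep V A ev F'"
  shows "int_poly_rep V A ev (\<lambda>f. F f + F' f)"
proof -
  obtain p q where p: "Poly_Mapping.lookup p 0 = 0" "mpoly_vars p \<subseteq> V" "\<forall>f\<in>A. F f = mpoly_eval (ev f) p"
    and q: "Poly_Mapping.lookup q 0 = 0" "mpoly_vars q \<subseteq> V" "\<forall>f\<in>A. F' f = mpoly_eval (ev f) q"
    using assms unfolding int_poly_rep_def by blast
  have "mpoly_vars (p + q) \<subseteq> V"
    using p(2) q(2) Poly_Mapping.keys_add[of p q] unfolding mpoly_vars_def by blast
  then show ?thesis unfolding int_poly_rep_def using p q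
    by (intro exI[of _ "p + q"]) (simp add: lookup_add mpoly_eval_add)
qed

lemma int_poly_rep_mult:
  assumes "int_poly_rep V A ev F" "int_poly_rep V A ev F'"
  shows "int_poly_rep V A ev (\<lambda>f. F f * F' f)"
proof -
  obtain p q where p: "Poly_Mapping.lookup p 0 = 0" "mpoly_vars p \<subseteq> V" "\<forall>f\<in>A. F f = mpoly_eval (ev f) p"
    and q: "Poly_Mapping.lookup q 0 = 0" "mpoly_vars q \<subseteq> V" "\<forall>f\<in>A. F' f = mpoly_eval (ev f) q"
    using assms unfolding int_poly_rep_def by blast
  have keys: "m \<in> Poly_Mapping.keys (p * q) \<Longrightarrow>
      \<exists>k\<in>Poly_Mapping.keys p. \<exists>l\<in>Poly_Mapping.keys q. m = k + l" for m
    using keys_mult[of p q] by blast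
  have "mpoly_vars (p * q) \<subseteq> V"
  proof
    fix v assume "v \<in> mpoly_vars (p * q)"
    then obtain k l where kl: "k \<in> Poly_Mapping.keys p" "l \<in> Poly_Mapping.keys q" "v \<in> Poly_Mapping.keys (k + l)"
      unfolding mpoly_vars_def using keys by blast
    then have "v \<in> Poly_Mapping.keys k \<or> v \<in> Poly_Mapping.keys l"
      using Poly_Mapping.keys_add[of k l] by blast
    then show "v \<in> V" using kl p(2) q(2) unfolding mpoly_vars_def by blast
  qed
  \<comment> \<open>Exponents are natural numbers, so k + l = 0 forces k = 0: a free term of the
    product would require one in \<open>p\<close>.\<close>
  moreover have "Poly_Mapping.lookup (p * q) 0 = 0"
  proof (rule ccontr)
    assume "Poly_Mapping.lookup (p * q) 0 \<noteq> 0"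
    then obtain k l where kl: "k \<in> Poly_Mapping.keys p" "k + l = 0"
      using keys[of 0] by (auto simp: in_keys_iff)
    have "Poly_Mapping.lookup k v = 0" for v
      using kl(2) lookup_add[of k l v] by simp
    then have "k = 0" by (intro poly_mapping_eqI) simp
    then show False using kl(1) p(1) by (simp add: in_keys_iff)
  qed
  ultimately show ?thesis unfolding int_poly_rep_def using p q
    by (intro exI[of _ "p * q"]) (simp add: mpoly_eval_mult)
qed

lemma int_poly_rep_uminus:
  assumes "int_poly_rep V A ev F"
  shows "int_poly_rep V A ev (\<lambda>f. - F f)"
proof -
  obtain p where p: "Poly_Mapping.lookup p 0 = 0" "mpoly_vars p \<subseteq> V" "\<forall>f\<in>A. F f = mpoly_eval (ev f) p"
    using assms unfolding int_poly_rep_def by blast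
  have keys: "Poly_Mapping.keys (- p) = Poly_Mapping.keys p" by (auto simp: in_keys_iff)
  have "mpoly_vars (- p) \<subseteq> V" using p(2) by (simp add: mpoly_vars_def keys)
  then show ?thesis unfolding int_poly_rep_def using p
    by (intro exI[of _ "- p"]) (simp add: mpoly_eval_def keys sum_negf)
qed

lemma int_poly_rep_sum:
  "(\<And>i. i \<in> I \<Longrightarrow> int_poly_rep V A ev (F i)) \<Longrightarrow> int_poly_rep V A ev (\<lambda>f. \<Sum>i\<in>I. F i f)"
  by (induction I rule: infinite_finite_induct) (auto intro: int_poly_rep_add int_poly_rep_zero)

lemma int_poly_rep_sum_list:
  "(\<And>x. x \<in> set xs \<Longrightarrow> int_poly_rep V A ev (F x)) \<Longrightarrow> int_poly_rep V A ev (\<lambda>f. \<Sum>x\<leftarrow>xs. F x f)"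
  by (induction xs) (auto intro: int_poly_rep_add int_poly_rep_zero)

lemma int_poly_rep_jterm:
  fixes D :: "'f \<Rightarrow> 'n::{finite,linorder} multiset \<Rightarrow> real"
  assumes "\<And>j i. j \<in> set js \<Longrightarrow> i \<noteq> k1 \<Longrightarrow> int_poly_rep V A ev (\<lambda>f. c f j i)"
    and "\<And>ls. length ls = length js \<Longrightarrow> set ls \<subseteq> -{k1} \<Longrightarrow> int_poly_rep V A ev (\<lambda>f. D f (\<alpha> + mset ls))"
  shows "int_poly_rep V A ev (\<lambda>f. jterm (D f) (c f) \<alpha> js)"
  using assms
proof (induction js arbitrary: \<alpha>)
  case Nil
  show ?case using Nil(2)[of "[]"] by simp
next
  case (Cons j js)
  have "int_poly_rep V A ev (\<lambda>f. jterm (D f) (c f) (add_mset i \<alpha>) js)" if "i \<noteq> k1" for i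
  proof (rule Cons.IH)
    fix ls :: "'n list" assume "length ls = length js" "set ls \<subseteq> -{k1}"
    with that show "int_poly_rep V A ev (\<lambda>f. D f (add_mset i \<alpha> + mset ls))"
      using Cons.prems(2)[of "i # ls"] by simp
  qed (use Cons.prems(1) in auto)
  with Cons.prems(1)[of j] show ?case
    by (auto intro!: int_poly_rep_sum int_poly_rep_mult)
qed

lemma jterm_zero: "j \<in> set js \<Longrightarrow> c j = (\<lambda>_. 0) \<Longrightarrow> jterm D c \<alpha> js = 0"
  by (induction js arbitrary: \<alpha>) auto

lemma nonpure_add_mset: "length ls = length js \<Longrightarrow> set ls \<subseteq> -{k} \<Longrightarrow> js \<noteq> [] \<Longrightarrow> \<not> set_mset (\<alpha> + mset ls) \<subseteq> {k}"
  by (cases ls) auto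

section \<open>The coefficients c_j and the invariants as integer polynomials in the jet\<close>

context
  fixes A :: "'f set" and D :: "'f \<Rightarrow> 'n::{finite,linorder} multiset \<Rightarrow> real" and G :: "'f \<Rightarrow> 'n rmat"
    and ev :: "'f \<Rightarrow> 'n jet_var \<Rightarrow> real"
  assumes jet: "\<And>f. f \<in> A \<Longrightarrow> corank_one_jet (D f) (G f)"
    and ev_partial: "\<And>f \<alpha>. ev f (PartialVar \<alpha>) = D f \<alpha>"
    and ev_inv: "\<And>f i j. ev f (InvVar i j) = G f $ i $ j"
begin

abbreviation "rep \<mu> \<equiv> int_poly_rep (admissible_vars \<mu>) A ev"
abbreviation "cf f \<equiv> corank_one_jet.c (D f) (G f)"

lemma rep_partial:
  assumes "3 \<le> size \<alpha>" "size \<alpha> \<le> \<mu>" "\<not> set_mset \<alpha> \<subseteq> {k1}"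
  shows "rep \<mu> (\<lambda>f. D f \<alpha>)"
  using int_poly_rep_var[of "PartialVar \<alpha>" "admissible_vars \<mu>" A ev] assms
  by (simp add: ev_partial admissible_vars_def)

lemma rep_inv: "i \<noteq> k1 \<Longrightarrow> j \<noteq> k1 \<Longrightarrow> rep \<mu> (\<lambda>f. G f $ i $ j)"
  using int_poly_rep_var[of "InvVar i j" "admissible_vars \<mu>" A ev]
  by (simp add: ev_inv admissible_vars_def)

text \<open>With r slots, a term contracts a derivative of f of order 1 + p + r. The weight bounds
  this by m + 1 \<le> \<mu>, and the index l makes it mixed. It is below 3 only for f_yz, which
  vanishes, and for the term left out of \<open>jrest\<close>.\<close>

lemma rep_jrest_aux:
  assumes c: "\<And>j i. j < m \<Longrightarrow> i \<noteq> k1 \<Longrightarrow> rep \<mu> (\<lambda>f. cf f j i)"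
    and m: "1 \<le> m" "m < \<mu>" and l: "l \<noteq> k1"
  shows "rep \<mu> (\<lambda>f. jrest (D f) (cf f) {#l#} m)"
  unfolding jrest_def
proof (rule int_poly_rep_sum_list)
  fix x assume "x \<in> set (filter (\<lambda>x. x \<noteq> (0, [m])) (jterms m))"
  then have x: "x \<in> set (jterms m)" "x \<noteq> (0, [m])" by auto
  obtain p js where pj: "x = (p, js)" by (cases x)
  have w: "p + sum_list js = m" "\<forall>j\<in>set js. 1 \<le> j" using jterms_weight[OF x(1)] pj by auto
  have len: "length js \<le> sum_list js" using length_le_sum_list[of js 1] w(2) by simp
  have small: "j < m" if "j \<in> set js" for j using jterms_rest_less[OF x(1) x(2)] that pj by simp
  show "rep \<mu> (\<lambda>f. jval (D f) (cf f) {#l#} x)"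
  proof (cases "p + length js \<ge> 2")
    case True
    show ?thesis unfolding jval_def
    proof (rule int_poly_rep_jterm)
      fix ls :: "'n list" assume ls: "length ls = length (snd x)" "set ls \<subseteq> -{k1}"
      show "rep \<mu> (\<lambda>f. D f ({#l#} + replicate_mset (fst x) k1 + mset ls))"
        using True w(1) len m(2) l ls by (intro rep_partial) (auto simp: pj)
    qed (use small c pj in auto)
  next
    case False
    moreover have "p + length js \<ge> 1" using w(1) m(1) by (cases js) auto
    ultimately have "p + length js = 1" by linarith
    then consider "p = 1" "js = []" | j where "p = 0" "js = [j]"
      by (cases p; cases js; cases "tl js") auto
    then show ?thesis
    proof cases
      case 1
      show ?thesis
        by (rule int_poly_rep_cong[OF int_poly_rep_zero])
          (use 1 corank_one_jet.D2'[OF jet] in \<open>simp add: pj jval_def add_mset_commute\<close>)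
    next
      case 2
      then show ?thesis using x(2) w(1) pj by simp
    qed
  qed
qed

lemma rep_c: "j < \<mu> \<Longrightarrow> rep \<mu> (\<lambda>f. cf f j i)"
proof (induction j arbitrary: i rule: less_induct)
  case (less m)
  show ?case
  proof (cases "m = 0 \<or> i = k1")
    case True
    show ?thesis
      by (rule int_poly_rep_cong[OF int_poly_rep_zero])
        (use True corank_one_jet.c_0[OF jet] corank_one_jet.c_k1[OF jet] in auto)
  next
    case False
    have "rep \<mu> (\<lambda>f. - (\<Sum>l\<in>-{k1}. G f $ i $ l * jrest (D f) (cf f) {#l#} m))"
      using False less by (intro int_poly_rep_uminus int_poly_rep_sum int_poly_rep_mult rep_inv rep_jrest_aux) auto
    then show ?thesis
      by (rule int_poly_rep_cong) (use False corank_one_jet.c_rec[OF jet] in auto)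
  qed
qed

lemma rep_jrest: "1 \<le> m \<Longrightarrow> m < \<mu> \<Longrightarrow> l \<noteq> k1 \<Longrightarrow> rep \<mu> (\<lambda>f. jrest (D f) (cf f) {#l#} m)"
  by (rule rep_jrest_aux) (auto intro: rep_c)

text \<open>Terms with a slot of order 1 vanish. In the others the order of the derivative of f is
  at most \<mu>, which is admissible from 3 on. Below 3 there remain f_z and f_yz, which vanish, and
  f_zz, which is not an admissible variable.\<close>

lemma rep_jval:
  assumes x: "x \<in> set (jterms (Suc \<mu>))" "snd x \<noteq> []" and \<mu>: "\<mu> \<ge> 2"
  shows "rep \<mu> (\<lambda>f. jval (D f) (cf f) {#} x)"
proof -
  obtain p js where pj: "x = (p, js)" by (cases x)
  have w: "p + sum_list js = Suc \<mu>" "\<forall>j\<in>set js. 1 \<le> j" using jterms_weight[OF x(1)] pj by auto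
  have js: "js \<noteq> []" using x(2) pj by simp
  have zero: ?thesis if "\<And>f. f \<in> A \<Longrightarrow> jval (D f) (cf f) {#} x = 0"
    by (rule int_poly_rep_cong[OF int_poly_rep_zero]) (use that in auto)
  show ?thesis
  proof (cases "1 \<in> set js")
    case True
    then show ?thesis
      by (intro zero) (auto simp: jval_def pj intro!: jterm_zero[of 1] corank_one_jet.c_1[OF jet])
  next
    case False
    then have two: "\<forall>j\<in>set js. 2 \<le> j" using w(2) by (metis Suc_1 le_antisym not_less_eq_eq)
    \<comment> \<open>With r slots of order at least 2 each, p + r \<le> \<mu> + 1 - r \<le>
      \<mu>.\<close>
    have len: "2 * length js \<le> sum_list js" using length_le_sum_list[OF two] .
    have pos: "length js \<ge> 1" using js by (cases js) auto
    consider "p + length js \<ge> 3" | j where "p = 0" "js = [j]" | j where "p = 1" "js = [j]"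
      | a b where "p = 0" "js = [a, b]"
    proof -
      have "p + length js \<ge> 3 \<or> (p = 0 \<and> length js = 1) \<or> (p = 1 \<and> length js = 1) \<or> (p = 0 \<and> length js = 2)"
        using pos by linarith
      then show thesis using that by (auto simp: length_Suc_conv numeral_2_eq_2)
    qed
    then show ?thesis
    proof cases
      case 1
      \<comment> \<open>The y-derivatives and the other slots use up at least 2 of the weight \<mu>
        + 1, so \<open>rep_c\<close> covers every coefficient that occurs.\<close>
      have small: "j < \<mu>" if "j \<in> set js" for j
      proof -
        obtain as bs where s: "js = as @ j # bs" using \<open>j \<in> set js\<close> by (meson split_list)
        have "2 * length as \<le> sum_list as" "2 * length bs \<le> sum_list bs"
          using two s by (auto intro!: length_le_sum_list)
        then show ?thesis using w(1) 1 unfolding s by simp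
      qed
      show ?thesis unfolding jval_def
      proof (rule int_poly_rep_jterm)
        fix ls :: "'n list" assume ls: "length ls = length (snd x)" "set ls \<subseteq> -{k1}"
        show "rep \<mu> (\<lambda>f. D f ({#} + replicate_mset (fst x) k1 + mset ls))"
        proof (rule rep_partial)
          show "\<not> set_mset ({#} + replicate_mset (fst x) k1 + mset ls) \<subseteq> {k1}"
            using nonpure_add_mset[OF ls x(2)] .
        qed (use 1 w(1) len pos ls pj in auto)
      qed (use small rep_c pj in auto)
    next
      case 2
      show ?thesis by (rule zero) (use 2 corank_one_jet.D1[OF jet] in \<open>simp add: jval_def pj\<close>)
    next
      case 3
      show ?thesis by (rule zero) (use 3 corank_one_jet.D2'[OF jet] in \<open>simp add: jval_def pj\<close>)
    next
      case 4
      then have ab: "a < \<mu>" "b < \<mu>" "1 \<le> b" using w(1) two by auto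
      \<comment> \<open>The contraction of f_zz with c_a and c_b equals that of c_a with - r_b, by
        \<open>H_c\<close>.\<close>
      have "rep \<mu> (\<lambda>f. \<Sum>i\<in>-{k1}. cf f a i * - jrest (D f) (cf f) {#i#} b)"
        using ab by (intro int_poly_rep_sum int_poly_rep_mult int_poly_rep_uminus rep_c rep_jrest) auto
      then show ?thesis
        by (rule int_poly_rep_cong)
          (use corank_one_jet.H_c[OF jet, of _ b] ab 4 in \<open>auto simp: jval_def pj intro!: sum.cong\<close>)
    qed
  qed
qed

lemma rep_a:
  assumes "\<mu> \<ge> 2"
  shows "rep \<mu> (\<lambda>f. corank_one_jet.a (D f) (G f) \<mu> - D f (replicate_mset (\<mu> + 1) k1))"
proof -
  have "rep \<mu> (\<lambda>f. \<Sum>x\<leftarrow>filter (\<lambda>x. snd x \<noteq> []) (jterms (Suc \<mu>)). jval (D f) (cf f) {#} x)"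
    using assms by (intro int_poly_rep_sum_list rep_jval) auto
  then show ?thesis
  proof (rule int_poly_rep_cong)
    fix f assume f: "f \<in> A"
    have "corank_one_jet.a (D f) (G f) \<mu> = jsum (D f) (cf f) {#} (Suc \<mu>)"
      by (simp add: corank_one_jet.a_def[OF jet[OF f]])
    also have "\<dots> = D f (replicate_mset (\<mu> + 1) k1) + (\<Sum>x\<leftarrow>filter (\<lambda>x. snd x \<noteq> []) (jterms (Suc \<mu>)). jval (D f) (cf f) {#} x)"
      unfolding jsum_def
      by (subst sum_list_filter_split[where P = "\<lambda>x. snd x = []"]) (simp add: jterms_nil jval_def del: jterms.simps)
    finally show "(\<Sum>x\<leftarrow>filter (\<lambda>x. snd x \<noteq> []) (jterms (Suc \<mu>)). jval (D f) (cf f) {#} x) =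
      corank_one_jet.a (D f) (G f) \<mu> - D f (replicate_mset (\<mu> + 1) k1)" by simp
  qed
qed

end

subsection \<open>The invariants of orders 2 to 5\<close>

text \<open>The coefficients here and in the next four lemmas count set partitions: p of the m
  elements are set apart for y, and a slot of order j is a block of size j. The newest block stands
  first, which is why \<open>[3, 2]\<close> and \<open>[2, 3]\<close> appear separately, with 4 + 6
  = 10. Slots of order 1 are discarded because c_1 = 0.\<close>

lemma sum_jterms_2:
  fixes g :: "nat \<times> nat list \<Rightarrow> real"
  assumes "\<And>x. 1 \<in> set (snd x) \<Longrightarrow> g x = 0"
  shows "(\<Sum>x\<leftarrow>jterms 2. g x) = g (2, []) + g (0, [2])"
proof -
  have [simp]: "g (p, js) = 0" if "Suc 0 \<in> set js" for p js
    using assms[of "(p, js)"] that by simp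
  show ?thesis by (simp add: eval_nat_numeral jstep_def)
qed

lemma sum_jterms_3:
  fixes g :: "nat \<times> nat list \<Rightarrow> real"
  assumes "\<And>x. 1 \<in> set (snd x) \<Longrightarrow> g x = 0"
  shows "(\<Sum>x\<leftarrow>jterms 3. g x) = g (3, []) + 3 * g (1, [2]) + g (0, [3])"
proof -
  have [simp]: "g (p, js) = 0" if "Suc 0 \<in> set js" for p js
    using assms[of "(p, js)"] that by simp
  show ?thesis by (simp add: eval_nat_numeral jstep_def)
qed

lemma sum_jterms_4:
  fixes g :: "nat \<times> nat list \<Rightarrow> real"
  assumes "\<And>x. 1 \<in> set (snd x) \<Longrightarrow> g x = 0"
  shows "(\<Sum>x\<leftarrow>jterms 4. g x) = g (4, []) + 6 * g (2, [2]) + 4 * g (1, [3]) + 3 * g (0, [2, 2]) + g (0, [4])"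
proof -
  have [simp]: "g (p, js) = 0" if "Suc 0 \<in> set js" for p js
    using assms[of "(p, js)"] that by simp
  show ?thesis by (simp add: eval_nat_numeral jstep_def)
qed

lemma sum_jterms_5:
  fixes g :: "nat \<times> nat list \<Rightarrow> real"
  assumes "\<And>x. 1 \<in> set (snd x) \<Longrightarrow> g x = 0"
  shows "(\<Sum>x\<leftarrow>jterms 5. g x) = g (5, []) + 10 * g (3, [2]) + 10 * g (2, [3]) + 15 * g (1, [2, 2]) + 5 * g (1, [4]) + 4 * g (0, [3, 2]) + 6 * g (0, [2, 3]) + g (0, [5])"
proof -
  have [simp]: "g (p, js) = 0" if "Suc 0 \<in> set js" for p js
    using assms[of "(p, js)"] that by simp
  show ?thesis by (simp add: eval_nat_numeral jstep_def)
qed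

lemma sum_jterms_6:
  fixes g :: "nat \<times> nat list \<Rightarrow> real"
  assumes "\<And>x. 1 \<in> set (snd x) \<Longrightarrow> g x = 0"
  shows "(\<Sum>x\<leftarrow>jterms 6. g x) = g (6, []) + 15 * g (4, [2]) + 20 * g (3, [3]) + 45 * g (2, [2, 2]) + 15 * g (2, [4]) + 24 * g (1, [3, 2]) + 36 * g (1, [2, 3]) + 6 * g (1, [5]) + 15 * g (0, [2, 2, 2]) + 5 * g (0, [4, 2]) + 10 * g (0, [3, 3]) + 10 * g (0, [2, 4]) + g (0, [6])"
proof -
  have [simp]: "g (p, js) = 0" if "Suc 0 \<in> set js" for p js
    using assms[of "(p, js)"] that by simp
  show ?thesis by (simp add: eval_nat_numeral jstep_def)
qed


lemma sum_UNIV_z: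
  fixes g :: "'n::{finite,linorder} \<Rightarrow> real"
  assumes "g k1 = 0"
  shows "sum g UNIV = sum g (-{k1})"
  using assms by (intro sum.mono_neutral_right) auto

lemma symmetric_matrix_dot:
  fixes A :: "real ^ 'n ^ 'n"
  assumes "transpose A = A"
  shows "(A *v u) \<bullet> v = u \<bullet> (A *v v)"
  by (metis assms dot_lmul_matrix transpose_matrix_vector)

section \<open>The invariants in vector notation\<close>

context corank_one_jet
begin

definition b :: "nat \<Rightarrow> 'n rvec" where
  "b j = (\<chi> i. if i = k1 then 0 else D (replicate_mset j k1 + {#i#}))"

definition M :: "nat \<Rightarrow> 'n rmat" where
  "M j = (\<chi> i m. if i = k1 \<or> m = k1 then 0 else D (replicate_mset j k1 + {#i, m#}))"

definition T :: "'n rvec \<Rightarrow> 'n rvec \<Rightarrow> 'n rvec \<Rightarrow> real" where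
  "T u v w = (\<Sum>i\<in>-{k1}. \<Sum>j\<in>-{k1}. \<Sum>m\<in>-{k1}. D {#i, j, m#} * u $ i * v $ j * w $ m)"

definition C :: "nat \<Rightarrow> 'n rvec" where "C j = (\<chi> i. c j i)"

definition R :: "nat \<Rightarrow> 'n rvec" where "R j = (\<chi> i. if i = k1 then 0 else jrest D c {#i#} j)"

lemma C_eq: "j \<ge> 1 \<Longrightarrow> C j = - (G *v R j)"
  by (simp add: C_def R_def vec_eq_iff matrix_vector_mult_def c_rec sum_UNIV_z cong: if_cong)

lemma M_dot: "(M p *v u) \<bullet> v = u \<bullet> (M p *v v)"
proof (rule symmetric_matrix_dot)
  show "transpose (M p) = M p"
    by (simp add: transpose_def M_def vec_eq_iff add_mset_commute)
qed

lemma G_dot: "(G *v u) \<bullet> v = u \<bullet> (G *v v)"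
  by (rule symmetric_matrix_dot) (use G_sym in \<open>simp add: transpose_def vec_eq_iff\<close>)

lemma jval_0: "jval D c {#} (p, []) = D (replicate_mset p k1)"
  by (simp add: jval_def)

lemma jval_1: "jval D c {#} (p, [j]) = C j \<bullet> b p"
  by (simp add: jval_def inner_vec_def C_def b_def sum_UNIV_z)

lemma jval_2: "jval D c {#} (p, [i, j]) = C i \<bullet> (M p *v C j)"
proof -
  have "(M p *v C j) $ k = (\<Sum>l\<in>-{k1}. D (replicate_mset p k1 + {#k, l#}) * c j l)" if "k \<noteq> k1" for k
    using that by (simp add: matrix_vector_mult_def M_def C_def sum_UNIV_z)
  then show ?thesis
    by (simp add: jval_def inner_vec_def sum_UNIV_z C_def c_k1)
      (intro sum.cong, auto simp: mult_ac add_mset_commute intro!: sum.cong)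
qed

text \<open>This is the place where f_zz leaves the explicit formulas.\<close>

lemma jval_2_0: "j \<ge> 1 \<Longrightarrow> jval D c {#} (0, [i, j]) = - (C i \<bullet> R j)"
  by (simp add: jval_def inner_vec_def C_def R_def c_k1 sum_UNIV_z H_c flip: sum_negf)

lemma jval_3_0: "jval D c {#} (0, [i, j, k]) = T (C i) (C j) (C k)"
  by (simp add: jval_def T_def C_def sum_distrib_left mult_ac add_mset_commute)

lemma jval_swap: "jval D c \<beta> (p, [i, j]) = jval D c \<beta> (p, [j, i])"
  unfolding jval_def fst_conv snd_conv by (rule jterm_swap)

lemma jval_one: "1 \<in> set (snd x) \<Longrightarrow> jval D c \<beta> x = 0"
  unfolding jval_def by (rule jterm_zero[of 1]) (simp_all only: c_1)

lemma jrest_eq: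
  assumes "m \<ge> 1"
  shows "jrest D c \<beta> m = jsum D c \<beta> m - jval D c \<beta> (0, [m])"
  using jsum_eq_jrest[OF assms, of D c \<beta>] by (simp add: jval_def)

lemma b_1: "b 1 = 0" and b_0: "b 0 = 0"
  by (simp_all add: b_def vec_eq_iff D1 D2')

lemma R_2: "R 2 = b 2"
proof -
  have "jrest D c {#i#} 2 = D (replicate_mset 2 k1 + {#i#})" for i
    using sum_jterms_2[of "jval D c {#i#}", OF jval_one] jrest_eq[of 2 "{#i#}"]
    by (simp add: jsum_def jval_def)
  then show ?thesis by (simp add: R_def b_def vec_eq_iff)
qed

lemma R_3: "R 3 = b 3 + 3 *\<^sub>R (M 1 *v C 2)"
proof -
  have "jrest D c {#i#} 3 = D (replicate_mset 3 k1 + {#i#}) + 3 * (\<Sum>l\<in>-{k1}. c 2 l * D {#l, k1, i#})" for i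
    using sum_jterms_3[of "jval D c {#i#}", OF jval_one] jrest_eq[of 3 "{#i#}"]
    by (simp add: jsum_def jval_def)
  moreover have "(M 1 *v C 2) $ i = (if i = k1 then 0 else \<Sum>l\<in>-{k1}. c 2 l * D {#l, k1, i#})" for i
    by (simp add: matrix_vector_mult_def M_def C_def sum_UNIV_z)
      (auto intro!: sum.cong simp: mult.commute add_mset_commute)
  ultimately show ?thesis by (simp add: R_def b_def vec_eq_iff)
qed

lemma C_2: "C 2 = - (G *v b 2)"
  by (simp add: C_eq R_2)

lemma C_3: "C 3 = - (G *v b 3) + 3 *\<^sub>R (G *v (M 1 *v (G *v b 2)))"
  by (simp add: C_eq[of 3] R_3 C_2 matrix_vector_right_distrib matrix_vector_mult_scaleR
      linear_neg[OF matrix_vector_mul_linear] linear_diff[OF matrix_vector_mul_linear] del: One_nat_def)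

lemma a_2: "a 2 = D (replicate_mset 3 k1)"
  using sum_jterms_3[of "jval D c {#}", OF jval_one]
  by (simp add: a_def jsum_def jval_0 jval_1 b_1 b_0 del: jterms.simps One_nat_def)

lemma a_3: "a 3 = D (replicate_mset 4 k1) - 3 * (b 2 \<bullet> (G *v b 2))"
proof -
  have "a 3 = D (replicate_mset 4 k1) + 6 * (C 2 \<bullet> b 2) - 3 * (C 2 \<bullet> R 2)"
    using sum_jterms_4[of "jval D c {#}", OF jval_one]
    by (simp add: a_def jsum_def jval_0 jval_1 jval_2_0 b_1 b_0 del: jterms.simps One_nat_def)
  \<comment> \<open>Since c_2 = - G b_2 and r_2 = b_2, the two contributions combine to -6 + 3 =
    -3.\<close>
  then show ?thesis by (simp add: R_2 C_2 G_dot)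
qed

lemma a_4: "a 4 = D (replicate_mset 5 k1) - 10 * (b 2 \<bullet> (G *v b 3)) + 15 * (b 2 \<bullet> (G *v (M 1 *v (G *v b 2))))"
proof -
  have s: "jval D c {#} (0, [3, 2]) = - (C 3 \<bullet> R 2)" "jval D c {#} (0, [2, 3]) = - (C 3 \<bullet> R 2)"
    using jval_swap[of "{#}" 0 2 3] jval_2_0[of 2 3] by simp_all
  have "a 4 = D (replicate_mset 5 k1) + 10 * (C 2 \<bullet> b 3) + 10 * (C 3 \<bullet> b 2) + 15 * (C 2 \<bullet> (M 1 *v C 2)) - 10 * (C 3 \<bullet> R 2)"
    using sum_jterms_5[of "jval D c {#}", OF jval_one]
    by (simp add: a_def jsum_def s jval_0 jval_1 jval_2[of 1] b_1 b_0 del: jterms.simps One_nat_def)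
  \<comment> \<open>The two contributions of \<open>C 3\<close> cancel because \<open>R 2\<close> is
    \<open>b 2\<close>.\<close>
  then show ?thesis
    by (simp add: R_2 C_2 G_dot linear_neg[OF matrix_vector_mul_linear] del: One_nat_def)
qed

lemma T_neg: "T (- u) (- u) (- u) = - T u u u"
  by (simp add: T_def sum_negf)

lemma a_5: "a 5 = D (replicate_mset 6 k1) - 15 * (b 2 \<bullet> (G *v b 4))
    + 60 * (b 2 \<bullet> (G *v (M 1 *v (G *v b 3))))
    - 90 * (b 2 \<bullet> (G *v (M 1 *v (G *v (M 1 *v (G *v b 2))))))
    - 10 * (b 3 \<bullet> (G *v b 3))
    + 45 * (b 2 \<bullet> (G *v (M 2 *v (G *v b 2))))
    - 15 * T (G *v b 2) (G *v b 2) (G *v b 2)"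
proof -
  have s: "jval D c {#} (0, [4, 2]) = - (C 4 \<bullet> R 2)" "jval D c {#} (0, [2, 4]) = - (C 4 \<bullet> R 2)"
    "jval D c {#} (0, [3, 3]) = - (C 3 \<bullet> R 3)"
    using jval_swap[of "{#}" 0 2 4] jval_2_0[of 2 4] jval_2_0[of 3 3]
    by simp_all
  have m: "C 3 \<bullet> (M 1 *v C 2) = C 2 \<bullet> (M 1 *v C 3)" by (metis M_dot inner_commute)
  have P: "b 3 \<bullet> (G *v (M 1 *v (G *v b 2))) = b 2 \<bullet> (G *v (M 1 *v (G *v b 3)))"
    by (metis G_dot M_dot inner_commute)
  have "a 5 = D (replicate_mset 6 k1) + 15 * (C 2 \<bullet> b 4) + 20 * (C 3 \<bullet> b 3) + 45 * (C 2 \<bullet> (M 2 *v C 2))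
      + 15 * (C 4 \<bullet> b 2) + 60 * (C 2 \<bullet> (M 1 *v C 3)) + 15 * T (C 2) (C 2) (C 2) - 15 * (C 4 \<bullet> R 2)
      - 10 * (C 3 \<bullet> R 3)"
    using sum_jterms_6[of "jval D c {#}", OF jval_one]
    by (simp add: a_def jsum_def s m jval_0 jval_1 jval_2[of 1] jval_2[of 2] jval_3_0 b_1 b_0 del: jterms.simps One_nat_def)
  \<comment> \<open>\<open>C 4\<close> cancels because \<open>R 2\<close> is \<open>b 2\<close>. By
    \<open>R_3\<close> the terms with \<open>C 3\<close> add up to (20 - 10) C_3 . R_3 = -10 R_3 . G
    R_3, whose expansion gives the coefficients -10, 60 and -90.\<close>
  then show ?thesis
    by (simp add: R_2 R_3 C_2 C_3 G_dot M_dot P T_neg linear_neg[OF matrix_vector_mul_linear]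
        matrix_vector_right_distrib matrix_vector_mult_scaleR inner_add_left inner_add_right
        inner_diff_left inner_diff_right linear_diff[OF matrix_vector_mul_linear] algebra_simps del: One_nat_def)
qed

end

section \<open>The matrix square root and the second-order Taylor formula\<close>

lemma has_derivative_vecI:
  fixes f :: "'a::real_normed_vector \<Rightarrow> real ^ 'm::finite"
  assumes "\<And>i. ((\<lambda>x. f x $ i) has_derivative (\<lambda>v. f' v $ i)) F"
  shows "(f has_derivative f') F"
proof -
  have eq: "w = (\<Sum>i\<in>UNIV. w $ i *\<^sub>R axis i 1)" for w :: "real ^ 'm"
    using basis_expansion[of w] by (simp add: scalar_mult_eq_scaleR)
  have "((\<lambda>x. \<Sum>i\<in>UNIV. f x $ i *\<^sub>R axis i (1::real)) has_derivative
      (\<lambda>v. \<Sum>i\<in>UNIV. f' v $ i *\<^sub>R axis i 1)) F"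
    by (intro has_derivative_sum has_derivative_scaleR_left assms)
  then show ?thesis by (simp flip: eq)
qed

lemma has_derivative_nth:
  "(f has_derivative f') F \<Longrightarrow> ((\<lambda>x. (f x :: real ^ 'm::finite) $ i) has_derivative (\<lambda>v. f' v $ i)) F"
  by (rule bounded_linear.has_derivative[OF bounded_linear_vec_nth])

text \<open>Matrices are encoded as vectors indexed by pairs. To make the solution symmetric without an appeal to
  uniqueness, the quadratic term is evaluated at the symmetric part of the unknown.\<close>

lemma quadratic_matrix_equation:
  fixes K :: "'n::finite \<Rightarrow> 'n \<Rightarrow> real"
  assumes K: "\<And>i j. K i j = K j i"
  obtains V and Q :: "real ^ ('n \<times> 'n) \<Rightarrow> 'n \<Rightarrow> 'n \<Rightarrow> real"
  where "open V" "0 \<in> V" "\<And>i j. smooth_on V (\<lambda>E. Q E i j)" "\<And>i j. Q 0 i j = 0"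
    "\<And>E i j. Q E i j = Q E j i"
    "\<And>E i j. E \<in> V \<Longrightarrow> (\<And>i j. E $ (i, j) = E $ (j, i)) \<Longrightarrow>
       2 * Q E i j + (\<Sum>k\<in>UNIV. \<Sum>l\<in>UNIV. Q E i k * K k l * Q E l j) = E $ (i, j)"
proof -
  define S where "S P i j = 1 / 2 * (P $ (i, j) + P $ (j, i))" for P :: "real ^ ('n \<times> 'n)" and i j
  define N where "N P i j = (\<Sum>k\<in>UNIV. \<Sum>l\<in>UNIV. S P i k * K k l * S P l j)" for P i j
  define \<phi> where "\<phi> P = (\<chi> x. 2 * P $ x + N P (fst x) (snd x))" for P
  have Ssym: "S P i j = S P j i" for P i j by (simp add: S_def)
  have Nsym: "N P i j = N P j i" for P i j
    unfolding N_def by (subst sum.swap) (simp add: K[of _ "_ :: 'n"] Ssym mult_ac)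
  have smS: "smooth_on A (\<lambda>P. S P i j)" if "open A" for A i j
    unfolding S_def using that by (intro smooth_intros)
  have \<phi>nth: "\<phi> P $ (i, j) = 2 * P $ (i, j) + N P i j" for P i j by (simp add: \<phi>_def)
  have sm: "smooth_on UNIV \<phi>"
    unfolding \<phi>_def N_def by (intro smooth_intros smS)
  have S0: "S 0 i j = 0" for i j by (simp add: S_def)
  have dS: "((\<lambda>P. S P i j) has_derivative (\<lambda>v. S v i j)) (at 0)" for i j
    unfolding S_def
    by (intro has_derivative_mult_right has_derivative_add has_derivative_nth has_derivative_ident)
  \<comment> \<open>The quadratic part has derivative 0 at the origin, so the derivative of
    \<open>\<phi>\<close> there is twice the identity.\<close>
  have dN: "((\<lambda>P. N P i j) has_derivative (\<lambda>v. 0)) (at 0)" for i j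
  proof -
    have "((\<lambda>P. N P i j) has_derivative (\<lambda>v. \<Sum>k\<in>UNIV. \<Sum>l\<in>UNIV.
       S 0 i k * K k l * S v l j + (S 0 i k * 0 + S v i k * K k l) * S 0 l j)) (at 0)"
      unfolding N_def
      by (intro has_derivative_sum has_derivative_mult dS has_derivative_const)
    then show ?thesis by (simp add: S0)
  qed
  have "(\<phi> has_derivative (\<lambda>v. 2 *\<^sub>R v)) (at 0)"
  proof (rule has_derivative_vecI)
    fix x
    show "((\<lambda>P. \<phi> P $ x) has_derivative (\<lambda>v. (2 *\<^sub>R v) $ x)) (at 0)"
      using has_derivative_add[OF has_derivative_mult_right[OF has_derivative_nth[OF has_derivative_ident], of 2 x] dN[of "fst x" "snd x"]]
      by (simp add: \<phi>_def)
  qed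
  then have fd: "frechet_derivative \<phi> (at 0) v = 2 *\<^sub>R v" for v
    using frechet_derivative_at by metis
  have \<phi>0: "\<phi> 0 = 0" by (simp add: \<phi>_def N_def S0 vec_eq_iff)
  have inj: "frechet_derivative \<phi> (at 0) v = 0 \<Longrightarrow> v = 0" for v by (simp add: fd)
  obtain U V \<psi> where I0: "open U" "U \<subseteq> UNIV" "0 \<in> U" "open V" "0 \<in> V" "homeomorphism U V \<phi> \<psi>" "smooth_on V \<psi>"
    by (rule smooth_inverse_function[OF open_UNIV UNIV_I sm \<phi>0 inj])
  note I = I0(4-7) I0(3)
  have \<psi>0: "\<psi> 0 = 0" using I(3,5) \<phi>0 by (auto simp: homeomorphism_def)
  show thesis
  proof (rule that[of V "\<lambda>E. S (\<psi> E)"])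
    show "smooth_on V (\<lambda>E. S (\<psi> E) i j)" for i j
      by (rule smooth_on_compose_UNIV[OF smS I(1) I(4)]) simp
    show "2 * S (\<psi> E) i j + (\<Sum>k\<in>UNIV. \<Sum>l\<in>UNIV. S (\<psi> E) i k * K k l * S (\<psi> E) l j) = E $ (i, j)"
      if E: "E \<in> V" "\<And>i j. E $ (i, j) = E $ (j, i)" for E i j
    proof -
      have "\<phi> (\<psi> E) = E" using I(3) E(1) by (auto simp: homeomorphism_def)
      then have e: "E $ (i, j) = 2 * \<psi> E $ (i, j) + N (\<psi> E) i j" for i j
        using \<phi>nth[of "\<psi> E" i j] by simp
      \<comment> \<open>Averaging the equations at (i, j) and (j, i) turns the linear term into its
        symmetric part; the quadratic term contains only symmetric parts already.\<close>
      have "2 * E $ (i, j) = E $ (i, j) + E $ (j, i)" using E(2) by simp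
      also have "\<dots> = 2 * (2 * S (\<psi> E) i j + N (\<psi> E) i j)"
        unfolding e using Nsym[of "\<psi> E" j i] by (simp add: S_def)
      finally show ?thesis by (simp add: N_def)
    qed
  qed (use I S0 \<psi>0 Ssym in auto)
qed

lemma taylor_second_order:
  fixes f :: "'n::{finite,linorder} rvec \<Rightarrow> real"
  assumes sm: "smooth_on UNIV f"
  shows "f (p + v) = f p + (\<Sum>i\<in>UNIV. v $ i * mixed_partial {#i#} f p) +
    (\<Sum>i\<in>UNIV. \<Sum>j\<in>UNIV. v $ i * v $ j * integral {0..1} (\<lambda>t. (1 - t) * mixed_partial {#i, j#} f (p + t *\<^sub>R v)))"
proof -
  define fv where "fv q = frechet_derivative f (at q) v" for q
  have fv: "fv q = (\<Sum>i\<in>UNIV. v $ i * mixed_partial {#i#} f q)" for q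
    by (simp add: fv_def frechet_derivative_partials[OF sm] mixed_partial_add_mset[OF sm])
  have smv: "smooth_on UNIV fv" unfolding fv_def by (rule smooth_onD(2)[OF sm])
  have fvv: "frechet_derivative fv (at q) v = (\<Sum>i\<in>UNIV. \<Sum>j\<in>UNIV. v $ i * v $ j * mixed_partial {#i, j#} f q)" for q
  proof -
    have "(fv has_derivative (\<lambda>w. \<Sum>i\<in>UNIV. v $ i * frechet_derivative (mixed_partial {#i#} f) (at q) w)) (at q)"
      unfolding fv by (intro has_derivative_sum has_derivative_mult_right smooth_onD(1)[OF smooth_mixed_partial[OF sm]]) auto
    from fun_cong[OF frechet_derivative_at[OF this], of v, symmetric]
    have "frechet_derivative fv (at q) v = (\<Sum>i\<in>UNIV. v $ i * frechet_derivative (mixed_partial {#i#} f) (at q) v)" .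
    also have "\<dots> = (\<Sum>i\<in>UNIV. v $ i * (\<Sum>j\<in>UNIV. v $ j * mixed_partial {#j, i#} f q))"
      unfolding frechet_derivative_partials[OF smooth_mixed_partial[OF sm]] mixed_partial_add_mset[OF sm, symmetric] ..
    finally show ?thesis
      unfolding sum_distrib_left mult.assoc[symmetric] by (simp only: add_mset_commute)
  qed
  let ?u' = "\<lambda>t. (1 - t) * frechet_derivative fv (at (p + t *\<^sub>R v)) v"
  \<comment> \<open>In the derivative of this function the two first-order contributions cancel,
    which leaves 1 - t times the second derivative.\<close>
  have "((\<lambda>t. f (p + t *\<^sub>R v) + (1 - t) * fv (p + t *\<^sub>R v)) has_real_derivative ?u' t) (at t within {0..1})" for t
  proof -
    have "((\<lambda>t. 1 - t) has_real_derivative - 1) (at t)" by (auto intro!: derivative_eq_intros)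
    from DERIV_add[OF has_derivative_along_line[OF sm, of p v t] DERIV_mult[OF this has_derivative_along_line[OF smv, of p v t]]]
    have "((\<lambda>t. f (p + t *\<^sub>R v) + (1 - t) * fv (p + t *\<^sub>R v)) has_real_derivative ?u' t) (at t)"
      by (simp add: fv_def mult.commute)
    then show ?thesis by (rule has_field_derivative_at_within)
  qed
  then have "(?u' has_integral (f (p + 1 *\<^sub>R v) + (1 - 1) * fv (p + 1 *\<^sub>R v) - (f (p + 0 *\<^sub>R v) + (1 - 0) * fv (p + 0 *\<^sub>R v)))) {0..1}"
    by (intro fundamental_theorem_of_calculus)
      (auto simp flip: has_real_derivative_iff_has_vector_derivative)
  from integral_unique[OF this] have "f (p + v) = f p + fv p + integral {0..1} ?u'" by simp
  also have "integral {0..1} ?u' = (\<Sum>i\<in>UNIV. \<Sum>j\<in>UNIV. v $ i * v $ j * integral {0..1} (\<lambda>t. (1 - t) * mixed_partial {#i, j#} f (p + t *\<^sub>R v)))"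
  proof -
    have int: "(\<lambda>t. (1 - t) * mixed_partial {#i, j#} f (p + t *\<^sub>R v)) integrable_on {0..1}" for i j
      by (intro integrable_continuous_real continuous_intros
          continuous_on_compose2[OF smooth_onD(3)[OF smooth_mixed_partial[OF sm]]]) auto
    have "?u' = (\<lambda>t. \<Sum>i\<in>UNIV. \<Sum>j\<in>UNIV. v $ i * v $ j * ((1 - t) * mixed_partial {#i, j#} f (p + t *\<^sub>R v)))"
      by (simp add: fvv sum_distrib_left mult_ac)
    then show ?thesis
      by (simp add: integral_sum integrable_sum integrable_on_mult_right int)
  qed
  finally show ?thesis by (simp add: fv)
qed

subsection \<open>The adapted curve\<close>

text \<open>The derivative of order j of the polynomial with terms c_l t^l / l!, for all j at once,
  because \<open>jterm\<close> takes the whole family of derivatives of a curve.\<close>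

definition Zpoly :: "(nat \<Rightarrow> 'n \<Rightarrow> real) \<Rightarrow> nat \<Rightarrow> nat \<Rightarrow> real \<Rightarrow> 'n \<Rightarrow> real" where
  "Zpoly c N j t i = (\<Sum>l\<le>N. if j \<le> l then c l i * t ^ (l - j) / fact (l - j) else 0)"

lemma Zpoly_derivative: "((\<lambda>t. Zpoly c N j t i) has_real_derivative Zpoly c N (Suc j) t i) (at t)"
  unfolding Zpoly_def
proof (rule DERIV_sum)
  fix l
  show "((\<lambda>t. if j \<le> l then c l i * t ^ (l - j) / fact (l - j) else 0) has_real_derivative
      (if Suc j \<le> l then c l i * t ^ (l - Suc j) / fact (l - Suc j) else 0)) (at t)"
  proof (cases "Suc j \<le> l")
    case True
    define k where "k = l - Suc j"
    have k: "l - j = Suc k" using True by (simp add: k_def)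
    have "((\<lambda>t. c l i * t ^ Suc k / fact (Suc k)) has_real_derivative c l i * (real (Suc k) * t ^ k) / fact (Suc k)) (at t)"
      by (auto intro!: derivative_eq_intros simp del: power_Suc)
    also have "c l i * (real (Suc k) * t ^ k) / fact (Suc k) = c l i * t ^ k / fact k"
      by (simp add: divide_simps del: of_nat_Suc)
    finally show ?thesis using True by (simp add: k flip: k_def)
  next
    case False
    then show ?thesis by (cases "j = l") auto
  qed
qed

lemma Zpoly_at_0: "Zpoly c N j 0 i = (if j \<le> N then c j i else 0)"
proof -
  have "(if j \<le> l then c l i * 0 ^ (l - j) / fact (l - j) else 0) = (if l = j then c j i else 0)" for l
    by (auto simp: power_0_left)
  then show ?thesis unfolding Zpoly_def by (simp add: sum.delta')
qed

locale adapted_curve =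
  fixes f :: "'n::{finite,linorder} rvec \<Rightarrow> real" and G :: "'n rmat" and N :: nat
  assumes sm: "smooth_on UNIV f"
    and jet: "corank_one_jet (\<lambda>\<alpha>. mixed_partial \<alpha> f 0) G"
begin

sublocale corank_one_jet "\<lambda>\<alpha>. mixed_partial \<alpha> f 0" G
  by (rule jet)

definition cN :: "nat \<Rightarrow> 'n \<Rightarrow> real" where "cN = zcoef_upto (\<lambda>\<alpha>. mixed_partial \<alpha> f 0) G N"

definition \<zeta> :: "nat \<Rightarrow> real \<Rightarrow> 'n rvec" where "\<zeta> j t = (\<chi> i. Zpoly cN N j t i)"

definition \<gamma> :: "real \<Rightarrow> 'n rvec" where "\<gamma> t = t *\<^sub>R axis k1 1 + \<zeta> 0 t"

text \<open>The m-th derivative of the partial derivative \<open>\<beta>\<close> of f along the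
  curve, by \<open>d_0\<close> and \<open>d_derivative\<close>; in this form its value at 0 is read
  off from the jet.\<close>

definition d :: "'n multiset \<Rightarrow> nat \<Rightarrow> real \<Rightarrow> real" where
  "d \<beta> m t = jsum (\<lambda>\<alpha>. mixed_partial \<alpha> f (\<gamma> t)) (\<lambda>j i. \<zeta> j t $ i) \<beta> m"

lemma cN_eq: "cN j = (if j \<le> N then c j else (\<lambda>_. 0))"
  unfolding cN_def c_def by (rule zcoef_upto_eq)

lemma \<zeta>_at_0: "\<zeta> j 0 $ i = cN j i"
  by (simp add: \<zeta>_def Zpoly_at_0 cN_eq)

lemma \<zeta>_0_0: "\<zeta> 0 0 = 0"
  by (simp add: vec_eq_iff \<zeta>_at_0 cN_eq c_0)

lemma \<zeta>_k1: "\<zeta> j t $ k1 = 0"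
  by (simp add: \<zeta>_def Zpoly_def cN_eq c_k1 cong: if_cong)

lemma \<gamma>_k1: "\<gamma> t $ k1 = t"
  by (simp add: \<gamma>_def \<zeta>_k1)

lemma \<gamma>_0: "\<gamma> 0 = 0"
  by (simp add: \<gamma>_def \<zeta>_0_0)

lemma \<zeta>_nth_derivative: "((\<lambda>t. \<zeta> j t $ i) has_real_derivative \<zeta> (Suc j) t $ i) (at t)"
  using Zpoly_derivative[of cN N j i t] by (simp add: \<zeta>_def)

lemma smooth_\<zeta>: "smooth_on UNIV (\<zeta> j)"
proof -
  have "smooth_on UNIV (\<lambda>t. \<chi> i. \<zeta> j t $ i)"
    by (rule smooth_on_vec_lambda[OF open_UNIV])
      (rule smooth_on_UNIV_real_derivatives[where d = "\<lambda>j t. \<zeta> j t $ i" for i], rule \<zeta>_nth_derivative)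
  then show ?thesis by simp
qed

lemma smooth_\<gamma>: "smooth_on UNIV \<gamma>"
  unfolding \<gamma>_def[abs_def] by (intro smooth_intros smooth_\<zeta>)

lemma \<gamma>_derivative: "(\<gamma> has_vector_derivative (axis k1 1 + \<zeta> 1 t)) (at t)"
  unfolding has_vector_derivative_def
proof (rule has_derivative_vecI)
  fix i
  have "((\<lambda>t. \<gamma> t $ i) has_real_derivative (axis k1 1 + \<zeta> 1 t) $ i) (at t)"
    unfolding \<gamma>_def
    using \<zeta>_nth_derivative[of 0 i t] by (auto intro!: derivative_eq_intros)
  moreover have "(\<lambda>h. (h *\<^sub>R (axis k1 1 + \<zeta> 1 t)) $ i) = (*) ((axis k1 1 + \<zeta> 1 t) $ i)"
    by (simp add: fun_eq_iff mult.commute)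
  ultimately show "((\<lambda>t. \<gamma> t $ i) has_derivative (\<lambda>h. (h *\<^sub>R (axis k1 1 + \<zeta> 1 t)) $ i)) (at t)"
    by (simp only: has_field_derivative_def)
qed

lemma partial_\<gamma>_derivative:
  "((\<lambda>t. mixed_partial \<alpha> f (\<gamma> t)) has_real_derivative mixed_partial (add_mset k1 \<alpha>) f (\<gamma> t)
     + (\<Sum>i\<in>-{k1}. \<zeta> 1 t $ i * mixed_partial (add_mset i \<alpha>) f (\<gamma> t))) (at t)"
proof -
  have "(\<Sum>i\<in>UNIV. (axis k1 1 + \<zeta> 1 t) $ i * mixed_partial (add_mset i \<alpha>) f (\<gamma> t)) =
      (\<Sum>i\<in>insert k1 (-{k1}). (axis k1 1 + \<zeta> 1 t) $ i * mixed_partial (add_mset i \<alpha>) f (\<gamma> t))"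
    by (rule sum.cong) auto
  also have "\<dots> = mixed_partial (add_mset k1 \<alpha>) f (\<gamma> t)
     + (\<Sum>i\<in>-{k1}. (axis k1 1 + \<zeta> 1 t) $ i * mixed_partial (add_mset i \<alpha>) f (\<gamma> t))"
    by (subst sum.insert) (auto simp: \<zeta>_k1)
  also have "(\<Sum>i\<in>-{k1}. (axis k1 1 + \<zeta> 1 t) $ i * mixed_partial (add_mset i \<alpha>) f (\<gamma> t)) =
      (\<Sum>i\<in>-{k1}. \<zeta> 1 t $ i * mixed_partial (add_mset i \<alpha>) f (\<gamma> t))"
    by (rule sum.cong) (auto simp: axis_def)
  finally show ?thesis using mixed_partial_along_curve[OF sm \<gamma>_derivative, of \<alpha> t] by simp
qed

lemma d_derivative: "(d \<beta> m has_real_derivative d \<beta> (Suc m) t) (at t)"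
  unfolding d_def[abs_def]
  by (rule has_derivative_jsum) (use partial_\<gamma>_derivative \<zeta>_nth_derivative in auto)

lemma d_0: "d \<beta> 0 t = mixed_partial \<beta> f (\<gamma> t)"
  by (simp add: d_def jsum_def jval_def)

lemma d_at_0: "d \<beta> m 0 = jsum (\<lambda>\<alpha>. mixed_partial \<alpha> f 0) cN \<beta> m"
  by (simp add: d_def \<gamma>_0 \<zeta>_at_0)

lemma d_z_at_0: "i \<noteq> k1 \<Longrightarrow> m \<le> N \<Longrightarrow> d {#i#} m 0 = 0"
  unfolding d_at_0 cN_def by (rule jsum_upto_z)

lemma d_y_at_0: "2 \<le> m \<Longrightarrow> m \<le> N \<Longrightarrow> d {#} (Suc m) 0 = a m"
  using jsum_upto_y[of "Suc m" N] unfolding d_at_0 cN_def by (simp add: a_def)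

lemma d_y_1: "N \<ge> 1 \<Longrightarrow> d {#} (Suc 0) 0 = 0"
  using jsum_upto_y[of 1 N] unfolding d_at_0 cN_def by (simp add: jsum_def jstep_def jval_def D1)

lemma d_y_2: "N \<ge> 1 \<Longrightarrow> d {#} (Suc (Suc 0)) 0 = 0"
proof -
  assume "N \<ge> 1"
  then have "d {#} 2 0 = jsum (\<lambda>\<alpha>. mixed_partial \<alpha> f 0) c {#} 2"
    using jsum_upto_y[of 2 N] unfolding d_at_0 cN_def by simp
  also have "\<dots> = 0"
    unfolding jsum_def using sum_jterms_2[of "jval (\<lambda>\<alpha>. mixed_partial \<alpha> f 0) c {#}", OF jval_one]
    by (simp add: jval_0 jval_1 b_0 eval_nat_numeral D2 del: jterms.simps)
  finally show ?thesis by (simp add: numeral_2_eq_2)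
qed

lemma partial_z_on_\<gamma>:
  assumes "i \<noteq> k1"
  obtains \<rho> where "smooth_on UNIV \<rho>" "\<And>t. mixed_partial {#i#} f (\<gamma> t) = t ^ Suc N * \<rho> t"
proof -
  have z: "d {#i#} j 0 = 0" if "j < Suc N" for j using d_z_at_0[OF assms] that by simp
  show thesis
  proof (rule smooth_power_quotient[of "d {#i#}" "Suc N", OF d_derivative z])
    fix u assume "smooth_on UNIV u" "\<And>t. d {#i#} 0 t = t ^ Suc N * u t"
    then show thesis using that[of u] unfolding d_0 by blast
  qed
qed

lemma f_on_\<gamma>:
  assumes "2 \<le> m" "m \<le> N" "\<And>j. 2 \<le> j \<Longrightarrow> j < m \<Longrightarrow> a j = 0"
  obtains u where "smooth_on UNIV u" "\<And>t. f (\<gamma> t) = f 0 + t ^ Suc m * u t" "u 0 = a m / fact (Suc m)"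
proof -
  \<comment> \<open>Subtracting the constant f(0) changes only the member of order 0 in the family
    of derivatives.\<close>
  define e where "e j t = (if j = 0 then d {#} 0 t - f 0 else d {#} j t)" for j t
  have e: "(e j has_real_derivative e (Suc j) t) (at t)" for j t
    using d_derivative[of "{#}" j t] by (cases j) (auto simp: e_def[abs_def] intro!: derivative_eq_intros)
  have "e j 0 = 0" if "j < Suc m" for j
  proof -
    consider "j = 0" | "j = Suc 0" | "j = Suc (Suc 0)" | i where "j = Suc i" "2 \<le> i"
    proof -
      have "j = 0 \<or> j = Suc 0 \<or> j = Suc (Suc 0) \<or> (\<exists>i\<ge>2. j = Suc i)"
        by (cases j; cases "j - 1"; cases "j - 2") auto
      then show thesis using that by blast
    qed
    then show ?thesis
    proof cases
      case 1
      then show ?thesis by (simp add: e_def d_0 \<gamma>_0)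
    next
      case (4 i)
      then show ?thesis using that assms d_y_at_0[of i] by (simp add: e_def)
    qed (use assms d_y_1 d_y_2 in \<open>auto simp: e_def\<close>)
  qed
  note e0 = this
  show thesis
  proof (rule smooth_power_quotient[of e, OF e e0])
    fix u assume u: "smooth_on UNIV u" "\<And>t. e 0 t = t ^ Suc m * u t" "u 0 = e (Suc m) 0 / fact (Suc m)"
    show thesis
    proof (rule that[OF u(1)])
      show "f (\<gamma> t) = f 0 + t ^ Suc m * u t" for t
        using u(2)[of t] by (simp add: e_def d_0)
      show "u 0 = a m / fact (Suc m)" using u(3) d_y_at_0[OF assms(1,2)] by (simp add: e_def)
    qed
  qed
qed

end

subsection \<open>Reduction to the normal form\<close>

text \<open>If \<open>2 q + q K q = B - B0\<close> with \<open>K = B0\<^sup>-\<^sup>1\<close>, then \<open>(1 + K q)\<^sup>T B0 (1 + K q) = B\<close>.\<close>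

lemma matrix_square_root_congruence:
  fixes B K q :: "'n::{finite,linorder} \<Rightarrow> 'n \<Rightarrow> real" and z :: "'n \<Rightarrow> real"
  assumes z: "z k1 = 0" and K: "\<And>i j. K i j = K j i" "\<And>i. K i k1 = 0"
    and B: "\<And>i j. B i j = B j i" and q: "\<And>i j. q i j = q j i"
    and BK: "\<And>i m. i \<noteq> k1 \<Longrightarrow> m \<noteq> k1 \<Longrightarrow> (\<Sum>j\<in>-{k1}. B i j * K j m) = (if i = m then 1 else 0)"
  defines "n \<equiv> \<lambda>i. \<Sum>m\<in>UNIV. \<Sum>l\<in>UNIV. K i m * q m l * z l"
  shows "(\<Sum>i\<in>-{k1}. \<Sum>j\<in>-{k1}. B i j * (z i + n i) * (z j + n j)) =
    (\<Sum>i\<in>UNIV. \<Sum>j\<in>UNIV. z i * z j * (B i j + (2 * q i j + (\<Sum>k\<in>UNIV. \<Sum>l\<in>UNIV. q i k * K k l * q l j))))"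
proof -
  define p where "p m = (\<Sum>l\<in>UNIV. q m l * z l)" for m
  have n: "n i = (\<Sum>m\<in>UNIV. K i m * p m)" for i
    by (simp add: n_def p_def sum_distrib_left mult_ac)
  have nz: "n i = (\<Sum>m\<in>-{k1}. K i m * p m)" for i
    unfolding n by (rule sum_UNIV_z) (simp add: K(2))
  have n_k1: "n k1 = 0" unfolding n using K(1)[of k1] K(2) by simp
  have Bn: "(\<Sum>j\<in>-{k1}. B i j * n j) = p i" if "i \<noteq> k1" for i
  proof -
    have "(\<Sum>j\<in>-{k1}. B i j * n j) = (\<Sum>m\<in>-{k1}. (\<Sum>j\<in>-{k1}. B i j * K j m) * p m)"
      unfolding nz sum_distrib_left sum_distrib_right by (subst sum.swap) (simp add: mult_ac)
    also have "\<dots> = (\<Sum>m\<in>-{k1}. if i = m then p m else 0)"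
      using that by (intro sum.cong) (auto simp: BK)
    also have "\<dots> = p i" using that by (simp add: sum.delta)
    finally show ?thesis .
  qed
  have "(\<Sum>i\<in>-{k1}. \<Sum>j\<in>-{k1}. B i j * (z i + n i) * (z j + n j)) =
      (\<Sum>i\<in>-{k1}. \<Sum>j\<in>-{k1}. z i * z j * B i j) + (\<Sum>i\<in>-{k1}. z i * (\<Sum>j\<in>-{k1}. B i j * n j))
      + (\<Sum>i\<in>-{k1}. \<Sum>j\<in>-{k1}. z j * (B i j * n i)) + (\<Sum>i\<in>-{k1}. n i * (\<Sum>j\<in>-{k1}. B i j * n j))"
    unfolding sum_distrib_left sum.distrib[symmetric] by (intro sum.cong) (auto simp: algebra_simps)
  also have "(\<Sum>i\<in>-{k1}. \<Sum>j\<in>-{k1}. z j * (B i j * n i)) = (\<Sum>j\<in>-{k1}. z j * (\<Sum>i\<in>-{k1}. B j i * n i))"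
    by (subst sum.swap) (simp add: sum_distrib_left B[of _ "_ :: 'n"])
  also have "(\<Sum>i\<in>-{k1}. z i * (\<Sum>j\<in>-{k1}. B i j * n j)) = (\<Sum>i\<in>-{k1}. z i * p i)"
    by (intro sum.cong) (auto simp: Bn)
  also have "(\<Sum>i\<in>-{k1}. n i * (\<Sum>j\<in>-{k1}. B i j * n j)) = (\<Sum>i\<in>-{k1}. n i * p i)"
    by (intro sum.cong) (auto simp: Bn)
  finally have L: "(\<Sum>i\<in>-{k1}. \<Sum>j\<in>-{k1}. B i j * (z i + n i) * (z j + n j)) =
      (\<Sum>i\<in>-{k1}. \<Sum>j\<in>-{k1}. z i * z j * B i j) + 2 * (\<Sum>i\<in>-{k1}. z i * p i) + (\<Sum>i\<in>-{k1}. n i * p i)"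
    by simp
  have "(\<Sum>i\<in>UNIV. \<Sum>j\<in>UNIV. z i * z j * (\<Sum>k\<in>UNIV. \<Sum>l\<in>UNIV. q i k * K k l * q l j)) = (\<Sum>k\<in>UNIV. n k * p k)"
  proof -
    have "(\<Sum>i\<in>UNIV. \<Sum>j\<in>UNIV. z i * z j * (\<Sum>k\<in>UNIV. \<Sum>l\<in>UNIV. q i k * K k l * q l j)) =
        (\<Sum>i\<in>UNIV. \<Sum>j\<in>UNIV. \<Sum>k\<in>UNIV. \<Sum>l\<in>UNIV. (q k i * z i) * (K k l * (q l j * z j)))"
      unfolding sum_distrib_left by (intro sum.cong refl) (simp add: q[of _ "_ :: 'n"] mult_ac)
    also have "\<dots> = (\<Sum>i\<in>UNIV. \<Sum>k\<in>UNIV. \<Sum>l\<in>UNIV. \<Sum>j\<in>UNIV. (q k i * z i) * (K k l * (q l j * z j)))"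
    proof (rule sum.cong[OF refl])
      fix i
      show "(\<Sum>j\<in>UNIV. \<Sum>k\<in>UNIV. \<Sum>l\<in>UNIV. (q k i * z i) * (K k l * (q l j * z j))) =
          (\<Sum>k\<in>UNIV. \<Sum>l\<in>UNIV. \<Sum>j\<in>UNIV. (q k i * z i) * (K k l * (q l j * z j)))"
        by (subst sum.swap) (rule sum.cong[OF refl], rule sum.swap)
    qed
    also have "\<dots> = (\<Sum>i\<in>UNIV. \<Sum>k\<in>UNIV. (q k i * z i) * n k)"
      by (simp add: n p_def sum_distrib_left)
    also have "\<dots> = (\<Sum>k\<in>UNIV. n k * p k)"
      by (subst sum.swap) (simp add: p_def sum_distrib_left mult_ac)
    finally show ?thesis .
  qed
  moreover have "(\<Sum>i\<in>UNIV. \<Sum>j\<in>UNIV. z i * z j * (2 * q i j)) = 2 * (\<Sum>i\<in>UNIV. z i * p i)"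
    by (simp add: p_def sum_distrib_left mult_ac)
  moreover have "(\<Sum>i\<in>UNIV. \<Sum>j\<in>UNIV. z i * z j * B i j) = (\<Sum>i\<in>-{k1}. \<Sum>j\<in>-{k1}. z i * z j * B i j)"
    by (simp add: sum_UNIV_z z)
  moreover have "(\<Sum>i\<in>UNIV. z i * p i) = (\<Sum>i\<in>-{k1}. z i * p i)" "(\<Sum>k\<in>UNIV. n k * p k) = (\<Sum>k\<in>-{k1}. n k * p k)"
    by (simp_all add: sum_UNIV_z z n_k1)
  ultimately show ?thesis
    unfolding L by (simp add: distrib_left sum.distrib)
qed

section \<open>Coordinates measured from the curve\<close>

context adapted_curve
begin

lemma H_nondegenerate:
  assumes "\<And>i. i \<noteq> k1 \<Longrightarrow> (\<Sum>j\<in>-{k1}. mixed_partial {#i, j#} f 0 * u j) = 0" "m \<noteq> k1"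
  shows "u m = 0"
proof -
  have "u m = (\<Sum>j\<in>-{k1}. (if m = j then 1 else 0) * u j)"
    using assms(2) by (simp add: if_distrib[of "\<lambda>c. c * _"] sum.delta cong: if_cong)
  also have "\<dots> = (\<Sum>j\<in>-{k1}. (\<Sum>i\<in>-{k1}. G $ m $ i * mixed_partial {#i, j#} f 0) * u j)"
    using assms(2) by (intro sum.cong) (auto simp: GH)
  also have "\<dots> = (\<Sum>i\<in>-{k1}. G $ m $ i * (\<Sum>j\<in>-{k1}. mixed_partial {#i, j#} f 0 * u j))"
    unfolding sum_distrib_left sum_distrib_right by (subst sum.swap) (simp add: mult_ac)
  also have "\<dots> = 0" using assms(1) by (intro sum.neutral) auto
  finally show ?thesis .
qed

text \<open>The displacement from the point of the curve with the same y. Its first component is 0,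
  so a Taylor expansion along it moves in z only.\<close>

definition zc :: "'n rvec \<Rightarrow> 'n rvec" where "zc k = k - \<gamma> (k $ k1)"

lemma zc_k1: "zc k $ k1 = 0"
  by (simp add: zc_def \<gamma>_k1)

lemma zc_0: "zc 0 = 0"
  by (simp add: zc_def \<gamma>_0)

lemma smooth_compose_k1:
  fixes g :: "real \<Rightarrow> 'b::real_normed_vector"
  shows "smooth_on UNIV g \<Longrightarrow> smooth_on UNIV (\<lambda>k :: 'n rvec. g (k $ k1))"
  by (rule smooth_on_compose_UNIV, assumption) (intro smooth_intros)+

lemma smooth_zc: "smooth_on UNIV zc"
  unfolding zc_def[abs_def] by (intro smooth_intros smooth_compose_k1 smooth_\<gamma>)

lemma zc_derivative: "(zc has_derivative (\<lambda>v. v - v $ k1 *\<^sub>R (axis k1 1 + \<zeta> 1 0))) (at 0)"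
proof -
  have "((\<lambda>k :: 'n rvec. k $ k1) has_derivative (\<lambda>v. v $ k1)) (at 0)"
    by (rule has_derivative_nth[OF has_derivative_ident])
  from has_derivative_compose[OF this, of \<gamma>] \<gamma>_derivative[of 0]
  have "((\<lambda>k. \<gamma> (k $ k1)) has_derivative (\<lambda>v. v $ k1 *\<^sub>R (axis k1 1 + \<zeta> 1 0))) (at (0 :: 'n rvec))"
    by (simp add: has_vector_derivative_def)
  then show ?thesis unfolding zc_def[abs_def] by (intro has_derivative_diff has_derivative_ident)
qed

text \<open>The coefficients of the remainder in \<open>taylor_second_order\<close>, with base point
  on the curve.\<close>

definition Bc :: "'n \<Rightarrow> 'n \<Rightarrow> 'n rvec \<Rightarrow> real" where
  "Bc i j k = integral {0..1} (\<lambda>t. (1 - t) * mixed_partial {#i, j#} f (\<gamma> (k $ k1) + t *\<^sub>R zc k))"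

lemma smooth_Bc: "smooth_on UNIV (Bc i j)"
proof -
  have fst: "smooth_on UNIV (\<lambda>p :: 'n rvec \<times> real. fst p)" and snd: "smooth_on UNIV (\<lambda>p :: 'n rvec \<times> real. snd p)"
    by (auto intro: smooth_on_linear bounded_linear_fst bounded_linear_snd)
  have "smooth_on UNIV (\<lambda>p. (1 - snd p) * mixed_partial {#i, j#} f (\<gamma> (fst p $ k1) + snd p *\<^sub>R zc (fst p)))"
    by (intro smooth_intros snd smooth_on_compose_UNIV[OF smooth_mixed_partial[OF sm]]
        smooth_on_compose_UNIV[OF smooth_compose_k1[OF smooth_\<gamma>]] smooth_on_compose_UNIV[OF smooth_zc] fst)
  from smooth_on_parametric_integral[OF this] show ?thesis by (simp add: Bc_def[abs_def])
qed

lemma Bc_sym: "Bc i j k = Bc j i k"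
  by (simp add: Bc_def add_mset_commute)

lemma Bc_0: "Bc i j 0 = mixed_partial {#i, j#} f 0 / 2"
proof -
  have "((\<lambda>t. (1 - t) * h) has_integral ((1 - 1\<^sup>2 / 2) * h - (0 - 0\<^sup>2 / 2) * h)) {0..1}" for h :: real
    by (rule fundamental_theorem_of_calculus)
      (auto intro!: derivative_eq_intros simp flip: has_real_derivative_iff_has_vector_derivative)
  from integral_unique[OF this] show ?thesis by (simp add: Bc_def \<gamma>_0 zc_0)
qed

lemma taylor_along_\<gamma>:
  assumes "\<And>t. f (\<gamma> t) = f 0 + t ^ Suc N * u t"
    and "\<And>i t. i \<noteq> k1 \<Longrightarrow> mixed_partial {#i#} f (\<gamma> t) = t ^ Suc N * \<rho> i t"
  shows "f k = f 0 + (k $ k1) ^ Suc N * (u (k $ k1) + (\<Sum>i\<in>-{k1}. zc k $ i * \<rho> i (k $ k1)))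
    + (\<Sum>i\<in>UNIV. \<Sum>j\<in>UNIV. zc k $ i * zc k $ j * Bc i j k)"
proof -
  have "(\<Sum>i\<in>UNIV. zc k $ i * mixed_partial {#i#} f (\<gamma> (k $ k1))) =
      (\<Sum>i\<in>-{k1}. zc k $ i * mixed_partial {#i#} f (\<gamma> (k $ k1)))"
    by (rule sum_UNIV_z) (simp add: zc_k1)
  also have "\<dots> = (k $ k1) ^ Suc N * (\<Sum>i\<in>-{k1}. zc k $ i * \<rho> i (k $ k1))"
    unfolding sum_distrib_left by (intro sum.cong) (auto simp: assms(2))
  finally have "f (\<gamma> (k $ k1) + zc k) = f (\<gamma> (k $ k1)) + (k $ k1) ^ Suc N * (\<Sum>i\<in>-{k1}. zc k $ i * \<rho> i (k $ k1))
    + (\<Sum>i\<in>UNIV. \<Sum>j\<in>UNIV. zc k $ i * zc k $ j * Bc i j k)"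
    by (simp add: taylor_second_order[OF sm, of "\<gamma> (k $ k1)" "zc k"] Bc_def)
  then show ?thesis by (simp add: assms(1) distrib_left zc_def)
qed

text \<open>The free factor \<open>s\<close> lets one proof serve the coefficient \<open>a N\<close>
  as well as 1 and -1. Equal signs of \<open>s\<close> and \<open>a N\<close> make the function
  \<open>w\<close>, whose root is taken, positive at 0.\<close>

theorem normal_form:
  assumes N: "2 \<le> N" and az: "\<And>j. 2 \<le> j \<Longrightarrow> j < N \<Longrightarrow> a j = 0" and s: "s * a N > 0"
  shows "\<exists>Q. nondeg_quadratic_form_z Q \<and> reduces_to f (\<lambda>x. f 0 + s * (x $ k1) ^ (N + 1) + Q x)"
proof -
  have s0: "s \<noteq> 0" using s by auto
  obtain u where u: "smooth_on UNIV u" "\<And>t. f (\<gamma> t) = f 0 + t ^ Suc N * u t" "u 0 = a N / fact (Suc N)"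
    using f_on_\<gamma>[OF N order_refl az] by blast
  have "\<exists>\<rho>. i \<noteq> k1 \<longrightarrow> smooth_on UNIV \<rho> \<and> (\<forall>t. mixed_partial {#i#} f (\<gamma> t) = t ^ Suc N * \<rho> t)" for i
    using partial_z_on_\<gamma>[of i] by blast
  then obtain \<rho> where \<rho>: "\<And>i. i \<noteq> k1 \<Longrightarrow> smooth_on UNIV (\<rho> i)"
    "\<And>i t. i \<noteq> k1 \<Longrightarrow> mixed_partial {#i#} f (\<gamma> t) = t ^ Suc N * \<rho> i t"
    by metis
  define w where "w k = (u (k $ k1) + (\<Sum>i\<in>-{k1}. zc k $ i * \<rho> i (k $ k1))) / s" for k :: "'n rvec"
  have smw: "smooth_on UNIV w"
    unfolding w_def[abs_def]
    by (intro smooth_on_divide_const smooth_on_add smooth_on_sum smooth_on_mult smooth_on_nth smooth_zc smooth_compose_k1 u(1) \<rho>(1) open_UNIV) auto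
  have w0: "w 0 > 0"
  proof -
    have "w 0 = (s * a N) / (s\<^sup>2 * fact (Suc N))"
      using s0 by (simp add: w_def zc_0 u(3) power2_eq_square del: fact_Suc)
    also have "\<dots> > 0" using divide_pos_pos[OF s, of "s\<^sup>2 * fact (Suc N)"] s0 by (simp del: fact_Suc)
    finally show ?thesis .
  qed
  have f_eq: "f k = f 0 + s * ((k $ k1) ^ Suc N * w k) + (\<Sum>i\<in>UNIV. \<Sum>j\<in>UNIV. zc k $ i * zc k $ j * Bc i j k)" for k
    using taylor_along_\<gamma>[OF u(2) \<rho>(2), of k] s0 by (simp add: w_def)
  \<comment> \<open>The quadratic form at the origin has matrix f_zz / 2, and the inverse of this is
    2 G.\<close>
  define K where "K i j = 2 * G $ i $ j" for i j
  define E where "E k = (\<chi> p. Bc (fst p) (snd p) k - Bc (fst p) (snd p) 0)" for k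
  have K_sym: "K i j = K j i" for i j by (simp add: K_def G_sym[of i j])
  obtain V q where V: "open V" "0 \<in> V" "\<And>i j. smooth_on V (\<lambda>E. q E i j)" "\<And>i j. q 0 i j = 0"
    "\<And>E i j. q E i j = q E j i"
    "\<And>E i j. E \<in> V \<Longrightarrow> (\<And>i j. E $ (i, j) = E $ (j, i)) \<Longrightarrow>
       2 * q E i j + (\<Sum>k\<in>UNIV. \<Sum>l\<in>UNIV. q E i k * K k l * q E l j) = E $ (i, j)"
  proof (rule quadratic_matrix_equation[of K, OF K_sym])
    fix V Q
    assume "open V" "0 \<in> V" "\<And>i j. smooth_on V (\<lambda>E. Q E i j)" "\<And>i j. Q 0 i j = 0"
      "\<And>E i j. Q E i j = Q E j i"
      "\<And>E i j. E \<in> V \<Longrightarrow> (\<And>i j. E $ (i, j) = E $ (j, i)) \<Longrightarrow>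
         2 * Q E i j + (\<Sum>k\<in>UNIV. \<Sum>l\<in>UNIV. Q E i k * K k l * Q E l j) = E $ (i, j)"
    then show thesis by (rule that[of V Q])
  qed
  have E0: "E 0 = 0" by (simp add: E_def vec_eq_iff)
  have smE: "smooth_on UNIV E"
    unfolding E_def[abs_def] by (intro smooth_on_vec_lambda smooth_on_diff smooth_on_const smooth_Bc open_UNIV)
  \<comment> \<open>Where \<open>w\<close> is positive its root is smooth; where \<open>E\<close>
    lies in \<open>V\<close> the matrix equation has its solution \<open>q\<close>.\<close>
  define U where "U = w -` {0<..} \<inter> E -` V"
  have "open U"
    unfolding U_def using V(1) smooth_onD(3)[OF smw] smooth_onD(3)[OF smE]
    by (intro open_Int open_vimage) auto
  have "0 \<in> U" using w0 E0 V(2) by (simp add: U_def)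
  define W where "W k = w k powr (1 / Suc N)" for k
  define \<phi> where "\<phi> k = (\<chi> i. if i = k1 then k $ k1 * W k
     else zc k $ i + (\<Sum>m\<in>UNIV. \<Sum>l\<in>UNIV. K i m * q (E k) m l * zc k $ l))" for k
  have smW: "smooth_on U W"
    unfolding W_def[abs_def]
    by (rule smooth_on_powr[OF \<open>open U\<close> smooth_on_subset[OF smw]]) (auto simp: U_def)
  have smq: "smooth_on U (\<lambda>k. q (E k) i j)" for i j
    by (rule smooth_on_compose[OF \<open>open U\<close> V(1) smooth_on_subset[OF smE] V(3)]) (auto simp: U_def)
  have smzU: "smooth_on U (\<lambda>k. zc k $ i)" for i
    using smooth_on_nth[OF open_UNIV smooth_zc] by (rule smooth_on_subset) simp
  have sm\<phi>: "smooth_on U \<phi>"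
    unfolding \<phi>_def[abs_def]
  proof (rule smooth_on_vec_lambda[OF \<open>open U\<close>])
    fix i
    have "smooth_on U (\<lambda>k. k $ k1 * W k)"
      by (intro smooth_on_mult smooth_on_nth smooth_on_ident smW \<open>open U\<close>)
    moreover have "smooth_on U (\<lambda>k. zc k $ i + (\<Sum>m\<in>UNIV. \<Sum>l\<in>UNIV. K i m * q (E k) m l * zc k $ l))"
      by (intro smooth_on_add smooth_on_sum smooth_on_mult smooth_on_const smq smzU \<open>open U\<close>)
    ultimately show "smooth_on U (\<lambda>k. if i = k1 then k $ k1 * W k
       else zc k $ i + (\<Sum>m\<in>UNIV. \<Sum>l\<in>UNIV. K i m * q (E k) m l * zc k $ l))"
      by (cases "i = k1") simp_all
  qed
  have \<phi>0: "\<phi> 0 = 0" by (simp add: \<phi>_def vec_eq_iff zc_0)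
  \<comment> \<open>At 0 both \<open>q\<close> and \<open>zc\<close> vanish, so their products
    contribute nothing and the derivative is triangular: \<open>W 0\<close> times v_1 in the first
    component, v_i plus a multiple of v_1 in the others.\<close>
  have inj: "v = 0" if v: "frechet_derivative \<phi> (at 0) v = 0" for v
  proof -
    have d\<phi>: "((\<lambda>k. \<phi> k $ i) has_derivative (\<lambda>v. frechet_derivative \<phi> (at 0) v $ i)) (at 0)" for i
      by (rule has_derivative_nth[OF smooth_onD(1)[OF sm\<phi> \<open>0 \<in> U\<close>]])
    have "((\<lambda>k. \<phi> k $ k1) has_derivative (\<lambda>v. v $ k1 * W 0)) (at 0)"
      using has_derivative_mult[OF has_derivative_nth[OF has_derivative_ident, where i = k1] smooth_onD(1)[OF smW \<open>0 \<in> U\<close>]]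
      by (simp add: \<phi>_def)
    from fun_cong[OF has_derivative_unique[OF this d\<phi>], of v] have v1: "v $ k1 = 0"
      using v w0 by (simp add: W_def)
    have "v $ i = 0" if i: "i \<noteq> k1" for i
    proof -
      let ?z' = "\<lambda>v :: 'n rvec. v - v $ k1 *\<^sub>R (axis k1 1 + \<zeta> 1 0)"
      have "((\<lambda>k. zc k $ i + (\<Sum>m\<in>UNIV. \<Sum>l\<in>UNIV. K i m * q (E k) m l * zc k $ l)) has_derivative
         (\<lambda>v. ?z' v $ i + (\<Sum>m\<in>UNIV. \<Sum>l\<in>UNIV. K i m * q (E 0) m l * ?z' v $ l
           + (K i m * frechet_derivative (\<lambda>k. q (E k) m l) (at 0) v) * zc 0 $ l))) (at 0)"
        by (intro has_derivative_add has_derivative_sum has_derivative_mult has_derivative_mult_right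
            has_derivative_nth zc_derivative smooth_onD(1)[OF smq \<open>0 \<in> U\<close>])
      then have "((\<lambda>k. \<phi> k $ i) has_derivative (\<lambda>v. ?z' v $ i)) (at 0)"
        using i by (simp add: \<phi>_def E0 V(4) zc_0)
      from fun_cong[OF has_derivative_unique[OF this d\<phi>], of v] show ?thesis
        using v v1 by simp
    qed
    with v1 show ?thesis by (auto simp: vec_eq_iff) metis
  qed
  obtain U' V' \<psi> where I: "open U'" "U' \<subseteq> U" "0 \<in> U'" "open V'" "0 \<in> V'" "homeomorphism U' V' \<phi> \<psi>" "smooth_on V' \<psi>"
    by (rule smooth_inverse_function[OF \<open>open U\<close> \<open>0 \<in> U\<close> sm\<phi> \<phi>0 inj])
  define B where "B i j = mixed_partial {#i, j#} f 0 / 2" for i j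
  define Q where "Q x = (\<Sum>i\<in>-{k1}. \<Sum>j\<in>-{k1}. B i j * x $ i * x $ j)" for x :: "'n rvec"
  have B_sym: "B i j = B j i" for i j by (simp add: B_def add_mset_commute)
  have BK: "(\<Sum>j\<in>-{k1}. B i j * K j m) = (if i = m then 1 else 0)" if "i \<noteq> k1" "m \<noteq> k1" for i m
    using HG[OF that] by (simp add: B_def K_def)
  have "f k = f 0 + s * (\<phi> k $ k1) ^ (N + 1) + Q (\<phi> k)" if "k \<in> U'" for k
  proof -
    have k: "w k > 0" "E k \<in> V" using that I(2) by (auto simp: U_def)
    have "(\<phi> k $ k1) ^ (N + 1) = (k $ k1) ^ Suc N * w k"
      using k(1) powr_realpow[of "W k" "Suc N"]
      by (simp add: \<phi>_def power_mult_distrib W_def powr_powr del: power_Suc of_nat_Suc)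
    moreover have "Q (\<phi> k) = (\<Sum>i\<in>UNIV. \<Sum>j\<in>UNIV. zc k $ i * zc k $ j * Bc i j k)"
    proof -
      have "Bc i j k = B i j + (2 * q (E k) i j + (\<Sum>m\<in>UNIV. \<Sum>l\<in>UNIV. q (E k) i m * K m l * q (E k) l j))" for i j
      proof -
        have E_nth: "E k $ (i, j) = Bc i j k - B i j" for i j by (simp add: E_def B_def Bc_0)
        have "E k $ (i, j) = E k $ (j, i)" for i j unfolding E_nth Bc_sym[of i j] B_sym[of i j] ..
        from V(6)[OF k(2) this, of i j] show ?thesis unfolding E_nth by simp
      qed
      moreover have "Q (\<phi> k) = (\<Sum>i\<in>-{k1}. \<Sum>j\<in>-{k1}. B i j *
          (zc k $ i + (\<Sum>m\<in>UNIV. \<Sum>l\<in>UNIV. K i m * q (E k) m l * zc k $ l)) *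
          (zc k $ j + (\<Sum>m\<in>UNIV. \<Sum>l\<in>UNIV. K j m * q (E k) m l * zc k $ l)))"
        unfolding Q_def by (intro sum.cong) (auto simp: \<phi>_def)
      ultimately show ?thesis
        using matrix_square_root_congruence[of "\<lambda>i. zc k $ i" K B "q (E k)", OF zc_k1 K_sym _ B_sym V(5) BK] G0
        by (simp add: K_def)
    qed
    ultimately show ?thesis using f_eq[of k] by simp
  qed
  moreover have "smooth_on U' \<phi>" using sm\<phi> I(2) by (rule smooth_on_subset)
  ultimately have "reduces_to f (\<lambda>x. f 0 + s * (x $ k1) ^ (N + 1) + Q x)"
    unfolding reduces_to_def using I \<phi>0 by blast
  moreover have "nondeg_quadratic_form_z Q"
    unfolding nondeg_quadratic_form_z_def
  proof (intro exI conjI allI impI ballI)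
    show "transpose (\<chi> i j. B i j) = (\<chi> i j. B i j)" by (simp add: transpose_def B_sym[of _ "_ :: 'n"] vec_eq_iff)
    show "Q x = (\<Sum>i\<in>-{k1}. \<Sum>j\<in>-{k1}. (\<chi> i j. B i j) $ i $ j * x $ i * x $ j)" for x by (simp add: Q_def)
    fix x :: "'n rvec" and j :: 'n
    assume *: "\<forall>i\<in>-{k1}. (\<Sum>j\<in>-{k1}. (\<chi> i j. B i j) $ i $ j * x $ j) = 0" and j: "j \<in> -{k1}"
    show "x $ j = 0"
    proof (rule H_nondegenerate[of "\<lambda>i. x $ i"])
      fix i :: 'n assume "i \<noteq> k1"
      then have "(\<Sum>j\<in>-{k1}. B i j * x $ j) = 0" using * by simp
      then show "(\<Sum>j\<in>-{k1}. mixed_partial {#i, j#} f 0 * x $ j) = 0"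
        by (simp add: B_def flip: sum_divide_distrib)
    qed (use j in auto)
  qed
  ultimately show ?thesis by blast
qed

end

subsection \<open>Necessity of the conditions\<close>

context adapted_curve
begin

text \<open>The derivative of f along the curve is f_y plus a contraction of f_z, and f_z is
  O(t^(N+1)). So f_y has the leading term of the derivative of t^(m+1) u, which is (m + 1) u(0) t^m
  = a_m t^m / m!.\<close>

lemma f_y_on_\<gamma>:
  assumes "2 \<le> m" "m \<le> N" "\<And>j. 2 \<le> j \<Longrightarrow> j < m \<Longrightarrow> a j = 0"
  shows "((\<lambda>t. mixed_partial {#i#} f (\<gamma> t) / t ^ m) \<longlongrightarrow> (if i = k1 then a m / fact m else 0)) (at 0)"
proof -
  have z: "((\<lambda>t. mixed_partial {#i#} f (\<gamma> t) / t ^ m) \<longlongrightarrow> 0) (at 0)" if i: "i \<noteq> k1" for i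
  proof -
    obtain \<rho> where \<rho>: "smooth_on UNIV \<rho>" "\<And>t. mixed_partial {#i#} f (\<gamma> t) = t ^ Suc N * \<rho> t"
      using partial_z_on_\<gamma>[OF i] by blast
    have "isCont (\<lambda>t. t ^ (Suc N - m) * \<rho> t) 0"
      using smooth_onD(3)[OF \<rho>(1)] continuous_on_eq_continuous_at[of UNIV \<rho>] by (intro continuous_intros) auto
    then have lim: "((\<lambda>t. t ^ (Suc N - m) * \<rho> t) \<longlongrightarrow> 0) (at 0)"
      using assms(2) by (simp add: isCont_def zero_power)
    have eq: "t ^ (Suc N - m) * \<rho> t = mixed_partial {#i#} f (\<gamma> t) / t ^ m" if "t \<noteq> 0" for t
      using that assms(2) by (simp add: \<rho>(2) power_diff del: power_Suc)
    show ?thesis by (rule Lim_transform_within[OF lim, of 1]) (use eq in auto)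
  qed
  show ?thesis
  proof (cases "i = k1")
    case True
    obtain u where u: "smooth_on UNIV u" "\<And>t. f (\<gamma> t) = f 0 + t ^ Suc m * u t" "u 0 = a m / fact (Suc m)"
      using f_on_\<gamma>[OF assms] by blast
    define u' where "u' t = frechet_derivative u (at t) 1" for t
    have du: "(u has_real_derivative u' t) (at t)" for t
      using has_derivative_along_line[OF u(1), of 0 1 t] by (simp add: u'_def)
    have cont: "isCont u 0" "isCont u' 0"
      using smooth_onD(3)[OF u(1)] smooth_onD(3)[OF smooth_onD(2)[OF u(1)], of 1]
      by (simp_all add: continuous_on_eq_continuous_at u'_def[abs_def])
    have h': "mixed_partial {#k1#} f (\<gamma> t) + (\<Sum>i\<in>-{k1}. \<zeta> 1 t $ i * mixed_partial {#i#} f (\<gamma> t)) =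
        real (Suc m) * t ^ m * u t + t ^ Suc m * u' t" for t
    proof (rule DERIV_unique)
      show "((\<lambda>t. f (\<gamma> t)) has_real_derivative
          mixed_partial {#k1#} f (\<gamma> t) + (\<Sum>i\<in>-{k1}. \<zeta> 1 t $ i * mixed_partial {#i#} f (\<gamma> t))) (at t)"
        using partial_\<gamma>_derivative[of "{#}" t] by simp
      show "((\<lambda>t. f (\<gamma> t)) has_real_derivative real (Suc m) * t ^ m * u t + t ^ Suc m * u' t) (at t)"
        unfolding u(2) by (auto intro!: derivative_eq_intros du simp del: power_Suc of_nat_Suc)
    qed
    have \<zeta>: "((\<lambda>t. \<zeta> 1 t $ i) \<longlongrightarrow> \<zeta> 1 0 $ i) (at 0)" for i
      using DERIV_isCont[OF \<zeta>_nth_derivative[of 1 i 0]] by (simp add: isCont_def)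
    have "((\<lambda>t. (real (Suc m) * u t + t * u' t) - (\<Sum>i\<in>-{k1}. \<zeta> 1 t $ i * (mixed_partial {#i#} f (\<gamma> t) / t ^ m)))
       \<longlongrightarrow> (real (Suc m) * u 0 + 0 * u' 0) - (\<Sum>i\<in>-{k1}. \<zeta> 1 0 $ i * 0)) (at 0)"
      using cont by (intro tendsto_intros z \<zeta>) (auto simp: isCont_def)
    also have "(real (Suc m) * u 0 + 0 * u' 0) - (\<Sum>i\<in>-{k1}. \<zeta> 1 0 $ i * 0) = a m / fact m"
      by (simp add: u(3) divide_simps del: of_nat_Suc)
    finally have "((\<lambda>t. mixed_partial {#k1#} f (\<gamma> t) / t ^ m) \<longlongrightarrow> a m / fact m) (at 0)"
    proof (rule Lim_transform_within[of _ _ _ _ 1])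
      fix t :: real assume "0 < dist t 0"
      then have "t ^ m \<noteq> 0" by simp
      moreover have "mixed_partial {#k1#} f (\<gamma> t) = t ^ m * (real (Suc m) * u t + t * u' t) - (\<Sum>i\<in>-{k1}. \<zeta> 1 t $ i * mixed_partial {#i#} f (\<gamma> t))"
        using h'[of t] by (simp add: algebra_simps)
      ultimately show "(real (Suc m) * u t + t * u' t) - (\<Sum>i\<in>-{k1}. \<zeta> 1 t $ i * (mixed_partial {#i#} f (\<gamma> t) / t ^ m))
        = mixed_partial {#k1#} f (\<gamma> t) / t ^ m"
        by (simp add: diff_divide_distrib sum_divide_distrib)
    qed simp
    then show ?thesis using True by simp
  next
    case False
    then show ?thesis using z by simp
  qed
qed

lemma power_tendsto_imp_zero:
  fixes g :: "real \<Rightarrow> real"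
  assumes "((\<lambda>t. g t / t ^ m) \<longlongrightarrow> l) (at 0)" "k < m"
  shows "((\<lambda>t. g t / t ^ k) \<longlongrightarrow> 0) (at 0)"
proof -
  have "((\<lambda>t. t ^ (m - k) * (g t / t ^ m)) \<longlongrightarrow> 0 ^ (m - k) * l) (at 0)"
    by (intro tendsto_intros assms(1))
  then have "((\<lambda>t. t ^ (m - k) * (g t / t ^ m)) \<longlongrightarrow> 0) (at 0)"
    using assms(2) by (simp add: zero_power)
  then show ?thesis
    by (rule Lim_transform_within[of _ _ _ _ 1]) (use assms(2) in \<open>auto simp: power_diff\<close>)
qed

text \<open>Let \<open>x t = \<phi> (\<gamma> t)\<close>. The gradient of the normal form at \<open>x t\<close> is \<open>\<nabla>f (\<gamma> t)\<close> composed with the derivative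
  of the inverse change of variables, so vanishing of \<open>\<nabla>f\<close> along the curve to order \<open>m\<close> forces \<open>x\<^sub>1\<^sup>N\<close> and all
  other \<open>x\<^sub>j\<close> to vanish to order \<open>m\<close>. As \<open>x' 0 \<noteq> 0\<close>, this pins down the first nonzero invariant.\<close>

theorem normal_form_necessary:
  fixes q :: "'n rmat"
  assumes N: "2 \<le> N" and s: "s \<noteq> 0" and q: "transpose q = q"
    "\<And>x. Q x = (\<Sum>i\<in>-{k1}. \<Sum>j\<in>-{k1}. q $ i $ j * x $ i * x $ j)"
    "\<And>u :: 'n rvec. (\<And>i. i \<noteq> k1 \<Longrightarrow> (\<Sum>j\<in>-{k1}. q $ i $ j * u $ j) = 0) \<Longrightarrow> (\<And>j. j \<noteq> k1 \<Longrightarrow> u $ j = 0)"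
    and red: "reduces_to f (\<lambda>x. C0 + s * (x $ k1) ^ (N + 1) + Q x)"
  shows "(\<forall>j. 2 \<le> j \<and> j < N \<longrightarrow> a j = 0) \<and> a N \<noteq> 0"
proof -
  have q_sym: "q $ i $ j = q $ j $ i" for i j
    using arg_cong[OF q(1), of "\<lambda>A. A $ i $ j"] by (simp add: transpose_def)
  obtain U V \<phi> \<psi> where R: "open U" "open V" "0 \<in> U" "0 \<in> V" "homeomorphism U V \<phi> \<psi>"
    "smooth_on U \<phi>" "smooth_on V \<psi>" "\<phi> 0 = 0" "\<And>k. k \<in> U \<Longrightarrow> f k = C0 + s * (\<phi> k $ k1) ^ (N + 1) + Q (\<phi> k)"
    using red unfolding reduces_to_def by blast
  have \<psi>\<phi>: "\<psi> (\<phi> k) = k" "\<phi> k \<in> V" if "k \<in> U" for k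
    using R(5) that by (auto simp: homeomorphism_def)
  have \<phi>\<psi>: "\<phi> (\<psi> y) = y" "\<psi> y \<in> U" if "y \<in> V" for y
    using R(5) that by (auto simp: homeomorphism_def)
  define x where "x t = \<phi> (\<gamma> t)" for t
  have x0: "x 0 = 0" by (simp add: x_def \<gamma>_0 R(8))
  define U0 where "U0 = \<gamma> -` U"
  have U0: "open U0" "0 \<in> U0"
    unfolding U0_def using smooth_onD(3)[OF smooth_\<gamma>] R(1,3) by (auto simp: \<gamma>_0 intro: open_vimage)
  then have ev: "eventually (\<lambda>t. t \<in> U0) (at 0)" by (rule eventually_at_in_open')
  have xV: "x t \<in> V" "\<psi> (x t) = \<gamma> t" if "t \<in> U0" for t
    using that \<psi>\<phi> by (auto simp: x_def U0_def)

  define \<xi> where "\<xi> = frechet_derivative \<phi> (at 0) (axis k1 1 + \<zeta> 1 0)"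
  have dx: "(x has_derivative (\<lambda>h. h *\<^sub>R \<xi>)) (at 0)"
  proof -
    let ?L = "frechet_derivative \<phi> (at 0)"
    have L: "(\<phi> has_derivative ?L) (at (\<gamma> 0))" unfolding \<gamma>_0 by (rule smooth_onD(1)[OF R(6,3)])
    from has_derivative_compose[OF \<gamma>_derivative[of 0, unfolded has_vector_derivative_def] L]
    have "(x has_derivative (\<lambda>h. ?L (h *\<^sub>R (axis k1 1 + \<zeta> 1 0)))) (at 0)" by (simp add: x_def[abs_def])
    then show ?thesis using has_derivative_linear[OF L] by (simp add: linear_cmul \<xi>_def)
  qed
  have xlim: "((\<lambda>t. x t $ i / t ^ 1) \<longlongrightarrow> \<xi> $ i) (at 0)" for i
  proof -
    have "((\<lambda>t. x t $ i) has_derivative (\<lambda>h. h * \<xi> $ i)) (at 0)"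
      using has_derivative_nth[OF dx, of i] by simp
    moreover have "(\<lambda>h. h * \<xi> $ i) = (*) (\<xi> $ i)" by (simp add: fun_eq_iff)
    ultimately have "((\<lambda>t. x t $ i) has_real_derivative \<xi> $ i) (at 0)"
      by (simp add: has_field_derivative_def)
    then show ?thesis by (simp add: DERIV_def x0)
  qed
  \<comment> \<open>\<open>\<psi>\<close> carries \<open>x\<close> back to the curve, whose velocity
    has first component 1.\<close>
  have \<xi>_nz: "\<xi> \<noteq> 0"
  proof
    assume "\<xi> = 0"
    let ?L = "frechet_derivative \<psi> (at 0)"
    have L: "(\<psi> has_derivative ?L) (at (x 0))" unfolding x0 by (rule smooth_onD(1)[OF R(7,4)])
    from has_derivative_compose[OF dx L] have "((\<lambda>t. \<psi> (x t)) has_derivative (\<lambda>h. 0)) (at 0)"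
      using linear_0[OF has_derivative_linear[OF L]] \<open>\<xi> = 0\<close> by simp
    then have "(\<gamma> has_derivative (\<lambda>h. 0)) (at 0)"
      by (rule has_derivative_transform_within_open[OF _ U0]) (simp add: xV)
    from has_derivative_unique[OF this \<gamma>_derivative[of 0, unfolded has_vector_derivative_def]]
    have "axis k1 1 + \<zeta> 1 0 = (0 :: 'n rvec)" by (metis scaleR_one)
    then have "(axis k1 1 + \<zeta> 1 0 :: 'n rvec) $ k1 = 0" by simp
    then show False by (simp add: \<zeta>_k1)
  qed

  define gd where "gd y w = s * (real (N + 1) * (y $ k1) ^ N * w $ k1)
      + (\<Sum>i\<in>-{k1}. \<Sum>j\<in>-{k1}. q $ i $ j * (y $ i * w $ j + w $ i * y $ j))" for y w :: "'n rvec"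
  have dg: "((\<lambda>y. C0 + s * (y $ k1) ^ (N + 1) + Q y) has_derivative gd y) (at y)" for y
  proof -
    have "((\<lambda>y. C0 + s * (y $ k1) ^ (N + 1)) has_derivative (\<lambda>w. 0 + s * (real (N + 1) * (w $ k1 * (y $ k1) ^ (N + 1 - 1))))) (at y)"
      by (intro has_derivative_add has_derivative_const has_derivative_mult_right)
        (use has_derivative_power[OF has_derivative_nth[OF has_derivative_ident, where i = k1], where n = "N + 1"] in \<open>simp add: mult_ac\<close>)
    moreover have "((\<lambda>y. \<Sum>i\<in>-{k1}. \<Sum>j\<in>-{k1}. q $ i $ j * (y $ i * y $ j)) has_derivative
       (\<lambda>w. \<Sum>i\<in>-{k1}. \<Sum>j\<in>-{k1}. q $ i $ j * (y $ i * w $ j + w $ i * y $ j))) (at y)"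
      by (intro has_derivative_sum has_derivative_mult_right has_derivative_mult has_derivative_nth has_derivative_ident)
    ultimately show ?thesis
      using has_derivative_add[of "\<lambda>y. C0 + s * (y $ k1) ^ (N + 1)" _ "at y" "\<lambda>y. \<Sum>i\<in>-{k1}. \<Sum>j\<in>-{k1}. q $ i $ j * (y $ i * y $ j)"]
      by (simp add: q(2) gd_def[abs_def] mult_ac)
  qed
  define \<Psi> where "\<Psi> w i t = frechet_derivative \<psi> (at (x t)) w $ i" for w i t
  have gd_eq: "gd (x t) w = (\<Sum>i\<in>UNIV. \<Psi> w i t * mixed_partial {#i#} f (\<gamma> t))" if t: "t \<in> U0" for t w
  proof -
    note xt = xV[OF t]
    have "((\<lambda>y. f (\<psi> y)) has_derivative (\<lambda>w. frechet_derivative f (at (\<psi> (x t))) (frechet_derivative \<psi> (at (x t)) w))) (at (x t))"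
      using smooth_onD(1)[OF R(7) xt(1)] smooth_onD(1)[OF sm UNIV_I] by (rule has_derivative_compose)
    then have "((\<lambda>y. C0 + s * (y $ k1) ^ (N + 1) + Q y) has_derivative
        (\<lambda>w. frechet_derivative f (at (\<psi> (x t))) (frechet_derivative \<psi> (at (x t)) w))) (at (x t))"
      by (rule has_derivative_transform_within_open[OF _ R(2) xt(1)]) (simp add: R(9) \<phi>\<psi>)
    from fun_cong[OF has_derivative_unique[OF dg this], of w] show ?thesis
      by (simp add: xt(2) \<Psi>_def frechet_derivative_partials[OF sm] mixed_partial_add_mset[OF sm])
  qed
  have \<Psi>lim: "(\<Psi> w i \<longlongrightarrow> \<Psi> w i 0) (at 0)" for w i
  proof -
    have "smooth_on V (\<lambda>y. frechet_derivative \<psi> (at y) w $ i)"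
      by (rule smooth_on_nth[OF R(2) smooth_onD(2)[OF R(7)]])
    then have "isCont (\<lambda>y. frechet_derivative \<psi> (at y) w $ i) (x 0)"
      using smooth_onD(3) continuous_on_eq_continuous_at[OF R(2)] R(4) x0 by metis
    moreover have "isCont x 0" using dx by (rule has_derivative_continuous)
    ultimately have "isCont (\<Psi> w i) 0" unfolding \<Psi>_def[abs_def] by (rule isCont_o2[rotated])
    then show ?thesis by (simp add: isCont_def)
  qed
  have gdlim: "((\<lambda>t. gd (x t) w / t ^ m) \<longlongrightarrow> \<Psi> w k1 0 * (a m / fact m)) (at 0)"
    if "2 \<le> m" "m \<le> N" "\<And>j. 2 \<le> j \<Longrightarrow> j < m \<Longrightarrow> a j = 0" for m w
  proof -
    have "((\<lambda>t. \<Sum>i\<in>UNIV. \<Psi> w i t * (mixed_partial {#i#} f (\<gamma> t) / t ^ m)) \<longlongrightarrow>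
        (\<Sum>i\<in>UNIV. \<Psi> w i 0 * (if i = k1 then a m / fact m else 0))) (at 0)"
      by (intro tendsto_sum tendsto_mult \<Psi>lim f_y_on_\<gamma> that)
    also have "(\<Sum>i\<in>UNIV. \<Psi> w i 0 * (if i = k1 then a m / fact m else 0)) = \<Psi> w k1 0 * (a m / fact m)"
      by (simp add: if_distrib[of "\<lambda>c. _ * c"] sum.delta' cong: if_cong)
    finally show ?thesis
    proof (rule Lim_transform_eventually)
      show "\<forall>\<^sub>F t in at 0. (\<Sum>i\<in>UNIV. \<Psi> w i t * (mixed_partial {#i#} f (\<gamma> t) / t ^ m)) = gd (x t) w / t ^ m"
        using ev by eventually_elim (simp add: gd_eq sum_divide_distrib)
    qed
  qed

  \<comment> \<open>\<open>q\<close> on the z-components, completed by the identity on the first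
    axis so as to be injective on the full space. Its left inverse recovers z from the z-gradient 2
    q z.\<close>
  define L where "L y = (\<chi> i. if i = k1 then y $ k1 else \<Sum>j\<in>-{k1}. q $ i $ j * y $ j)" for y :: "'n rvec"
  have linL: "linear L"
    by (rule linearI) (auto simp: L_def vec_eq_iff sum.distrib sum_distrib_left algebra_simps)
  have "inj L"
    unfolding linear_injective_0[OF linL]
  proof (intro allI impI)
    fix y assume y: "L y = 0"
    have Ly: "L y $ i = 0" for i by (simp add: y)
    have "y $ k1 = 0" using Ly[of k1] by (simp add: L_def)
    moreover have "(\<Sum>j\<in>-{k1}. q $ i $ j * y $ j) = 0" if "i \<noteq> k1" for i
      using Ly[of i] that by (simp add: L_def)
    ultimately show "y = 0" using q(3)[of y] by (metis vec_eq_iff zero_index)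
  qed
  then obtain g where g: "linear g" "g \<circ> L = id"
    using linear_injective_left_inverse[OF linL] by blast
  have gd_axis: "gd y (axis i 1) = 2 * (\<Sum>j\<in>-{k1}. q $ i $ j * y $ j)" if "i \<noteq> k1" for y i
  proof -
    have "(\<Sum>a\<in>-{k1}. \<Sum>j\<in>-{k1}. q $ a $ j * (y $ a * axis i 1 $ j + axis i 1 $ a * y $ j)) =
        (\<Sum>a\<in>-{k1}. q $ a $ i * y $ a) + (\<Sum>j\<in>-{k1}. q $ i $ j * y $ j)"
    proof -
      have "(\<Sum>a\<in>-{k1}. \<Sum>j\<in>-{k1}. q $ a $ j * (y $ a * axis i 1 $ j + axis i 1 $ a * y $ j)) =
          (\<Sum>a\<in>-{k1}. \<Sum>j\<in>-{k1}. if j = i then q $ a $ j * y $ a else 0)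
          + (\<Sum>a\<in>-{k1}. \<Sum>j\<in>-{k1}. if a = i then q $ a $ j * y $ j else 0)"
        unfolding sum.distrib[symmetric] by (intro sum.cong refl) (auto simp: axis_def algebra_simps)
      also have "(\<Sum>a\<in>-{k1}. \<Sum>j\<in>-{k1}. if a = i then q $ a $ j * y $ j else 0) =
          (\<Sum>j\<in>-{k1}. \<Sum>a\<in>-{k1}. if a = i then q $ a $ j * y $ j else 0)"
        by (rule sum.swap)
      finally show ?thesis using that by (simp add: sum.delta')
    qed
    then show ?thesis using that by (simp add: gd_def axis_def q_sym[of i])
  qed
  have gd_k1: "gd y (axis k1 1) = s * (real (N + 1) * (y $ k1) ^ N)" for y
    by (auto simp: gd_def axis_def intro!: sum.neutral)
  have x_z: "y $ j = (\<Sum>i\<in>-{k1}. gd y (axis i 1) / 2 * g (axis i 1) $ j)" if "j \<noteq> k1" for y j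
  proof -
    \<comment> \<open>Without its first component, y is expressed through the z-gradient
      alone.\<close>
    define y' where "y' = (\<chi> i. if i = k1 then 0 else y $ i)"
    have "L y' = (\<Sum>i\<in>UNIV. L y' $ i *\<^sub>R axis i 1)"
      using basis_expansion[of "L y'"] by (simp add: scalar_mult_eq_scaleR)
    then have "g (L y') = (\<Sum>i\<in>UNIV. L y' $ i *\<^sub>R g (axis i 1))"
      by (metis (no_types, lifting) g(1) linear_cmul linear_sum sum.cong)
    then have "g (L y') $ j = (\<Sum>i\<in>UNIV. L y' $ i * g (axis i 1) $ j)"
      by (simp only: sum_component vector_scaleR_component real_scaleR_def)
    then have "y' $ j = (\<Sum>i\<in>UNIV. L y' $ i * g (axis i 1) $ j)"
      using fun_cong[OF g(2), of y'] by simp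
    also have "\<dots> = (\<Sum>i\<in>-{k1}. L y' $ i * g (axis i 1) $ j)"
      by (rule sum_UNIV_z) (simp add: L_def y'_def)
    also have "\<dots> = (\<Sum>i\<in>-{k1}. gd y (axis i 1) / 2 * g (axis i 1) $ j)"
      by (intro sum.cong refl) (auto simp: gd_axis L_def y'_def intro!: sum.cong)
    finally show ?thesis using that by (simp add: y'_def)
  qed
  have x_z_lim: "((\<lambda>t. x t $ j / t ^ m) \<longlongrightarrow> (\<Sum>i\<in>-{k1}. \<Psi> (axis i 1) k1 0 * (a m / fact m) / 2 * g (axis i 1) $ j)) (at 0)"
    if "2 \<le> m" "m \<le> N" "\<And>j. 2 \<le> j \<Longrightarrow> j < m \<Longrightarrow> a j = 0" "j \<noteq> k1" for m j
  proof -
    have "((\<lambda>t. \<Sum>i\<in>-{k1}. gd (x t) (axis i 1) / t ^ m / 2 * g (axis i 1) $ j) \<longlongrightarrow>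
        (\<Sum>i\<in>-{k1}. \<Psi> (axis i 1) k1 0 * (a m / fact m) / 2 * g (axis i 1) $ j)) (at 0)"
      by (intro tendsto_sum tendsto_mult tendsto_divide tendsto_const gdlim that) auto
    moreover have "x t $ j / t ^ m = (\<Sum>i\<in>-{k1}. gd (x t) (axis i 1) / t ^ m / 2 * g (axis i 1) $ j)" for t
      by (subst x_z[OF that(4)]) (simp add: sum_divide_distrib mult.commute[of 2])
    ultimately show ?thesis by simp
  qed

  have C0: "C0 = f 0" using R(9)[OF R(3)] N by (simp add: R(8) q(2))
  \<comment> \<open>As x = O(t), the power x_1^(N+1) is o(t^(m+1)). The gradient, and with it every
    x_j off the first axis, is O(t^m), so Q(x) = O(t^(2m)), which is o(t^(m+1)) because m \<ge> 2.
    Hence the coefficient u(0) of t^(m+1) in f along the curve vanishes.\<close>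
  have step: "a m = 0" if m: "2 \<le> m" "m < N" and am: "\<And>j. 2 \<le> j \<Longrightarrow> j < m \<Longrightarrow> a j = 0" for m
  proof -
    have mN: "m \<le> N" using m by simp
    obtain u where u: "smooth_on UNIV u" "\<And>t. f (\<gamma> t) = f 0 + t ^ Suc m * u t" "u 0 = a m / fact (Suc m)"
      using f_on_\<gamma>[OF m(1) mN am] by blast
    have "((\<lambda>t. (x t $ k1 / t ^ 1) ^ (N + 1)) \<longlongrightarrow> \<xi> $ k1 ^ (N + 1)) (at 0)"
      by (intro tendsto_power xlim)
    then have "((\<lambda>t. (x t $ k1) ^ (N + 1) / t ^ (N + 1)) \<longlongrightarrow> \<xi> $ k1 ^ (N + 1)) (at 0)"
      by (simp add: power_divide)
    then have 1: "((\<lambda>t. (x t $ k1) ^ (N + 1) / t ^ Suc m) \<longlongrightarrow> 0) (at 0)"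
      by (rule power_tendsto_imp_zero) (use m in simp)
    have 2: "((\<lambda>t. x t $ i * x t $ j / t ^ Suc m) \<longlongrightarrow> 0) (at 0)" if ij: "i \<noteq> k1" "j \<noteq> k1" for i j
    proof -
      have "((\<lambda>t. (x t $ i / t ^ m) * (x t $ j / t ^ m)) \<longlongrightarrow>
         (\<Sum>l\<in>-{k1}. \<Psi> (axis l 1) k1 0 * (a m / fact m) / 2 * g (axis l 1) $ i)
         * (\<Sum>l\<in>-{k1}. \<Psi> (axis l 1) k1 0 * (a m / fact m) / 2 * g (axis l 1) $ j)) (at 0)"
        by (intro tendsto_mult x_z_lim m(1) mN am ij)
      then have "((\<lambda>t. (x t $ i * x t $ j) / t ^ (m + m)) \<longlongrightarrow>
         (\<Sum>l\<in>-{k1}. \<Psi> (axis l 1) k1 0 * (a m / fact m) / 2 * g (axis l 1) $ i)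
         * (\<Sum>l\<in>-{k1}. \<Psi> (axis l 1) k1 0 * (a m / fact m) / 2 * g (axis l 1) $ j)) (at 0)"
        by (simp add: power_add)
      then show ?thesis by (rule power_tendsto_imp_zero) (use m in simp)
    qed
    have "((\<lambda>t. s * ((x t $ k1) ^ (N + 1) / t ^ Suc m) + (\<Sum>i\<in>-{k1}. \<Sum>j\<in>-{k1}. q $ i $ j * (x t $ i * x t $ j / t ^ Suc m)))
       \<longlongrightarrow> s * 0 + (\<Sum>i\<in>-{k1}. \<Sum>j\<in>-{k1}. q $ i $ j * 0)) (at 0)"
      by (intro tendsto_add tendsto_sum tendsto_mult tendsto_const 1 2) auto
    also have "s * 0 + (\<Sum>i\<in>-{k1}. \<Sum>j\<in>-{k1}. q $ i $ j * 0) = 0" by simp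
    finally have "(u \<longlongrightarrow> 0) (at 0)"
    proof (rule Lim_transform_eventually)
      have "\<forall>\<^sub>F t::real in at 0. t \<noteq> 0" by (simp add: eventually_at_filter)
      with ev show "\<forall>\<^sub>F t in at 0. s * ((x t $ k1) ^ (N + 1) / t ^ Suc m)
          + (\<Sum>i\<in>-{k1}. \<Sum>j\<in>-{k1}. q $ i $ j * (x t $ i * x t $ j / t ^ Suc m)) = u t"
      proof eventually_elim
        case (elim t)
        then have "t ^ Suc m * u t = s * (x t $ k1) ^ (N + 1) + Q (x t)"
          using R(9)[of "\<gamma> t"] u(2)[of t] by (simp add: U0_def x_def C0)
        then have "u t = (s * (x t $ k1) ^ (N + 1) + Q (x t)) / t ^ Suc m"
          using elim(2) by (simp add: field_simps)
        then show ?case by (simp add: q(2) add_divide_distrib sum_divide_distrib mult.assoc)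
      qed
    qed
    moreover have "(u \<longlongrightarrow> u 0) (at 0)"
      using smooth_onD(3)[OF u(1)] by (simp add: continuous_on_eq_continuous_at isCont_def)
    ultimately have "u 0 = 0" by (rule LIM_unique[rotated])
    then show ?thesis using u(3) by (simp del: fact_Suc)
  qed
  have below: "a j = 0" if "2 \<le> j" "j < N" for j
    using that by (induction j rule: less_induct) (auto intro: step)
  \<comment> \<open>Otherwise the gradient is o(t^N) along the curve, which gives x_1 = o(t), while
    the other components are O(t^N) with N \<ge> 2. Then \<open>x\<close> would have velocity
    0.\<close>
  moreover have "a N \<noteq> 0"
  proof
    assume aN: "a N = 0"
    have "((\<lambda>t. gd (x t) (axis k1 1) / t ^ N) \<longlongrightarrow> 0) (at 0)"
      using gdlim[OF N order_refl below, of "axis k1 1"] aN by simp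
    then have "((\<lambda>t. s * (real (N + 1) * (x t $ k1 / t ^ 1) ^ N)) \<longlongrightarrow> 0) (at 0)"
      by (simp add: gd_k1 power_divide)
    moreover have "((\<lambda>t. s * (real (N + 1) * (x t $ k1 / t ^ 1) ^ N)) \<longlongrightarrow> s * (real (N + 1) * (\<xi> $ k1) ^ N)) (at 0)"
      by (intro tendsto_mult tendsto_const tendsto_power xlim)
    ultimately have "s * (real (N + 1) * (\<xi> $ k1) ^ N) = 0" by (rule LIM_unique[rotated])
    then have "\<xi> $ k1 = 0" using s by (simp del: of_nat_Suc)
    moreover have "\<xi> $ j = 0" if "j \<noteq> k1" for j
    proof -
      have "((\<lambda>t. x t $ j / t ^ 1) \<longlongrightarrow> 0) (at 0)"
        by (rule power_tendsto_imp_zero[OF x_z_lim[OF N order_refl below that]]) (use N in auto)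
      with xlim show ?thesis by (rule LIM_unique)
    qed
    ultimately have "\<xi> = 0" by (metis vec_eq_iff zero_index)
    with \<xi>_nz show False ..
  qed
  ultimately show ?thesis by blast
qed

corollary nondeg_normal_form_necessary:
  assumes "2 \<le> N" "s \<noteq> 0" and Q: "nondeg_quadratic_form_z Q"
    and "reduces_to f (\<lambda>x. C0 + s * (x $ k1) ^ (N + 1) + Q x)"
  shows "(\<forall>j. 2 \<le> j \<and> j < N \<longrightarrow> a j = 0) \<and> a N \<noteq> 0"
proof -
  obtain q :: "'n rmat" where q: "transpose q = q"
    "\<forall>x. Q x = (\<Sum>i\<in>-{k1}. \<Sum>j\<in>-{k1}. q $ i $ j * x $ i * x $ j)"
    "\<forall>u :: 'n rvec. (\<forall>i\<in>-{k1}. (\<Sum>j\<in>-{k1}. q $ i $ j * u $ j) = 0) \<longrightarrow> (\<forall>j\<in>-{k1}. u $ j = 0)"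
    using Q unfolding nondeg_quadratic_form_z_def by blast
  show ?thesis
    by (rule normal_form_necessary[OF assms(1,2) q(1) _ _ assms(4)]) (use q(2,3) in auto)
qed

end

subsection \<open>Functions with a critical point of corank 1\<close>

lemma second_differential_eq:
  fixes f :: "'n::{finite,linorder} rvec \<Rightarrow> real"
  assumes sm: "smooth_on UNIV f"
  shows "second_differential f x v w = (\<Sum>j\<in>UNIV. w $ j * (\<Sum>i\<in>UNIV. v $ i * mixed_partial {#i, j#} f x))"
proof -
  have "((\<lambda>u. \<Sum>j\<in>UNIV. w $ j * mixed_partial {#j#} f u) has_derivative
      (\<lambda>v. \<Sum>j\<in>UNIV. w $ j * frechet_derivative (mixed_partial {#j#} f) (at x) v)) (at x)"
    by (intro has_derivative_sum has_derivative_mult_right smooth_onD(1)[OF smooth_mixed_partial[OF sm] UNIV_I])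
  moreover have "(\<lambda>u. frechet_derivative f (at u) w) = (\<lambda>u. \<Sum>j\<in>UNIV. w $ j * mixed_partial {#j#} f u)"
    by (simp add: frechet_derivative_partials[OF sm] mixed_partial_add_mset[OF sm])
  ultimately have "frechet_derivative (\<lambda>u. frechet_derivative f (at u) w) (at x) =
      (\<lambda>v. \<Sum>j\<in>UNIV. w $ j * frechet_derivative (mixed_partial {#j#} f) (at x) v)"
    by (simp only: frechet_derivative_at[symmetric])
  then show ?thesis
    unfolding second_differential_def frechet_derivative_partials[OF smooth_mixed_partial[OF sm]]
      mixed_partial_add_mset[OF sm, symmetric] by simp
qed

text \<open>The condition under \<open>THE\<close> in \<open>z_inverse\<close>, named in order to
  prove existence and uniqueness.\<close>

definition is_z_inverse :: "'n::{finite,linorder} rmat \<Rightarrow> 'n rmat \<Rightarrow> bool" where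
  "is_z_inverse A G \<longleftrightarrow> (\<forall>i j. i = k1 \<or> j = k1 \<longrightarrow> G $ i $ j = 0) \<and>
     (\<forall>i j. i \<noteq> k1 \<and> j \<noteq> k1 \<longrightarrow>
        (\<Sum>l\<in>-{k1}. A $ i $ l * G $ l $ j) = (if i = j then 1 else 0) \<and>
        (\<Sum>l\<in>-{k1}. G $ i $ l * A $ l $ j) = (if i = j then 1 else 0))"

lemma is_z_inverse_unique:
  assumes 1: "is_z_inverse A G" and 2: "is_z_inverse A G'"
  shows "G = G'"
proof -
  have "G $ i $ j = G' $ i $ j" for i j
  proof (cases "i = k1 \<or> j = k1")
    case True
    then show ?thesis using 1 2 by (auto simp: is_z_inverse_def)
  next
    case False
    then have ij: "i \<noteq> k1" "j \<noteq> k1" by auto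
    have "G $ i $ j = (\<Sum>l\<in>-{k1}. G $ i $ l * (if l = j then 1 else 0))"
      using ij by (simp add: if_distrib[of "\<lambda>c. _ * c"] sum.delta' cong: if_cong)
    also have "\<dots> = (\<Sum>l\<in>-{k1}. G $ i $ l * (\<Sum>m\<in>-{k1}. A $ l $ m * G' $ m $ j))"
      using 2 ij by (intro sum.cong) (auto simp: is_z_inverse_def)
    also have "\<dots> = (\<Sum>m\<in>-{k1}. (\<Sum>l\<in>-{k1}. G $ i $ l * A $ l $ m) * G' $ m $ j)"
      unfolding sum_distrib_left sum_distrib_right by (subst sum.swap) (simp add: mult_ac)
    also have "\<dots> = (\<Sum>m\<in>-{k1}. (if i = m then 1 else 0) * G' $ m $ j)"
      using 1 ij by (intro sum.cong) (auto simp: is_z_inverse_def)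
    also have "\<dots> = G' $ i $ j"
      using ij by (simp add: if_distrib[of "\<lambda>c. c * _"] sum.delta cong: if_cong)
    finally show ?thesis .
  qed
  then show ?thesis by (simp add: vec_eq_iff)
qed

text \<open>Completing the z-block by a 1 at the place of \<open>k1\<close> yields a matrix over the
  full index type with trivial kernel, which can be inverted even if there are no z-indices.\<close>

lemma is_z_inverse_exists:
  fixes A :: "'n::{finite,linorder} rmat"
  assumes "\<And>v :: 'n rvec. v $ k1 = 0 \<Longrightarrow> (\<And>i. i \<noteq> k1 \<Longrightarrow> (\<Sum>j\<in>-{k1}. A $ i $ j * v $ j) = 0) \<Longrightarrow> v = 0"
  shows "\<exists>G. is_z_inverse A G"
proof -
  define A' :: "'n rmat" where "A' = (\<chi> i j. if i = k1 \<or> j = k1 then (if i = j then 1 else 0) else A $ i $ j)"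
  have "v = 0" if v: "A' *v v = 0" for v
  proof (rule assms)
    have c: "(\<Sum>j\<in>UNIV. A' $ i $ j * v $ j) = 0" for i
      using arg_cong[OF v, of "\<lambda>u. u $ i"] by (simp add: matrix_vector_mult_def)
    have "(\<Sum>j\<in>UNIV. A' $ k1 $ j * v $ j) = (\<Sum>j\<in>UNIV. if k1 = j then v $ j else 0)"
      by (intro sum.cong) (auto simp: A'_def)
    then show "v $ k1 = 0" using c[of k1] by simp
    fix i :: 'n assume i: "i \<noteq> k1"
    have "(\<Sum>j\<in>UNIV. A' $ i $ j * v $ j) = (\<Sum>j\<in>-{k1}. A' $ i $ j * v $ j)"
      by (rule sum_UNIV_z) (use i in \<open>simp add: A'_def\<close>)
    also have "\<dots> = (\<Sum>j\<in>-{k1}. A $ i $ j * v $ j)"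
      by (intro sum.cong) (use i in \<open>auto simp: A'_def\<close>)
    finally show "(\<Sum>j\<in>-{k1}. A $ i $ j * v $ j) = 0" using c[of i] by simp
  qed
  then obtain B where B: "B ** A' = mat 1"
    using matrix_left_invertible_ker[of A'] by blast
  then have B': "A' ** B = mat 1" by (simp add: matrix_left_right_inverse)
  have "is_z_inverse A (\<chi> i j. if i = k1 \<or> j = k1 then 0 else B $ i $ j)"
    unfolding is_z_inverse_def
  proof (intro conjI allI impI)
    fix i j :: 'n assume "i \<noteq> k1 \<and> j \<noteq> k1"
    then have ij: "i \<noteq> k1" "j \<noteq> k1" by auto
    have "(\<Sum>l\<in>UNIV. A' $ i $ l * B $ l $ j) = (if i = j then 1 else 0)"
      using arg_cong[OF B', of "\<lambda>M. M $ i $ j"] by (simp add: matrix_matrix_mult_def mat_def)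
    moreover have "(\<Sum>l\<in>UNIV. A' $ i $ l * B $ l $ j) = (\<Sum>l\<in>-{k1}. A' $ i $ l * B $ l $ j)"
      by (rule sum_UNIV_z) (use ij in \<open>simp add: A'_def\<close>)
    moreover have "(\<Sum>l\<in>-{k1}. A $ i $ l * (\<chi> i j. if i = k1 \<or> j = k1 then 0 else B $ i $ j) $ l $ j)
        = (\<Sum>l\<in>-{k1}. A' $ i $ l * B $ l $ j)"
      by (intro sum.cong) (use ij in \<open>auto simp: A'_def\<close>)
    ultimately show "(\<Sum>l\<in>-{k1}. A $ i $ l * (\<chi> i j. if i = k1 \<or> j = k1 then 0 else B $ i $ j) $ l $ j)
        = (if i = j then 1 else 0)" by simp
    have "(\<Sum>l\<in>UNIV. B $ i $ l * A' $ l $ j) = (if i = j then 1 else 0)"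
      using arg_cong[OF B, of "\<lambda>M. M $ i $ j"] by (simp add: matrix_matrix_mult_def mat_def)
    moreover have "(\<Sum>l\<in>UNIV. B $ i $ l * A' $ l $ j) = (\<Sum>l\<in>-{k1}. B $ i $ l * A' $ l $ j)"
      by (rule sum_UNIV_z) (use ij in \<open>simp add: A'_def\<close>)
    moreover have "(\<Sum>l\<in>-{k1}. (\<chi> i j. if i = k1 \<or> j = k1 then 0 else B $ i $ j) $ i $ l * A $ l $ j)
        = (\<Sum>l\<in>-{k1}. B $ i $ l * A' $ l $ j)"
      by (intro sum.cong) (use ij in \<open>auto simp: A'_def\<close>)
    ultimately show "(\<Sum>l\<in>-{k1}. (\<chi> i j. if i = k1 \<or> j = k1 then 0 else B $ i $ j) $ i $ l * A $ l $ j)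
        = (if i = j then 1 else 0)" by simp
  qed auto
  then show ?thesis by blast
qed

text \<open>A set, because one polynomial has to serve all these functions at once.\<close>

definition corank_one_functions :: "('n::{finite,linorder} rvec \<Rightarrow> real) set" where
  "corank_one_functions = {f. smooth_on UNIV f \<and> (f has_derivative (\<lambda>_. 0)) (at 0) \<and>
     kernel_second_differential f 0 = range (\<lambda>t. t *\<^sub>R axis k1 1)}"

text \<open>That the axis lies in the kernel gives f_yy = 0 and f_yz = 0. That the kernel is no
  larger makes f_zz invertible: a vector without first component that f_zz annihilates lies in the
  kernel, so it is a multiple of the axis and hence 0.\<close>

lemma corank_one_jet_of_function:
  fixes f :: "'n::{finite,linorder} rvec \<Rightarrow> real"
  assumes "f \<in> corank_one_functions"
  shows "corank_one_jet (\<lambda>\<alpha>. mixed_partial \<alpha> f 0) (Gmat f)"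
proof -
  have sm: "smooth_on UNIV f" and der: "(f has_derivative (\<lambda>_. 0)) (at 0)"
    and ker: "kernel_second_differential f 0 = range (\<lambda>t. t *\<^sub>R axis k1 1)"
    using assms by (auto simp: corank_one_functions_def)
  let ?D = "\<lambda>\<alpha>. mixed_partial \<alpha> f 0"
  have D1: "?D {#i#} = 0" for i
    using fun_cong[OF frechet_derivative_at[OF der], of "axis i 1"]
    by (simp add: mixed_partial_add_mset[OF sm] partial_deriv_def)
  have D2: "?D {#k1, i#} = 0" for i
  proof -
    have "axis k1 1 \<in> kernel_second_differential f 0" unfolding ker by (rule range_eqI[of _ _ 1]) simp
    then have "second_differential f 0 (axis k1 1) (axis i 1) = 0"
      by (simp add: kernel_second_differential_def)
    moreover have "second_differential f 0 (axis k1 1) (axis i 1) = ?D {#k1, i#}"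
      by (simp add: second_differential_eq[OF sm] axis_def if_distrib[of "\<lambda>c. c * _"] sum.delta cong: if_cong)
    ultimately show ?thesis by simp
  qed
  let ?H = "\<chi> i j. ?D {#i, j#}"
  have "v = 0" if v: "v $ k1 = 0" "\<And>i. i \<noteq> k1 \<Longrightarrow> (\<Sum>j\<in>-{k1}. ?H $ i $ j * v $ j) = 0" for v :: "'n rvec"
  proof -
    have row: "(\<Sum>i\<in>UNIV. v $ i * ?D {#i, j#}) = 0" for j
    proof (cases "j = k1")
      case True
      then show ?thesis using D2 by (simp add: add_mset_commute)
    next
      case False
      have "(\<Sum>i\<in>UNIV. v $ i * ?D {#i, j#}) = (\<Sum>i\<in>-{k1}. v $ i * ?D {#i, j#})"
        by (rule sum_UNIV_z) (simp add: v(1))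
      also have "\<dots> = 0"
        using v(2)[OF False] by (simp add: mult.commute add_mset_commute)
      finally show ?thesis .
    qed
    have "v \<in> kernel_second_differential f 0"
      unfolding kernel_second_differential_def second_differential_eq[OF sm] by (simp add: row)
    then obtain t where "v = t *\<^sub>R axis k1 1" unfolding ker by blast
    then show ?thesis using v(1) by simp
  qed
  then have ex: "\<exists>G. is_z_inverse ?H G" by (rule is_z_inverse_exists)
  have "Gmat f = (THE G. is_z_inverse ?H G)"
    unfolding Gmat_def z_inverse_def is_z_inverse_def ..
  then have G: "is_z_inverse ?H (Gmat f)"
    using ex is_z_inverse_unique by (metis (no_types, lifting) theI)
  show ?thesis
    by unfold_locales (use D1 D2 G in \<open>auto simp: is_z_inverse_def\<close>)
qed

lemma bvec_eq: "bvec f = corank_one_jet.b (\<lambda>\<alpha>. mixed_partial \<alpha> f 0)"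
  if "corank_one_jet (\<lambda>\<alpha>. mixed_partial \<alpha> f 0) G"
  by (rule ext) (simp add: bvec_def corank_one_jet.b_def[OF that])

lemma Mmat_eq: "Mmat f = corank_one_jet.M (\<lambda>\<alpha>. mixed_partial \<alpha> f 0)"
  if "corank_one_jet (\<lambda>\<alpha>. mixed_partial \<alpha> f 0) G"
  by (rule ext) (simp add: Mmat_def corank_one_jet.M_def[OF that])

lemma Tform_eq: "Tform f = corank_one_jet.T (\<lambda>\<alpha>. mixed_partial \<alpha> f 0)"
  if "corank_one_jet (\<lambda>\<alpha>. mixed_partial \<alpha> f 0) G"
  by (intro ext) (simp add: Tform_def corank_one_jet.T_def[OF that])

lemma type_A_plus_eq: "type_A_plus \<mu> f \<longleftrightarrow> (\<exists>c Q. nondeg_quadratic_form_z Q \<and>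
    reduces_to f (\<lambda>x. c + 1 * (x $ k1) ^ (\<mu> + 1) + Q x))"
  by (simp add: type_A_plus_def)

lemma type_A_minus_eq: "type_A_minus \<mu> f \<longleftrightarrow> (\<exists>c Q. nondeg_quadratic_form_z Q \<and>
    reduces_to f (\<lambda>x. c + (- 1) * (x $ k1) ^ (\<mu> + 1) + Q x))"
  by (simp add: type_A_minus_def)

theorem mainTheorem2:
  "\<exists>P :: nat \<Rightarrow> 'n::{finite,linorder} jet_var int_mpoly.
     (\<forall>\<mu>\<ge>2. Poly_Mapping.lookup (P \<mu>) 0 = 0 \<and> mpoly_vars (P \<mu>) \<subseteq> admissible_vars \<mu>) \<and>
     (\<forall>f :: 'n rvec \<Rightarrow> real.
        smooth_on UNIV f \<longrightarrow>
        (f has_derivative (\<lambda>_. 0)) (at 0) \<longrightarrow>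
        kernel_second_differential f 0 = range (\<lambda>t. t *\<^sub>R axis k1 1) \<longrightarrow>
        (\<exists>a :: nat \<Rightarrow> real.
           (\<forall>\<mu>\<ge>2. a \<mu> = fy f (\<mu> + 1) + mpoly_eval (jet_value f) (P \<mu>)) \<and>
           (let G = Gmat f; b = bvec f; M = Mmat f; T = Tform f in
              a 2 = fy f 3 \<and>
              a 3 = fy f 4 - 3 * (b 2 \<bullet> (G *v b 2)) \<and>
              a 4 = fy f 5 - 10 * (b 2 \<bullet> (G *v b 3))
                    + 15 * (b 2 \<bullet> (G *v (M 1 *v (G *v b 2)))) \<and>
              a 5 = fy f 6 - 15 * (b 2 \<bullet> (G *v b 4))
                    + 60 * (b 2 \<bullet> (G *v (M 1 *v (G *v b 3))))
                    - 90 * (b 2 \<bullet> (G *v (M 1 *v (G *v (M 1 *v (G *v b 2))))))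
                    - 10 * (b 3 \<bullet> (G *v b 3))
                    + 45 * (b 2 \<bullet> (G *v (M 2 *v (G *v b 2))))
                    - 15 * T (G *v b 2) (G *v b 2) (G *v b 2)) \<and>
           (\<forall>\<mu>\<ge>2. type_A \<mu> f \<longleftrightarrow> (\<forall>j\<in>{2..<\<mu>}. a j = 0) \<and> a \<mu> \<noteq> 0) \<and>
           (\<forall>\<mu>\<ge>2. (\<forall>j\<in>{2..<\<mu>}. a j = 0) \<and> a \<mu> \<noteq> 0 \<longrightarrow>
              (\<exists>c Q. nondeg_quadratic_form_z Q \<and>
                 reduces_to f (\<lambda>x. c + a \<mu> * (x $ k1) ^ (\<mu> + 1) + Q x)) \<and>
              (a \<mu> > 0 \<longrightarrow> type_A_plus \<mu> f) \<and>
              (a \<mu> < 0 \<longrightarrow> type_A_minus \<mu> f))))"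
proof -
  define am where "am f = corank_one_jet.a (\<lambda>\<alpha>. mixed_partial \<alpha> f 0) (Gmat f)" for f :: "'n rvec \<Rightarrow> real"
  \<comment> \<open>The polynomial is obtained before any f is fixed, so it depends only on \<mu>
    and the index type.\<close>
  have "\<exists>p. \<mu> \<ge> 2 \<longrightarrow> Poly_Mapping.lookup p 0 = 0 \<and> mpoly_vars p \<subseteq> admissible_vars \<mu> \<and>
      (\<forall>f\<in>corank_one_functions. am f \<mu> - fy f (\<mu> + 1) = mpoly_eval (jet_value f) p)" for \<mu>
    using rep_a[of corank_one_functions "\<lambda>f \<alpha>. mixed_partial \<alpha> f 0" Gmat jet_value \<mu>] corank_one_jet_of_function
    unfolding int_poly_rep_def am_def fy_def by fastforce
  then obtain P where P: "\<And>\<mu>. \<mu> \<ge> 2 \<Longrightarrow> Poly_Mapping.lookup (P \<mu>) 0 = 0 \<and> mpoly_vars (P \<mu>) \<subseteq> admissible_vars \<mu> \<and>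
      (\<forall>f\<in>corank_one_functions. am f \<mu> - fy f (\<mu> + 1) = mpoly_eval (jet_value f) (P \<mu>))"
    by metis
  show ?thesis
  proof (intro exI[of _ P] conjI allI impI)
    fix f :: "'n rvec \<Rightarrow> real"
    assume f: "smooth_on UNIV f" "(f has_derivative (\<lambda>_. 0)) (at 0)"
      "kernel_second_differential f 0 = range (\<lambda>t. t *\<^sub>R axis k1 1)"
    then have fA: "f \<in> corank_one_functions" by (simp add: corank_one_functions_def)
    note jet = corank_one_jet_of_function[OF fA]
    interpret corank_one_jet "\<lambda>\<alpha>. mixed_partial \<alpha> f 0" "Gmat f" by (rule jet)
    have curve: "adapted_curve f (Gmat f)" using f(1) jet by unfold_locales (auto simp: corank_one_jet_def)
    have nf: "\<exists>Q. nondeg_quadratic_form_z Q \<and> reduces_to f (\<lambda>x. f 0 + s * (x $ k1) ^ (\<mu> + 1) + Q x)"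
      if "\<mu> \<ge> 2" "\<forall>j\<in>{2..<\<mu>}. am f j = 0" "s * am f \<mu> > 0" for \<mu> s
      using adapted_curve.normal_form[OF curve, of \<mu> s] that unfolding am_def by auto
    have nec: "(\<forall>j\<in>{2..<\<mu>}. am f j = 0) \<and> am f \<mu> \<noteq> 0"
      if "\<mu> \<ge> 2" "s \<noteq> 0" "nondeg_quadratic_form_z Q" "reduces_to f (\<lambda>x. c + s * (x $ k1) ^ (\<mu> + 1) + Q x)" for \<mu> s c Q
      using adapted_curve.nondeg_normal_form_necessary[OF curve that] unfolding am_def by auto
    have plus: "type_A_plus \<mu> f" if "\<mu> \<ge> 2" "\<forall>j\<in>{2..<\<mu>}. am f j = 0" "am f \<mu> > 0" for \<mu>
      unfolding type_A_plus_eq using nf[of \<mu> 1] that by auto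
    have minus: "type_A_minus \<mu> f" if "\<mu> \<ge> 2" "\<forall>j\<in>{2..<\<mu>}. am f j = 0" "am f \<mu> < 0" for \<mu>
      unfolding type_A_minus_eq using nf[of \<mu> "- 1"] that by auto
    have iff: "type_A \<mu> f \<longleftrightarrow> (\<forall>j\<in>{2..<\<mu>}. am f j = 0) \<and> am f \<mu> \<noteq> 0" if \<mu>: "\<mu> \<ge> 2" for \<mu>
    proof
      assume "type_A \<mu> f"
      then show "(\<forall>j\<in>{2..<\<mu>}. am f j = 0) \<and> am f \<mu> \<noteq> 0"
        unfolding type_A_def type_A_plus_eq type_A_minus_eq
        using nec[OF \<mu>, of 1] nec[OF \<mu>, of "- 1"] by fastforce
    next
      assume "(\<forall>j\<in>{2..<\<mu>}. am f j = 0) \<and> am f \<mu> \<noteq> 0"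
      then show "type_A \<mu> f"
        unfolding type_A_def using plus[OF \<mu>] minus[OF \<mu>] by (cases "am f \<mu> > 0") auto
    qed
    show "\<exists>a :: nat \<Rightarrow> real.
           (\<forall>\<mu>\<ge>2. a \<mu> = fy f (\<mu> + 1) + mpoly_eval (jet_value f) (P \<mu>)) \<and>
           (let G = Gmat f; b = bvec f; M = Mmat f; T = Tform f in
              a 2 = fy f 3 \<and>
              a 3 = fy f 4 - 3 * (b 2 \<bullet> (G *v b 2)) \<and>
              a 4 = fy f 5 - 10 * (b 2 \<bullet> (G *v b 3))
                    + 15 * (b 2 \<bullet> (G *v (M 1 *v (G *v b 2)))) \<and>
              a 5 = fy f 6 - 15 * (b 2 \<bullet> (G *v b 4))
                    + 60 * (b 2 \<bullet> (G *v (M 1 *v (G *v b 3))))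
                    - 90 * (b 2 \<bullet> (G *v (M 1 *v (G *v (M 1 *v (G *v b 2))))))
                    - 10 * (b 3 \<bullet> (G *v b 3))
                    + 45 * (b 2 \<bullet> (G *v (M 2 *v (G *v b 2))))
                    - 15 * T (G *v b 2) (G *v b 2) (G *v b 2)) \<and>
           (\<forall>\<mu>\<ge>2. type_A \<mu> f \<longleftrightarrow> (\<forall>j\<in>{2..<\<mu>}. a j = 0) \<and> a \<mu> \<noteq> 0) \<and>
           (\<forall>\<mu>\<ge>2. (\<forall>j\<in>{2..<\<mu>}. a j = 0) \<and> a \<mu> \<noteq> 0 \<longrightarrow>
              (\<exists>c Q. nondeg_quadratic_form_z Q \<and>
                 reduces_to f (\<lambda>x. c + a \<mu> * (x $ k1) ^ (\<mu> + 1) + Q x)) \<and>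
              (a \<mu> > 0 \<longrightarrow> type_A_plus \<mu> f) \<and>
              (a \<mu> < 0 \<longrightarrow> type_A_minus \<mu> f))"
    proof (intro exI[of _ "am f"] conjI allI impI)
      show "am f \<mu> = fy f (\<mu> + 1) + mpoly_eval (jet_value f) (P \<mu>)" if "2 \<le> \<mu>" for \<mu>
        using P[OF that] fA by (metis add.commute diff_add_cancel)
      show "let G = Gmat f; b = bvec f; M = Mmat f; T = Tform f in
              am f 2 = fy f 3 \<and>
              am f 3 = fy f 4 - 3 * (b 2 \<bullet> (G *v b 2)) \<and>
              am f 4 = fy f 5 - 10 * (b 2 \<bullet> (G *v b 3))
                    + 15 * (b 2 \<bullet> (G *v (M 1 *v (G *v b 2)))) \<and>
              am f 5 = fy f 6 - 15 * (b 2 \<bullet> (G *v b 4))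
                    + 60 * (b 2 \<bullet> (G *v (M 1 *v (G *v b 3))))
                    - 90 * (b 2 \<bullet> (G *v (M 1 *v (G *v (M 1 *v (G *v b 2))))))
                    - 10 * (b 3 \<bullet> (G *v b 3))
                    + 45 * (b 2 \<bullet> (G *v (M 2 *v (G *v b 2))))
                    - 15 * T (G *v b 2) (G *v b 2) (G *v b 2)"
        unfolding Let_def bvec_eq[OF jet] Mmat_eq[OF jet] Tform_eq[OF jet] fy_def am_def
        using a_2 a_3 a_4 a_5 by blast
      show "type_A \<mu> f = ((\<forall>j\<in>{2..<\<mu>}. am f j = 0) \<and> am f \<mu> \<noteq> 0)" if "2 \<le> \<mu>" for \<mu>
        by (rule iff[OF that])
      fix \<mu> :: nat
      assume \<mu>: "2 \<le> \<mu>" and *: "(\<forall>j\<in>{2..<\<mu>}. am f j = 0) \<and> am f \<mu> \<noteq> 0"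
      \<comment> \<open>With the factor a_\<mu> itself the sign condition in \<open>nf\<close>
        becomes the positivity of a square.\<close>
      then have "am f \<mu> * am f \<mu> > 0" by (simp add: zero_less_mult_iff linorder_neq_iff disj_commute)
      then show "\<exists>c Q. nondeg_quadratic_form_z Q \<and> reduces_to f (\<lambda>x. c + am f \<mu> * (x $ k1) ^ (\<mu> + 1) + Q x)"
        using nf[OF \<mu>, of "am f \<mu>"] * by blast
      show "type_A_plus \<mu> f" if "am f \<mu> > 0" using plus[OF \<mu>] * that by blast
      show "type_A_minus \<mu> f" if "am f \<mu> < 0" using minus[OF \<mu>] * that by blast
    qed
  qed (use P in blast)+
qed

end
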